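(* Let $b:\mathbb{R}_+\times\mathbb{R}^d\to\mathbb{R}^d$ be a measurable vector field with $\|b\|_\infty+\|\nabla b\|_\infty<\infty$, and let $X_0$ be an $\mathcal F_0$-measurable $\mathbb{R}^d$-valued random variable. Let $X$ be the unique solution of $$X_t=X_0+\int_0^t b(s,X_s)\,ds,$$ and for $\varepsilon\in(0,1)$ let $X^\varepsilon$ be the solution of $$X^\varepsilon_t=X_0+\int_0^t\varepsilon\, b(s,X^\varepsilon_{s-})\,d\mathcal N^\varepsilon_s .$$ (i) (Strong convergence) For any $T>0$, $$\mathbb{E}\Big(\sup_{t\in[0,T]}|X^\varepsilon_t-X_t|^2\Big)\le 4\,e^{2\|\nabla b\|_\infty T}\|b\|_\infty^2\,T\,\varepsilon,\qquad \varepsilon\in(0,1).$$ (ii) (Weak convergence) If in addition $\|\nabla^2 b\|_\infty<\infty$, then for any $T>0$ there is a constant $C=C(T,\|b\|_{C^2_b})>0$ such that for any $f:\mathbb{R}^d\to\mathbb{R}$ with $\|\nabla f\|_{C^1_b}<\infty$ and any $t\in[0,T]$, $$|\mathbb{E} f(X^\varepsilon_t)-\mathbb{E} f(X_t)|\le C\|\nabla f\|_{C^1_b}\,\varepsilon,\qquad \varepsilon\in(0,1).$$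
   Context: $(\mathcal N_t)_{t\ge0}$ is a standard Poisson process of intensity $1$ on a probability space $(\Omega,\mathcal F,\mathbb P)$, and $\mathcal N^\varepsilon_t:=\mathcal N_{t/\varepsilon}$, a Poisson process with intensity $1/\varepsilon$. $\mathcal F_0\subset\mathcal F$ is a sub-$\sigma$-field independent of $(\mathcal N_t)_{t\ge 0}$. The equation for $X^\varepsilon$ is solved recursively over the jump times: $X^\varepsilon$ is constant between jumps of $\mathcal N^\varepsilon$ and at a jump time $s$ it jumps by $\varepsilon b(s,X^\varepsilon_{s-})$, where $X^\varepsilon_{s-}$ is the left limit. $\|\cdot\|_\infty$ is the $L^\infty$-norm over $\mathbb{R}_+\times\mathbb{R}^d$ (or over $\mathbb{R}^d$ for functions of $x$ only); $\nabla,\nabla^2$ are derivatives in $x$; $\|b\|_\infty+\|\nabla b\|_\infty<\infty$ means that $b$ is bounded and Lipschitz in $x$ uniformly in time, $\|\nabla b\|_\infty$ being the uniform Lipschitz constant. $\|b\|_{C^2_b}:=\|b\|_\infty+\|\nabla b\|_\infty+\|\nabla^2b\|_\infty$ and $\|\nabla f\|_{C^1_b}:=\|\nabla f\|_\infty+\|\nabla^2 f\|_\infty$. *)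

theory Defs
  imports "HOL-Probability.Probability"
begin

text \<open>All norms are \<^typ>\<open>ennreal\<close>-valued, so that ``norm \<open>< \<infinity>\<close>'' is a genuine condition.
  Vector fields are total functions of a real time variable; only times \<open>t \<ge> 0\<close> matter.\<close>

definition Linf_norm :: "(real \<Rightarrow> 'v::euclidean_space \<Rightarrow> 'w::real_normed_vector) \<Rightarrow> ennreal" where
  "Linf_norm b = esssup (restrict_space lborel ({0..} \<times> UNIV)) (\<lambda>(t, x). ennreal (norm (b t x)))"

text \<open>The norm \<open>\<parallel>\<nabla>g\<parallel>\<^sub>\<infinity>\<close> of a function of \<open>x\<close> only is its least Lipschitz constant (\<open>\<infinity>\<close> if there is
  none). Lemma \<open>grad_norm_eq_SUP\<close> below identifies it with the supremum of \<open>\<parallel>Dg(x)\<parallel>\<close>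
  (operator norm) when \<open>g\<close> is differentiable.\<close>

definition grad_norm :: "('v::real_normed_vector \<Rightarrow> 'w::real_normed_vector) \<Rightarrow> ennreal" where
  "grad_norm g = Inf {ennreal L | L. L-lipschitz_on UNIV g}"

definition gradient_map ::
  "('v::real_normed_vector \<Rightarrow> 'w::real_normed_vector) \<Rightarrow> 'v \<Rightarrow> ('v \<Rightarrow>\<^sub>L 'w)" where
  "gradient_map g x = Blinfun (frechet_derivative g (at x))"

text \<open>\<open>\<parallel>\<nabla>\<^sup>2g\<parallel>\<^sub>\<infinity>\<close> is \<open>\<parallel>\<nabla>(\<nabla>g)\<parallel>\<^sub>\<infinity>\<close> in the same sense. If \<open>g\<close> is twice differentiable this is the supremum
  of the operator norms of the second derivative; finiteness allows all of \<open>C\<^sup>1\<^sup>,\<^sup>1\<close>.\<close>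

definition hess_norm :: "('v::real_normed_vector \<Rightarrow> 'w::real_normed_vector) \<Rightarrow> ennreal" where
  "hess_norm g = (if \<forall>x. g differentiable (at x) then grad_norm (gradient_map g) else \<infinity>)"

text \<open>Essential supremum over times \<open>t \<ge> 0\<close>. Unlike \<^const>\<open>esssup\<close> it needs no
  measurability of \<open>\<phi>\<close>, which is not obvious for \<open>t \<mapsto> \<parallel>\<nabla>b(t,\<cdot>)\<parallel>\<^sub>\<infinity>\<close>.\<close>

definition esssup_time :: "(real \<Rightarrow> ennreal) \<Rightarrow> ennreal" where
  "esssup_time \<phi> = Inf {c. AE t in lborel. 0 \<le> t \<longrightarrow> \<phi> t \<le> c}"

definition Linf_grad :: "(real \<Rightarrow> 'v::real_normed_vector \<Rightarrow> 'w::real_normed_vector) \<Rightarrow> ennreal" where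
  "Linf_grad b = esssup_time (\<lambda>t. grad_norm (b t))"

definition Linf_hess :: "(real \<Rightarrow> 'v::real_normed_vector \<Rightarrow> 'w::real_normed_vector) \<Rightarrow> ennreal" where
  "Linf_hess b = esssup_time (\<lambda>t. hess_norm (b t))"

definition C2b_norm :: "(real \<Rightarrow> 'v::euclidean_space \<Rightarrow> 'w::real_normed_vector) \<Rightarrow> ennreal" where
  "C2b_norm b = Linf_norm b + Linf_grad b + Linf_hess b"

definition grad_C1b_norm :: "('v::real_normed_vector \<Rightarrow> real) \<Rightarrow> ennreal" where
  "grad_C1b_norm f = grad_norm f + hess_norm f"

lemma grad_norm_eq_SUP:
  fixes g :: "'v::real_normed_vector \<Rightarrow> 'w::real_normed_vector"
  assumes g: "\<And>x. (g has_derivative blinfun_apply (g' x)) (at x)"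
  shows "grad_norm g = (SUP x. ennreal (norm (g' x)))"
proof (rule antisym)
  show "(SUP x. ennreal (norm (g' x))) \<le> grad_norm g"
    unfolding grad_norm_def
  proof (rule Inf_greatest, clarify, rule SUP_least)
    fix L x assume L: "L-lipschitz_on UNIV g"
    have "norm (g' x v) \<le> L * norm v" for v
    proof (rule field_le_epsilon)
      fix e :: real assume "e > 0"
      define e' where "e' = e / (norm v + 1)"
      have nv: "norm v + 1 > 0" by (simp add: add_nonneg_pos)
      have e': "e' > 0" using \<open>e > 0\<close> nv by (simp add: e'_def)
      obtain d where d: "d > 0"
        "\<And>y. norm (y - x) < d \<Longrightarrow> norm (g y - g x - g' x (y - x)) \<le> e' * norm (y - x)"
        using g[of x] e' unfolding has_derivative_at_alt by blast
      define s where "s = d / (norm v + 1)"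
      have s: "s > 0" using d nv by (simp add: s_def)
      have "s * norm v < s * (norm v + 1)" using s by simp
      also have "\<dots> = d" using nv by (simp add: s_def)
      finally have "norm (g (x + s *\<^sub>R v) - g x - g' x (s *\<^sub>R v)) \<le> e' * (s * norm v)"
        using d(2)[of "x + s *\<^sub>R v"] s by simp
      moreover have "norm (g (x + s *\<^sub>R v) - g x) \<le> L * (s * norm v)"
        using L[THEN lipschitz_onD, of "x + s *\<^sub>R v" x] s by (simp add: dist_norm)
      ultimately have "norm (g' x (s *\<^sub>R v)) \<le> L * (s * norm v) + e' * (s * norm v)"
        using norm_triangle_sub[of "g' x (s *\<^sub>R v)" "g (x + s *\<^sub>R v) - g x"]
        by (simp add: norm_minus_commute)
      then have "s * norm (g' x v) \<le> s * (L * norm v + e' * norm v)"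
        using s by (simp add: blinfun.scaleR_right algebra_simps)
      then have "norm (g' x v) \<le> L * norm v + e' * norm v" using s by simp
      moreover have "e' * norm v \<le> e"
      proof -
        have "e' * norm v \<le> e' * (norm v + 1)" using e' by simp
        also have "\<dots> = e" using nv by (simp add: e'_def)
        finally show ?thesis .
      qed
      ultimately show "norm (g' x v) \<le> L * norm v + e" by linarith
    qed
    then have "norm (g' x) \<le> L"
      using lipschitz_on_nonneg[OF L] by (intro norm_blinfun_bound)
    then show "ennreal (norm (g' x)) \<le> ennreal L" by (rule ennreal_leI)
  qed
next
  define S where "S = (SUP x. ennreal (norm (g' x)))"
  show "grad_norm g \<le> S"
  proof (cases "S = \<infinity>")
    case False
    have le: "ennreal (norm (g' x)) \<le> S" for x unfolding S_def by (rule SUP_upper) simp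
    have "norm (g' x) \<le> enn2real S" for x
      using enn2real_mono[OF le[of x]] False by (simp add: top.not_eq_extremum)
    then have "(enn2real S)-lipschitz_on UNIV g"
      using g by (intro lipschitz_onI)
        (auto simp: dist_norm norm_blinfun.rep_eq[symmetric]
          intro!: differentiable_bound[where S = UNIV and f' = "\<lambda>x. blinfun_apply (g' x)"])
    then have "grad_norm g \<le> ennreal (enn2real S)"
      unfolding grad_norm_def by (intro Inf_lower) auto
    also have "\<dots> = S" using False by (simp add: top.not_eq_extremum)
    finally show ?thesis .
  qed simp
qed

lemma hess_norm_eq_SUP:
  fixes g :: "'v::real_normed_vector \<Rightarrow> 'w::real_normed_vector"
  assumes g: "\<And>x. (g has_derivative blinfun_apply (g' x)) (at x)"
    and g': "\<And>x. (g' has_derivative blinfun_apply (g'' x)) (at x)"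
  shows "hess_norm g = (SUP x. ennreal (norm (g'' x)))"
proof -
  have "gradient_map g = g'"
    using frechet_derivative_at[OF g]
    by (auto simp: gradient_map_def fun_eq_iff blinfun_apply_inverse simp flip: frechet_derivative_at[OF g])
  moreover have "\<forall>x. g differentiable (at x)" using g by (auto simp: differentiable_def)
  ultimately show ?thesis using grad_norm_eq_SUP[OF g'] by (simp add: hess_norm_def)
qed

text \<open>Processes are indexed by real times, but only times \<open>t \<ge> 0\<close> are constrained. The
  subtraction on \<^typ>\<open>nat\<close> is harmless because paths are almost surely nondecreasing. That all
  jumps have size 1 almost surely follows from the law of the increments.\<close>

definition poisson_process :: "'a measure \<Rightarrow> real \<Rightarrow> (real \<Rightarrow> 'a \<Rightarrow> nat) \<Rightarrow> bool" where
  "poisson_process M r N \<longleftrightarrow>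
     (\<forall>t\<ge>0. N t \<in> measurable M (count_space UNIV)) \<and>
     (AE \<omega> in M. N 0 \<omega> = 0 \<and> mono_on {0..} (\<lambda>t. N t \<omega>) \<and>
        (\<forall>t\<ge>0. continuous (at_right t) (\<lambda>s. real (N s \<omega>)))) \<and>
     (\<forall>s t. 0 \<le> s \<and> s < t \<longrightarrow>
        distr M (count_space UNIV) (\<lambda>\<omega>. N t \<omega> - N s \<omega>) = measure_pmf (poisson_pmf (r * (t - s)))) \<and>
     (\<forall>(\<tau>::nat \<Rightarrow> real) n. 0 \<le> \<tau> 0 \<and> mono \<tau> \<longrightarrow>
        prob_space.indep_vars M (\<lambda>_. count_space UNIV) (\<lambda>i \<omega>. N (\<tau> (Suc i)) \<omega> - N (\<tau> i) \<omega>) {..<n})"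

definition ode_solution :: "(real \<Rightarrow> 'v::euclidean_space \<Rightarrow> 'v) \<Rightarrow> 'v \<Rightarrow> (real \<Rightarrow> 'v) \<Rightarrow> bool" where
  "ode_solution b x0 x \<longleftrightarrow>
     (\<forall>t\<ge>0. set_integrable lborel {0..t} (\<lambda>s. b s (x s)) \<and>
             x t = x0 + (LINT s:{0..t}|lborel. b s (x s)))"

text \<open>The integral against a counting path \<open>n\<close> is the Lebesgue-Stieltjes integral over \<open>{0<..t}\<close>;
  \<open>max 0 s\<close> extends \<open>n\<close> constantly to negative times. For a counting path with unit
  jumps the equation says that \<open>x\<close> is constant between jumps of \<open>n\<close> and jumps by
  \<open>\<epsilon> b(s, x\<^bsub>s-\<^esub>)\<close> at a jump time \<open>s\<close>.\<close>

definition jump_solution ::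
  "real \<Rightarrow> (real \<Rightarrow> 'v::euclidean_space \<Rightarrow> 'v) \<Rightarrow> (real \<Rightarrow> nat) \<Rightarrow> 'v \<Rightarrow> (real \<Rightarrow> 'v) \<Rightarrow> bool" where
  "jump_solution \<epsilon> b n x0 x \<longleftrightarrow>
     (let \<mu> = interval_measure (\<lambda>s. real (n (max 0 s)));
          h = (\<lambda>s. \<epsilon> *\<^sub>R b s (Lim (at_left s) x))
      in \<forall>t\<ge>0. set_integrable \<mu> {0<..t} h \<and> x t = x0 + (LINT s:{0<..t}|\<mu>. h s))"

locale poisson_approximation = prob_space M
  for M :: "'a measure" +
  fixes F0 :: "'a measure"
    and N :: "real \<Rightarrow> 'a \<Rightarrow> nat"
    and b :: "real \<Rightarrow> 'v::euclidean_space \<Rightarrow> 'v"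
    and X0 :: "'a \<Rightarrow> 'v"
    and X :: "real \<Rightarrow> 'a \<Rightarrow> 'v"
    and Xe :: "real \<Rightarrow> real \<Rightarrow> 'a \<Rightarrow> 'v"
  assumes poisson: "poisson_process M 1 N"
    and F0_sub: "subalgebra M F0"
    and F0_indep: "indep_set (sets F0)
          (sigma_sets (space M) (\<Union>t\<in>{0..}. {N t -` A \<inter> space M | A. A \<in> UNIV}))"
    and b_measurable: "(\<lambda>(t, x). b t x) \<in> borel_measurable (restrict_space borel ({0..} \<times> UNIV))"
    and b_finite: "Linf_norm b + Linf_grad b < \<infinity>"
    and X0_measurable: "X0 \<in> borel_measurable F0"
    and X_measurable: "\<And>t. 0 \<le> t \<Longrightarrow> X t \<in> borel_measurable M"
    and X_solution: "AE \<omega> in M. ode_solution b (X0 \<omega>) (\<lambda>t. X t \<omega>)"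
    and Xe_measurable: "\<And>\<epsilon> t. 0 < \<epsilon> \<Longrightarrow> \<epsilon> < 1 \<Longrightarrow> 0 \<le> t \<Longrightarrow> Xe \<epsilon> t \<in> borel_measurable M"
    and Xe_solution: "\<And>\<epsilon>. 0 < \<epsilon> \<Longrightarrow> \<epsilon> < 1 \<Longrightarrow>
          AE \<omega> in M. jump_solution \<epsilon> b (\<lambda>t. N (t / \<epsilon>) \<omega>) (X0 \<omega>) (\<lambda>t. Xe \<epsilon> t \<omega>)"

end

theory Submission
  imports Defs
begin

text \<open>The jumps of \<open>N\<^sup>\<epsilon>\<close> arrive at rate \<open>1/\<epsilon>\<close> and each moves \<open>X\<^sup>\<epsilon>\<close> by \<open>\<epsilon> b\<close>, so on average
  \<open>X\<^sup>\<epsilon>\<close> drifts with velocity \<open>b\<close>: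
  \<open>X\<^sup>\<epsilon>\<^sub>t = X\<^sub>0 + M\<^sub>t + \<integral>\<^sub>0\<^sup>t b(s, X\<^sup>\<epsilon>\<^sub>s\<^sub>-) ds\<close>, where the compensated jump sum \<open>M\<close> is a martingale with
  \<open>E|M\<^sub>t|\<^sup>2 \<le> \<epsilon> \<parallel>b\<parallel>\<^sup>2 t\<close>.

  Strong convergence. The error satisfies \<open>|X\<^sup>\<epsilon>\<^sub>t - X\<^sub>t| \<le> |M\<^sub>t| + L \<integral>\<^sub>0\<^sup>t |X\<^sup>\<epsilon>\<^sub>s - X\<^sub>s| ds\<close> path by path, so by
  Gronwall it is at most \<open>e\<^sup>L\<^sup>T sup |M|\<close> (\<open>pathwise_error\<close>), and Doob's inequality bounds
  \<open>E sup |M|\<^sup>2\<close> by \<open>4 E|M\<^sub>T|\<^sup>2\<close> (\<open>Mart_maximal\<close>). These two factors are the constant in the claim.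

  Weak convergence. Put \<open>Z = X\<^sup>\<epsilon> - X\<close>; the strong bound says \<open>E|Z\<^sub>t|\<^sup>2 = O(\<epsilon>)\<close>. A Taylor expansion of
  \<open>f\<close> at \<open>X\<^sub>t\<close> reduces the claim to \<open>E\<langle>\<nabla>f(X\<^sub>t), Z\<^sub>t\<rangle> = O(\<epsilon>)\<close>. As \<open>X\<^sub>t\<close> is a function of \<open>X\<^sub>0\<close>, it
  suffices to bound \<open>E\<langle>\<xi>, Z\<^sub>t\<rangle>\<close> for all bounded \<open>\<xi>\<close> known at time \<open>0\<close>. In such a pairing the martingale
  drops out, and the drift difference is \<open>\<nabla>b(s, X\<^sub>s) Z\<^sub>s + O(|Z\<^sub>s|\<^sup>2)\<close>. Moving the matrix to the other side,
  \<open>E\<langle>\<xi>, \<nabla>b(s, X\<^sub>s) Z\<^sub>s\<rangle> = E\<langle>\<nabla>b(s, X\<^sub>s)\<^sup>T \<xi>, Z\<^sub>s\<rangle>\<close> is again a pairing with a field known at time \<open>0\<close>, of norm at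
  most \<open>L\<close>. The pairings with \<open>|\<xi>| \<le> 1\<close> therefore satisfy a joint Gronwall inequality whose source term
  is \<open>O(\<epsilon>)\<close> (\<open>pairing_bound\<close>).

  The stochastic calculus rests on one identity, \<open>jump_measure_eq_intensity\<close>. Predictable sets are
  generated by rectangles \<open>(u, v] \<times> A\<close> with \<open>A\<close> in the past of \<open>u\<close>; on these the expected number of
  jumps is \<open>r (v - u) P(A)\<close> by independence of increments. Hence jump sums and time integrals of
  predictable processes have the same expectation, which is the martingale property of \<open>M\<close>.

  Two regularisations precede this. The bounds on \<open>b\<close> hold only for almost every time; \<open>b\<close> is set to
  zero at the exceptional times, which changes neither equation, since almost surely no jump
  falls into a given null set. And \<open>N\<^sup>\<epsilon>\<close> is replaced by a version all of whose paths are counting paths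
  with unit jumps, so that \<open>X\<^sup>\<epsilon>\<close> is an explicit recursion along the jump times.\<close>

section \<open>Gronwall, Taylor and Doob inequalities\<close>

lemma set_integral_power_0:
  fixes t :: real
  assumes "0 \<le> t"
  shows "set_integrable lborel {0..t} (\<lambda>s. c * (L * s) ^ n / fact n)"
    and "L * (LINT s:{0..t}|lborel. c * (L * s) ^ n / fact n) = c * (L * t) ^ Suc n / fact (Suc n)"
proof -
  show "set_integrable lborel {0..t} (\<lambda>s. c * (L * s) ^ n / fact n)"
    by (intro borel_integrable_atLeastAtMost' continuous_intros) simp
  have "(LINT s:{0..t}|lborel. c * (L * s) ^ n / fact n)
      = (LINT s|lborel. (c * L ^ n / fact n) * (s ^ n * indicator {0..t} s))"
    unfolding set_lebesgue_integral_def
    by (rule Bochner_Integration.integral_cong) (auto simp: power_mult_distrib indicator_def)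
  also have "\<dots> = (c * L ^ n / fact n) * (t ^ Suc n / Suc n)"
    using integral_power[OF assms, of n] by simp
  finally have "L * (LINT s:{0..t}|lborel. c * (L * s) ^ n / fact n)
      = L * ((c * L ^ n / fact n) * (t ^ Suc n / Suc n))"
    by simp
  also have "\<dots> = c * (L * t) ^ Suc n / fact (Suc n)"
    by (simp add: power_mult_distrib field_simps)
  finally show "L * (LINT s:{0..t}|lborel. c * (L * s) ^ n / fact n)
      = c * (L * t) ^ Suc n / fact (Suc n)" .
qed

text \<open>A whole family of functions is estimated at once: each member is controlled by a common
  majorant of all members at earlier times. Starting from the crude bound \<open>S\<close>, iteration of the
  hypothesis produces majorants that are Taylor polynomials of \<open>a e\<^sup>L\<^sup>t\<close> plus a remainder \<open>S (L t)\<^sup>n / n!\<close>.\<close>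

lemma gronwall_family:
  fixes \<phi> :: "real \<Rightarrow> 'i \<Rightarrow> real"
  assumes bound: "\<And>t i. 0 \<le> t \<Longrightarrow> t \<le> T \<Longrightarrow> i \<in> I \<Longrightarrow> \<phi> t i \<le> S"
    and step: "\<And>t i \<psi>. 0 \<le> t \<Longrightarrow> t \<le> T \<Longrightarrow> i \<in> I \<Longrightarrow> set_integrable lborel {0..t} \<psi> \<Longrightarrow>
      (\<And>s j. 0 \<le> s \<Longrightarrow> s \<le> t \<Longrightarrow> j \<in> I \<Longrightarrow> \<phi> s j \<le> \<psi> s) \<Longrightarrow>
      \<phi> t i \<le> a + L * (LINT s:{0..t}|lborel. \<psi> s)"
    and t: "0 \<le> t" "t \<le> T" "i \<in> I"
  shows "\<phi> t i \<le> a * exp (L * t)"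
proof -
  define \<psi> where "\<psi> n s = a * (\<Sum>k<n. (L * s) ^ k / fact k) + S * (L * s) ^ n / fact n"
    for n and s :: real
  have \<psi>: "\<phi> t i \<le> \<psi> n t" if "0 \<le> t" "t \<le> T" "i \<in> I" for n t i
    using that
  proof (induction n arbitrary: t i)
    case 0
    then show ?case using bound by (simp add: \<psi>_def)
  next
    case (Suc n)
    have int: "set_integrable lborel {0..t} (\<lambda>s. c * (L * s) ^ k / fact k)" for c k
      using set_integral_power_0(1)[OF Suc.prems(1)] .
    have sum: "set_integrable lborel {0..t} (\<lambda>s. \<Sum>k<n. a * (L * s) ^ k / fact k)"
      "(LINT s:{0..t}|lborel. (\<Sum>k<n. a * (L * s) ^ k / fact k))
        = (\<Sum>k<n. (LINT s:{0..t}|lborel. a * (L * s) ^ k / fact k))"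
      using int[of a] unfolding set_integrable_def set_lebesgue_integral_def scaleR_sum_right
      by (auto intro!: Bochner_Integration.integral_sum)
    have \<psi>_eq: "\<psi> n = (\<lambda>s. (\<Sum>k<n. a * (L * s) ^ k / fact k) + S * (L * s) ^ n / fact n)"
      by (auto simp: \<psi>_def sum_distrib_left fun_eq_iff)
    have "\<phi> t i \<le> a + L * (LINT s:{0..t}|lborel. \<psi> n s)"
    proof (rule step)
      show "set_integrable lborel {0..t} (\<psi> n)"
        unfolding \<psi>_eq by (intro set_integral_add sum int)
    qed (use Suc in auto)
    also have "(LINT s:{0..t}|lborel. \<psi> n s)
      = (\<Sum>k<n. (LINT s:{0..t}|lborel. a * (L * s) ^ k / fact k))
        + (LINT s:{0..t}|lborel. S * (L * s) ^ n / fact n)"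
      unfolding \<psi>_eq set_integral_add(2)[OF sum(1) int] sum(2) ..
    also have "a + L * \<dots> = a + (\<Sum>k<n. a * (L * t) ^ Suc k / fact (Suc k))
        + S * (L * t) ^ Suc n / fact (Suc n)"
      using set_integral_power_0(2)[OF Suc.prems(1), of L] by (simp only: distrib_left sum_distrib_left)
    also have "\<dots> = \<psi> (Suc n) t"
      unfolding \<psi>_def sum.lessThan_Suc_shift by (simp add: sum_distrib_left distrib_left)
    finally show ?case .
  qed
  have "(\<lambda>n. (L * t) ^ n / fact n) sums exp (L * t)"
    using exp_converges[of "L * t"] by (simp add: divide_inverse mult.commute)
  then have "(\<lambda>n. \<Sum>k<n. (L * t) ^ k / fact k) \<longlonglongrightarrow> exp (L * t)"
    and "(\<lambda>n. (L * t) ^ n / fact n) \<longlonglongrightarrow> 0"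
    using summable_LIMSEQ_zero[OF sums_summable] by (auto simp: sums_def)
  then have "(\<lambda>n. a * (\<Sum>k<n. (L * t) ^ k / fact k) + S * ((L * t) ^ n / fact n))
      \<longlonglongrightarrow> a * exp (L * t) + S * 0"
    by (intro tendsto_intros)
  then show ?thesis
    using \<psi>[OF t] by (intro LIMSEQ_le_const) (auto simp: \<psi>_def)
qed

lemma norm_le_1_plus_square: "norm (x::'v::real_normed_vector) \<le> 1 + (norm x)\<^sup>2"
proof -
  have "2 * norm x \<le> 1 + (norm x)\<^sup>2" using sum_squares_bound[of 1 "norm x"] by simp
  then show ?thesis using norm_ge_zero[of x] by linarith
qed

text \<open>The vector that represents a linear functional. The explicit formula makes its dependence on
  a measurable parameter measurable.\<close>

definition riesz_vector :: "('v::euclidean_space \<Rightarrow> real) \<Rightarrow> 'v" where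
  "riesz_vector f = (\<Sum>e\<in>Basis. f e *\<^sub>R e)"

lemma inner_riesz_vector:
  assumes "bounded_linear f"
  shows "riesz_vector f \<bullet> z = f z"
proof -
  interpret bounded_linear f by fact
  have "f z = f (\<Sum>e\<in>Basis. (z \<bullet> e) *\<^sub>R e)" by (simp add: euclidean_representation)
  also have "\<dots> = riesz_vector f \<bullet> z"
    by (simp add: riesz_vector_def sum scaleR inner_sum_left inner_commute[of z] mult.commute)
  finally show ?thesis ..
qed

lemma norm_riesz_vector_le:
  assumes f: "bounded_linear f" and c: "0 \<le> c" "\<And>z. \<bar>f z\<bar> \<le> c * norm z"
  shows "norm (riesz_vector f) \<le> c"
proof -
  have "norm (riesz_vector f) * norm (riesz_vector f) = f (riesz_vector f)"
    by (simp flip: inner_riesz_vector[OF f] power2_norm_eq_inner power2_eq_square)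
  also have "\<dots> \<le> c * norm (riesz_vector f)" using c(2) abs_ge_self order_trans by blast
  finally show ?thesis using c(1) by (cases "riesz_vector f = 0") auto
qed

text \<open>First order expansion with quadratic remainder when the gradient is only Lipschitz: the
  derivative of \<open>z \<mapsto> g z - Dg(x) z\<close> is small on the segment from \<open>x\<close> to \<open>y\<close>.\<close>

lemma taylor_lipschitz_gradient:
  fixes g :: "'v::euclidean_space \<Rightarrow> 'w::euclidean_space"
  assumes g: "\<And>x. g differentiable (at x)" and H: "H-lipschitz_on UNIV (gradient_map g)"
  shows "norm (g y - g x - blinfun_apply (gradient_map g x) (y - x)) \<le> H * (norm (y - x))\<^sup>2"
proof -
  let ?D = "\<lambda>x. blinfun_apply (gradient_map g x)"
  have D: "(g has_derivative ?D z) (at z)" for z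
    using g[of z] unfolding gradient_map_def
    by (metis blinfun_apply_inverse bounded_linear_Blinfun_apply frechet_derivative_works has_derivative_bounded_linear)
  have "norm ((g y - ?D x y) - (g x - ?D x x)) \<le> (H * norm (y - x)) * norm (y - x)"
  proof (rule differentiable_bound[where S = "closed_segment x y" and f' = "\<lambda>z h. ?D z h - ?D x h"])
    fix z assume z: "z \<in> closed_segment x y"
    show "((\<lambda>z. g z - ?D x z) has_derivative (\<lambda>h. ?D z h - ?D x h)) (at z within closed_segment x y)"
      by (intro has_derivative_diff has_derivative_at_withinI[OF D] bounded_linear.has_derivative[OF blinfun.bounded_linear_right] has_derivative_ident)
    have "norm (gradient_map g z - gradient_map g x) \<le> H * norm (z - x)"
      using lipschitz_onD[OF H, of z x] by (simp add: dist_norm)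
    also have "\<dots> \<le> H * norm (y - x)"
      using segment_bound(1)[OF z] lipschitz_on_nonneg[OF H] by (intro mult_left_mono) (auto simp: norm_minus_commute)
    finally show "onorm (\<lambda>h. ?D z h - ?D x h) \<le> H * norm (y - x)"
      by (simp add: norm_blinfun.rep_eq minus_blinfun.rep_eq)
  qed auto
  then show ?thesis by (simp add: power2_eq_square algebra_simps blinfun.diff_right)
qed

lemma gradient_map_bound:
  fixes g :: "'v::euclidean_space \<Rightarrow> 'w::euclidean_space"
  assumes g: "\<And>x. g differentiable (at x)" and L: "L-lipschitz_on UNIV g"
  shows "norm (gradient_map g x) \<le> L"
proof -
  have D: "(g has_derivative blinfun_apply (gradient_map g z)) (at z)" for z
    using g[of z] unfolding gradient_map_def
    by (metis blinfun_apply_inverse bounded_linear_Blinfun_apply frechet_derivative_works has_derivative_bounded_linear)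
  have "ennreal (norm (gradient_map g x)) \<le> grad_norm g"
    unfolding grad_norm_eq_SUP[OF D] by (rule SUP_upper) simp
  also have "\<dots> \<le> ennreal L"
    unfolding grad_norm_def using L by (intro Inf_lower) auto
  finally show ?thesis using lipschitz_on_nonneg[OF L] by simp
qed

text \<open>The infimum that defines \<^const>\<open>grad_norm\<close> is attained.\<close>

lemma grad_norm_lipschitz:
  assumes "grad_norm g \<le> ennreal L" "0 \<le> L"
  shows "L-lipschitz_on UNIV g"
proof (rule lipschitz_onI)
  fix x y
  show "dist (g x) (g y) \<le> L * dist x y"
  proof (rule field_le_epsilon)
    fix e :: real assume e: "0 < e"
    define d where "d = e / (dist x y + 1)"
    have d: "0 < d" using e by (simp add: d_def add_nonneg_pos)
    have "grad_norm g < ennreal (L + d)"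
      using assms d by (intro le_less_trans[OF assms(1)]) (simp add: ennreal_less_iff)
    then obtain L' where L': "L'-lipschitz_on UNIV g" "L' < L + d"
      unfolding grad_norm_def Inf_less_iff using assms d
      by (auto simp: ennreal_less_iff lipschitz_on_nonneg simp del: ennreal_plus)
    have "dist (g x) (g y) \<le> L' * dist x y" using lipschitz_onD[OF L'(1)] by simp
    also have "\<dots> \<le> (L + d) * dist x y" using L' by (intro mult_right_mono) auto
    also have "\<dots> \<le> L * dist x y + d * (dist x y + 1)" using d by (simp add: algebra_simps)
    also have "d * (dist x y + 1) = e"
      using zero_le_dist[of x y] by (simp add: d_def add_nonneg_eq_0_iff)
    finally show "dist (g x) (g y) \<le> L * dist x y + e" .
  qed
qed fact

lemma esssup_time_AE: "AE t in lborel. 0 \<le> t \<longrightarrow> \<phi> t \<le> esssup_time \<phi>"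
proof -
  let ?C = "{c. AE t in lborel. 0 \<le> t \<longrightarrow> \<phi> t \<le> c}"
  have "top \<in> ?C" by simp
  then have "?C \<noteq> {}" by blast
  then obtain f :: "nat \<Rightarrow> ennreal" where f: "range f \<subseteq> ?C" "Inf ?C = (INF i. f i)"
    using ennreal_Inf_countable_INF[of ?C] by auto
  have "AE t in lborel. \<forall>i. 0 \<le> t \<longrightarrow> \<phi> t \<le> f i"
    unfolding AE_all_countable using f(1) by blast
  then show ?thesis
    unfolding esssup_time_def f(2) by eventually_elim (auto intro: INF_greatest)
qed

text \<open>An open set that is not empty has positive measure, so a continuous function
  satisfies an almost everywhere bound everywhere.\<close>

lemma AE_lborel_continuous_bound:
  fixes g :: "'v::euclidean_space \<Rightarrow> 'w::real_normed_vector"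
  assumes "continuous_on UNIV g" "AE x in lborel. norm (g x) \<le> B"
  shows "norm (g x) \<le> B"
proof -
  have op: "open {x. B < norm (g x)}"
    by (intro open_Collect_less continuous_on_norm assms continuous_intros)
  then have "{x. B < norm (g x)} \<in> null_sets lborel"
    using assms(2) by (subst AE_iff_null_sets) (auto simp: not_less elim: eventually_mono)
  then have "negligible {x. B < norm (g x)}"
    by (simp add: negligible_iff_null_sets null_sets_completionI)
  then have "{x. B < norm (g x)} = {}"
    using open_not_negligible[OF op] by blast
  then show ?thesis by (auto simp: not_less)
qed

text \<open>Outside a null set \<open>Z\<close> of times the essential bounds are genuine bounds at every point of
  space. Replacing the field by zero at the other times keeps it measurable.\<close>

lemma regularized_field:
  fixes b :: "real \<Rightarrow> 'v::euclidean_space \<Rightarrow> 'v"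
  assumes meas: "(\<lambda>(t, x). b t x) \<in> borel_measurable (restrict_space borel ({0..} \<times> UNIV))"
    and fin: "Linf_norm b + Linf_grad b < \<infinity>"
  obtains b' Z where "Z \<in> null_sets lborel"
    "(\<lambda>(t, x). b' t x) \<in> borel_measurable (borel \<Otimes>\<^sub>M borel)"
    "\<And>t x. norm (b' t x) \<le> enn2real (Linf_norm b)"
    "\<And>t. (enn2real (Linf_grad b))-lipschitz_on UNIV (b' t)"
    "\<And>t. 0 \<le> t \<Longrightarrow> t \<notin> Z \<Longrightarrow> b' t = b t" "\<And>t. t \<in> Z \<Longrightarrow> b' t = (\<lambda>_. 0)"
    "\<And>t x. Linf_hess b < \<infinity> \<Longrightarrow> b' t differentiable (at x)"
    "\<And>t. Linf_hess b < \<infinity> \<Longrightarrow> (enn2real (Linf_hess b))-lipschitz_on UNIV (gradient_map (b' t))"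
proof -
  define B L H where "B = enn2real (Linf_norm b)" "L = enn2real (Linf_grad b)"
    "H = enn2real (Linf_hess b)"
  have eB: "ennreal B = Linf_norm b" and eL: "ennreal L = Linf_grad b"
    using fin by (auto simp: B_L_H_def less_top)
  have nn: "0 \<le> B" "0 \<le> L" "0 \<le> H" by (auto simp: B_L_H_def)
  have "AE p in restrict_space lborel ({0..} \<times> UNIV). (\<lambda>(t, x). ennreal (norm (b t x))) p \<le> Linf_norm b"
    unfolding Linf_norm_def by (rule esssup_AE)
  then have "AE p in lborel \<Otimes>\<^sub>M lborel. p \<in> {0..} \<times> (UNIV::'v set) \<longrightarrow> norm (b (fst p) (snd p)) \<le> B"
    using nn unfolding lborel_prod by (subst (asm) AE_restrict_space_iff)
      (auto simp: case_prod_beta mem_Times_iff simp flip: eB intro!: borel_closed closed_Times)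
  then have AE1: "AE t in lborel. AE x in lborel. 0 \<le> t \<longrightarrow> norm (b t x) \<le> B"
    by (auto dest!: lborel_pair.AE_pair)
  have AE2: "AE t in lborel. 0 \<le> t \<longrightarrow> grad_norm (b t) \<le> ennreal L"
    using esssup_time_AE[of "\<lambda>t. grad_norm (b t)"] unfolding eL Linf_grad_def .
  have AE3: "AE t in lborel. 0 \<le> t \<longrightarrow> hess_norm (b t) \<le> Linf_hess b"
    using esssup_time_AE[of "\<lambda>t. hess_norm (b t)"] unfolding Linf_hess_def .
  define good where "good t \<longleftrightarrow> L-lipschitz_on UNIV (b t) \<and> (\<forall>x. norm (b t x) \<le> B) \<and>
    (Linf_hess b < \<infinity> \<longrightarrow> (\<forall>x. b t differentiable (at x)) \<and> H-lipschitz_on UNIV (gradient_map (b t)))" for t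
  have "AE t in lborel. 0 \<le> t \<longrightarrow> good t"
    using AE1 AE2 AE3
  proof eventually_elim
    case (elim t)
    show ?case
    proof
      assume t: "0 \<le> t"
      have lip: "L-lipschitz_on UNIV (b t)" using elim(2) t nn by (auto intro: grad_norm_lipschitz)
      have "norm (b t x) \<le> B" for x
        using elim(1) t lipschitz_on_continuous_on[OF lip] by (intro AE_lborel_continuous_bound) auto
      moreover have "(\<forall>x. b t differentiable (at x)) \<and> H-lipschitz_on UNIV (gradient_map (b t))"
        if "Linf_hess b < \<infinity>"
      proof -
        have "hess_norm (b t) < \<infinity>" using elim(3) t that by (auto intro: le_less_trans)
        then have d: "\<forall>x. b t differentiable (at x)" by (auto simp: hess_norm_def split: if_splits)
        moreover have "grad_norm (gradient_map (b t)) \<le> ennreal H"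
          using d elim(3) t that by (simp add: hess_norm_def B_L_H_def less_top)
        ultimately show ?thesis using grad_norm_lipschitz nn by auto
      qed
      ultimately show "good t" using lip by (auto simp: good_def)
    qed
  qed
  then obtain Z where Z: "Z \<in> null_sets lborel" "\<And>t. 0 \<le> t \<Longrightarrow> t \<notin> Z \<Longrightarrow> good t"
    by (auto elim!: AE_E3)
  define b' where "b' t = (if 0 \<le> t \<and> t \<notin> Z then b t else (\<lambda>_. 0))" for t
  have grad0: "gradient_map (\<lambda>_. 0 :: 'v) = (\<lambda>_ :: 'v. 0)"
    by (simp add: gradient_map_def fun_eq_iff zero_blinfun_def)
  show ?thesis
  proof (rule that[of Z b', folded B_L_H_def])
    show "Z \<in> null_sets lborel" by (rule Z)
    have [measurable]: "{0::real..} \<times> (UNIV :: 'v set) \<in> sets borel" "Z \<in> sets borel"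
      using Z(1) by (auto intro!: borel_closed[OF closed_Times])
    have "(\<lambda>p. if p \<in> {0..} \<times> UNIV then b (fst p) (snd p) else 0) \<in> borel_measurable borel"
      using meas unfolding case_prod_beta
      by (subst (asm) measurable_restrict_space_iff[where c = 0]) auto
    then have [measurable]: "(\<lambda>p. if p \<in> {0..} \<times> UNIV then b (fst p) (snd p) else 0)
        \<in> borel_measurable (borel \<Otimes>\<^sub>M borel)"
      by (simp add: borel_prod)
    have "(\<lambda>p. if fst p \<in> Z then 0 else if p \<in> {0..} \<times> UNIV then b (fst p) (snd p) else 0)
        \<in> borel_measurable (borel \<Otimes>\<^sub>M borel)"
      by measurable
    also have "(\<lambda>p. if fst p \<in> Z then 0 else if p \<in> {0..} \<times> UNIV then b (fst p) (snd p) else 0)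
      = (\<lambda>(t, x). b' t x)"
      by (auto simp: fun_eq_iff b'_def)
    finally show "(\<lambda>(t, x). b' t x) \<in> borel_measurable (borel \<Otimes>\<^sub>M borel)" .
    show "norm (b' t x) \<le> B" for t x using Z(2)[of t] nn by (auto simp: b'_def good_def)
    show "L-lipschitz_on UNIV (b' t)" for t
      using Z(2)[of t] nn by (auto simp: b'_def good_def lipschitz_on_def)
    show "b' t = b t" if "0 \<le> t" "t \<notin> Z" for t using that by (simp add: b'_def)
    show "b' t = (\<lambda>_. 0)" if "t \<in> Z" for t using that by (simp add: b'_def)
    show "b' t differentiable (at x)" if "Linf_hess b < \<infinity>" for t x
      using Z(2)[of t] that by (auto simp: b'_def good_def)
    show "H-lipschitz_on UNIV (gradient_map (b' t))" if "Linf_hess b < \<infinity>" for t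
      using Z(2)[of t] that nn by (auto simp: b'_def good_def grad0 lipschitz_on_def)
  qed
qed

text \<open>Doob's \<open>L\<^sup>2\<close> inequality before taking expectations. With \<open>a\<^sub>i\<close> the running maximum,
  \<open>\<Sum> a\<^sub>i (s\<^sub>i\<^sub>+\<^sub>1 - s\<^sub>i) \<le> a\<^sub>n s\<^sub>n - a\<^sub>n\<^sup>2 / 2\<close>, since the maximum moves only when it equals \<open>s\<close>; the claim follows
  from \<open>(2 s\<^sub>n - a\<^sub>n)\<^sup>2 \<ge> 0\<close>. For a submartingale \<open>s\<close> the sum has nonnegative expectation.\<close>

lemma doob_pathwise:
  fixes s :: "nat \<Rightarrow> real"
  shows "(Max (s ` {..n}))\<^sup>2 + 4 * (\<Sum>i<n. Max (s ` {..i}) * (s (Suc i) - s i)) \<le> 4 * (s n)\<^sup>2"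
proof -
  define a where "a n = Max (s ` {..n})" for n
  have a_Suc: "a (Suc n) = max (s (Suc n)) (a n)" for n
    by (simp add: a_def atMost_Suc)
  have "(\<Sum>i<n. a i * (s (Suc i) - s i)) \<le> a n * s n - (a n)\<^sup>2 / 2"
  proof (induction n)
    case 0
    then show ?case by (simp add: a_def power2_eq_square)
  next
    case (Suc n)
    have "a n * s (Suc n) - (a n)\<^sup>2 / 2 \<le> a (Suc n) * s (Suc n) - (a (Suc n))\<^sup>2 / 2"
    proof (cases "s (Suc n) \<le> a n")
      case False
      have "0 \<le> (s (Suc n) - a n)\<^sup>2" by simp
      then show ?thesis using False by (simp add: a_Suc power2_eq_square algebra_simps)
    qed (simp add: a_Suc max_absorb2)
    then show ?case using Suc by (simp add: algebra_simps)
  qed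
  moreover have "0 \<le> (2 * s n - a n)\<^sup>2" by simp
  ultimately show ?thesis unfolding a_def[symmetric] by (simp add: power2_eq_square algebra_simps)
qed

section \<open>Counting paths and the recursion along jump times\<close>

text \<open>Surjectivity encodes two properties at once: the path is unbounded and its jumps have size one.
  Setting the path to zero at negative times spares case distinctions at \<open>0\<close>.\<close>

locale counting_path =
  fixes n :: "real \<Rightarrow> nat"
  assumes n_neg: "t \<le> 0 \<Longrightarrow> n t = 0"
    and n_mono: "mono n"
    and n_right: "continuous (at_right t) (\<lambda>s. real (n s))"
    and n_surj: "surj n"
begin

definition jump_time :: "nat \<Rightarrow> real" where
  "jump_time k = Inf {t. Suc k \<le> n t}"

text \<open>Right continuity makes the infimum a minimum: the path has reached \<open>k + 1\<close> at the jump time.\<close>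

lemma jump_time_le_iff: "jump_time k \<le> t \<longleftrightarrow> Suc k \<le> n t"
proof
  have bdd: "bdd_below {t. Suc k \<le> n t}"
  proof (rule bdd_belowI[of _ 0])
    fix t assume "t \<in> {t. Suc k \<le> n t}"
    then show "0 \<le> t" using n_neg[of t] by (cases "t \<le> 0") auto
  qed
  show "jump_time k \<le> t" if "Suc k \<le> n t"
    unfolding jump_time_def using that by (intro cInf_lower bdd) auto
  assume le: "jump_time k \<le> t"
  show "Suc k \<le> n t"
  proof (rule ccontr)
    assume "\<not> Suc k \<le> n t"
    have "\<forall>\<^sub>F s in at_right t. real (n s) < n t + 1"
      using n_right[of t] by (intro order_tendstoD) (auto simp: continuous_within)
    then obtain u where "t < u" "\<And>s. t < s \<Longrightarrow> s < u \<Longrightarrow> real (n s) < n t + 1"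
      unfolding eventually_at_right_field by auto
    then obtain d where d: "0 < d" "\<And>s. t < s \<Longrightarrow> s < t + d \<Longrightarrow> real (n s) < n t + 1"
      by (intro that[of "u - t"]) auto
    obtain s0 where "n s0 = Suc k" using n_surj by (metis surjD)
    then have "s0 \<in> {t. Suc k \<le> n t}" by simp
    then have ne: "{t. Suc k \<le> n t} \<noteq> {}" by blast
    have "t + d / 2 \<le> s" if "Suc k \<le> n s" for s
    proof (rule ccontr)
      assume "\<not> t + d / 2 \<le> s"
      then have "s \<le> t \<or> (t < s \<and> s < t + d)" using d(1) by auto
      then have "n s \<le> n t" using d(2)[of s] monoD[OF n_mono, of s t] by auto
      then show False using that \<open>\<not> Suc k \<le> n t\<close> by simp
    qed
    then have "t + d / 2 \<le> jump_time k"
      unfolding jump_time_def by (intro cInf_greatest[OF ne]) auto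
    then show False using le d(1) by simp
  qed
qed

lemma less_jump_time_iff: "t < jump_time k \<longleftrightarrow> n t \<le> k"
  using jump_time_le_iff[of k t] by linarith

lemma jump_time_pos: "0 < jump_time k"
  by (simp add: less_jump_time_iff n_neg)

lemma n_jump_time: "n (jump_time k) = Suc k"
proof -
  obtain s where s: "n s = Suc k" using n_surj by (metis surjD)
  then have "jump_time k \<le> s" by (simp add: jump_time_le_iff)
  then have "n (jump_time k) \<le> Suc k" using s monoD[OF n_mono] by metis
  moreover have "Suc k \<le> n (jump_time k)" by (simp flip: jump_time_le_iff)
  ultimately show ?thesis by simp
qed

lemma jump_time_mono: "strict_mono jump_time"
  by (simp add: strict_mono_Suc_iff less_jump_time_iff n_jump_time)

lemma jump_time_less_iff [simp]: "jump_time j < jump_time k \<longleftrightarrow> j < k"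
  using jump_time_mono by (simp add: strict_mono_less)

lemma jumps_Ioc: "{k. s < jump_time k \<and> jump_time k \<le> t} = {n s..<n t}"
  by (auto simp: less_jump_time_iff jump_time_le_iff)

lemma jumps_upto: "{k. jump_time k \<le> t} = {..<n t}"
  by (auto simp: jump_time_le_iff)

text \<open>The left limit of the path, as the number of jumps strictly before \<open>t\<close>.\<close>

definition n_left :: "real \<Rightarrow> nat" where
  "n_left t = card {k. jump_time k < t}"

lemma jumps_before: "{k. jump_time k < t} = {..<n_left t}"
proof -
  have "{k. jump_time k < t} \<subseteq> {..<n t}" by (auto simp flip: jumps_upto)
  then have fin: "finite {k. jump_time k < t}" by (rule finite_subset) simp
  have dc: "j \<in> {k. jump_time k < t}" if "k \<in> {k. jump_time k < t}" "j \<le> k" for j k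
    using that strict_mono_less_eq[OF jump_time_mono, of j k] by simp
  show ?thesis
  proof (cases "{k. jump_time k < t} = {}")
    case False
    have "{k. jump_time k < t} = {..Max {k. jump_time k < t}}"
    proof (intro equalityI subsetI)
      show "k \<in> {..Max {k. jump_time k < t}}" if "k \<in> {k. jump_time k < t}" for k
        using Max_ge[OF fin that] by (rule atMost_iff[THEN iffD2])
      show "k \<in> {k. jump_time k < t}" if "k \<in> {..Max {k. jump_time k < t}}" for k
        using Max_in[OF fin False] that[THEN atMost_iff[THEN iffD1]] by (rule dc)
    qed
    then show ?thesis unfolding n_left_def by (metis card_atMost lessThan_Suc_atMost)
  qed (simp add: n_left_def)
qed

lemma n_left_jump_time: "n_left (jump_time k) = k"
  by (simp add: n_left_def)

lemma n_eq_n_left: "t \<notin> range jump_time \<Longrightarrow> n t = n_left t"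
proof -
  assume "t \<notin> range jump_time"
  then have "{k. jump_time k < t} = {k. jump_time k \<le> t}"
    by (auto simp: less_le)
  then show ?thesis unfolding n_left_def jumps_upto by simp
qed

lemma eventually_n_left: "\<forall>\<^sub>F s in at_left t. n s = n_left t"
proof -
  have "\<exists>u<t. \<forall>s. u \<le> s \<and> s < t \<longrightarrow> n s = n_left t"
  proof (cases "n_left t = 0")
    case True
    have "n s = n_left t" if "s < t" for s
    proof -
      have "n s = 0"
      proof (rule ccontr)
        assume "n s \<noteq> 0"
        then have "jump_time 0 \<le> s" by (simp add: jump_time_le_iff)
        then have "0 \<in> {k. jump_time k < t}" using that by simp
        then show False unfolding jumps_before using True by simp
      qed
      then show ?thesis using True by simp
    qed
    then show ?thesis by (intro exI[of _ "t - 1"]) auto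
  next
    case False
    then have "n_left t - 1 \<in> {k. jump_time k < t}" unfolding jumps_before by simp
    moreover have "n s = n_left t" if "jump_time (n_left t - 1) \<le> s" "s < t" for s
    proof -
      have "n_left t \<le> n s" using that(1) False by (simp add: jump_time_le_iff)
      moreover have "n s \<le> n_left t"
      proof (rule ccontr)
        assume "\<not> n s \<le> n_left t"
        then have "n_left t \<in> {k. jump_time k < t}" using that(2) jump_time_le_iff[of "n_left t" s] by auto
        then show False unfolding jumps_before by simp
      qed
      ultimately show ?thesis by simp
    qed
    ultimately show ?thesis by auto
  qed
  then obtain u where "u < t" "\<And>s. u \<le> s \<Longrightarrow> s < t \<Longrightarrow> n s = n_left t" by blast
  then show ?thesis unfolding eventually_at_left_field by (intro exI[of _ u]) auto
qed

lemma Lim_left: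
  assumes "\<And>s. s < t \<Longrightarrow> n s = n_left t \<Longrightarrow> 0 \<le> s \<Longrightarrow> f s = (c :: 'v :: t2_space)" "0 < t"
  shows "Lim (at_left t) f = c"
proof (rule tendsto_Lim)
  have "\<forall>\<^sub>F s in at_left t. s < t \<and> 0 \<le> s"
    using assms(2) unfolding eventually_at_left_field by (intro exI[of _ 0]) auto
  with eventually_n_left[of t] have "\<forall>\<^sub>F s in at_left t. f s = c"
    by eventually_elim (blast intro: assms(1))
  then show "(f \<longlongrightarrow> c) (at_left t)" by (rule tendsto_eventually)
qed simp

lemma eventually_n_right: "\<forall>\<^sub>F s in at_right t. n s = n t"
  unfolding eventually_at_right_field
proof (intro exI[of _ "jump_time (n t)"] conjI allI impI)
  fix s assume "t < s" "s < jump_time (n t)"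
  then show "n s = n t" using monoD[OF n_mono, of t s] by (simp add: less_jump_time_iff)
qed (simp add: less_jump_time_iff)

text \<open>The Stieltjes measure of a counting path is counting measure on its jump times: both give
  \<open>n b - n a\<close> to \<open>(a, b]\<close>.\<close>

lemma interval_measure_eq_jumps:
  "interval_measure (\<lambda>s. real (n s)) = distr (count_space UNIV) borel jump_time"
proof (rule measure_eqI_generator_eq)
  let ?E = "range (\<lambda>(a, b). {a<..b::real})"
  have E: "sets borel = sigma_sets UNIV ?E"
    by (subst borel_sigma_sets_Ioc) (auto simp: sets_measure_of)
  show "Int_stable ?E"
  proof (rule Int_stableI)
    fix A B assume "A \<in> ?E" "B \<in> ?E"
    then obtain a b c d where "A = {a<..b}" "B = {c<..d}" by auto
    then have "A \<inter> B = (\<lambda>(a, b). {a<..b}) (max a c, min b d)" by auto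
    then show "A \<inter> B \<in> ?E" by blast
  qed
  show "sets (interval_measure (\<lambda>s. real (n s))) = sigma_sets UNIV ?E"
    "sets (distr (count_space UNIV) borel jump_time) = sigma_sets UNIV ?E"
    by (simp_all add: E)
  have Ioc: "emeasure (interval_measure (\<lambda>s. real (n s))) {a<..b} = ennreal (real (n b) - real (n a))"
    if "a \<le> b" for a b
    using that monoD[OF n_mono] n_right by (intro emeasure_interval_measure_Ioc) auto
  show "emeasure (interval_measure (\<lambda>s. real (n s))) X = emeasure (distr (count_space UNIV) borel jump_time) X"
    if "X \<in> ?E" for X
  proof -
    obtain p where "X = (\<lambda>(a, b). {a<..b}) p" using \<open>X \<in> ?E\<close> by (rule rangeE)
    then obtain a b where X: "X = {a<..b}" by (cases p) simp
    show ?thesis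
    proof (cases "a \<le> b")
      case True
      have "emeasure (distr (count_space UNIV) borel jump_time) {a<..b}
          = emeasure (count_space UNIV) {k. a < jump_time k \<and> jump_time k \<le> b}"
        by (subst emeasure_distr) (auto simp: vimage_def)
      also have "\<dots> = ennreal (real (n b) - real (n a))"
        unfolding jumps_Ioc of_nat_diff[OF monoD[OF n_mono True], symmetric]
        by (simp add: ennreal_of_nat_eq_real_of_nat)
      finally show ?thesis using Ioc[OF True] X by simp
    qed (simp add: X)
  qed
  show "range (\<lambda>i::nat. {- real i<..real i}) \<subseteq> ?E" by auto
  show "(\<Union>i::nat. {- real i<..real i}) = UNIV"
  proof (intro set_eqI iffI UNIV_I)
    fix x :: real
    obtain i :: nat where "\<bar>x\<bar> < i" using reals_Archimedean2 by blast
    then show "x \<in> (\<Union>i::nat. {- real i<..real i})" by (intro UN_I[of i]) auto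
  qed
  show "emeasure (interval_measure (\<lambda>s. real (n s))) {- real i<..real i} \<noteq> \<infinity>" for i
    by (subst Ioc) auto
qed auto

lemma integral_over_jumps:
  fixes h :: "real \<Rightarrow> 'v :: euclidean_space"
  assumes int: "set_integrable (interval_measure (\<lambda>s. real (n s))) {0<..t} h"
  shows "(LINT s:{0<..t}|interval_measure (\<lambda>s. real (n s)). h s) = (\<Sum>k<n t. h (jump_time k))"
proof -
  let ?g = "\<lambda>s. indicator {0<..t} s *\<^sub>R h s"
  have "?g \<in> borel_measurable borel"
    using borel_measurable_integrable[OF int[unfolded set_integrable_def]]
    by (simp cong: measurable_cong_sets)
  then have "integral\<^sup>L (distr (count_space UNIV) borel jump_time) ?g
      = (\<integral>k. ?g (jump_time k) \<partial>count_space UNIV)"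
    by (intro integral_distr) auto
  also have "\<dots> = (\<integral>k. indicator {..<n t} k *\<^sub>R h (jump_time k) \<partial>count_space UNIV)"
    using jump_time_pos
    by (intro Bochner_Integration.integral_cong) (auto simp: jump_time_le_iff indicator_def)
  also have "\<dots> = (\<Sum>k | indicator {..<n t} k *\<^sub>R h (jump_time k) \<noteq> 0. indicator {..<n t} k *\<^sub>R h (jump_time k))"
    by (subst lebesgue_integral_count_space_finite_support)
      (auto simp: indicator_def intro: finite_subset[of _ "{..<n t}"] split: if_splits)
  also have "\<dots> = (\<Sum>k<n t. h (jump_time k))"
    by (intro sum.mono_neutral_cong_left) (auto simp: indicator_def split: if_splits)
  finally show ?thesis
    unfolding set_lebesgue_integral_def interval_measure_eq_jumps .
qed

end

fun jump_chain :: "real \<Rightarrow> (real \<Rightarrow> 'v::real_vector \<Rightarrow> 'v) \<Rightarrow> (nat \<Rightarrow> real) \<Rightarrow> 'v \<Rightarrow> nat \<Rightarrow> 'v" where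
  "jump_chain \<epsilon> b \<tau> x0 0 = x0"
| "jump_chain \<epsilon> b \<tau> x0 (Suc k) = jump_chain \<epsilon> b \<tau> x0 k + \<epsilon> *\<^sub>R b (\<tau> k) (jump_chain \<epsilon> b \<tau> x0 k)"

lemma jump_chain_sum:
  "jump_chain \<epsilon> b \<tau> x0 m = x0 + \<epsilon> *\<^sub>R (\<Sum>k<m. b (\<tau> k) (jump_chain \<epsilon> b \<tau> x0 k))"
  by (induction m) (auto simp: scaleR_right_distrib)

lemma jump_chain_cong:
  "(\<And>k. b (\<tau> k) = b' (\<tau> k)) \<Longrightarrow> jump_chain \<epsilon> b \<tau> x0 m = jump_chain \<epsilon> b' \<tau> x0 m"
  by (induction m) auto

text \<open>The integral equation determines its solution by induction on the jumps: between two jump times the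
  solution is constant, hence its left limit at the next jump time is the value after the
  previous jump.\<close>

lemma (in counting_path) jump_solution_unique:
  fixes b :: "real \<Rightarrow> 'v::euclidean_space \<Rightarrow> 'v"
  assumes sol: "jump_solution \<epsilon> b n' x0 x" and n': "\<And>t. 0 \<le> t \<Longrightarrow> n' t = n t" and t: "0 \<le> t"
  shows "x t = jump_chain \<epsilon> b jump_time x0 (n t)"
proof -
  define h where "h s = \<epsilon> *\<^sub>R b s (Lim (at_left s) x)" for s
  have "n' (max 0 s) = n s" for s
    using n'[of "max 0 s"] n_neg[of s] n_neg[of 0] by (cases "0 \<le> s") (auto simp: max_def)
  then have eq: "set_integrable (interval_measure (\<lambda>s. real (n s))) {0<..t} h \<and>
      x t = x0 + (LINT s:{0<..t}|interval_measure (\<lambda>s. real (n s)). h s)" if "0 \<le> t" for t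
    using sol that unfolding jump_solution_def Let_def h_def[symmetric] by simp
  have x: "x t = x0 + (\<Sum>k<n t. h (jump_time k))" if "0 \<le> t" for t
    using eq[OF that] integral_over_jumps[of t h] by simp
  have "x0 + (\<Sum>k<m. h (jump_time k)) = jump_chain \<epsilon> b jump_time x0 m" for m
  proof (induction m)
    case (Suc m)
    have "Lim (at_left (jump_time m)) x = x0 + (\<Sum>k<m. h (jump_time k))"
      using x jump_time_pos by (intro Lim_left) (auto simp: n_left_jump_time)
    then show ?case using Suc by (simp add: h_def flip: add.assoc)
  qed simp
  then show ?thesis using x[OF t] by simp
qed

section \<open>A regular version of the Poisson process\<close>

lemma sums_from_Suc:
  fixes f :: "nat \<Rightarrow> real"
  shows "f 0 = 0 \<Longrightarrow> (\<lambda>k. f (Suc k)) sums s \<Longrightarrow> f sums s"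
  using sums_Suc_iff[of f s] by simp

lemma poisson_factorial_moments:
  fixes r :: real
  shows "(\<lambda>k. r ^ k / fact k * exp (- r)) sums 1"
    and "(\<lambda>k. real k * (r ^ k / fact k * exp (- r))) sums r"
    and "(\<lambda>k. real k * (real k - 1) * (r ^ k / fact k * exp (- r))) sums r\<^sup>2"
proof -
  have Suc_fact: "real (Suc k) * (x / fact (Suc k)) = x / fact k" for k and x :: real
    by (simp add: divide_simps del: of_nat_Suc)
  have "(\<lambda>k. r ^ k / fact k) sums exp r"
    using exp_converges[of r] by (simp add: divide_inverse mult.commute)
  then have "(\<lambda>k. r ^ k / fact k * exp (- r)) sums (exp r * exp (- r))"
    by (rule sums_mult2)
  then show 0: "(\<lambda>k. r ^ k / fact k * exp (- r)) sums 1"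
    by (simp flip: exp_add)
  have "(\<lambda>k. real (Suc k) * (r ^ Suc k / fact (Suc k) * exp (- r))) = (\<lambda>k. r * (r ^ k / fact k * exp (- r)))"
    unfolding mult.assoc[symmetric] Suc_fact by simp
  then show 1: "(\<lambda>k. real k * (r ^ k / fact k * exp (- r))) sums r"
    using sums_mult[OF 0, of r] by (intro sums_from_Suc[where f = "\<lambda>k. real k * (r ^ k / fact k * exp (- r))"]) auto
  have "(\<lambda>k. real (Suc k) * (real (Suc k) - 1) * (r ^ Suc k / fact (Suc k) * exp (- r)))
      = (\<lambda>k. r * (real k * (r ^ k / fact k * exp (- r))))"
  proof
    fix k
    have "real (Suc k) * (real (Suc k) - 1) * (r ^ Suc k / fact (Suc k) * exp (- r))
      = (real (Suc k) - 1) * (real (Suc k) * (r ^ Suc k / fact (Suc k))) * exp (- r)"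
      by (simp only: ac_simps)
    then show "real (Suc k) * (real (Suc k) - 1) * (r ^ Suc k / fact (Suc k) * exp (- r))
      = r * (real k * (r ^ k / fact k * exp (- r)))"
      unfolding Suc_fact by simp
  qed
  then show "(\<lambda>k. real k * (real k - 1) * (r ^ k / fact k * exp (- r))) sums r\<^sup>2"
    using sums_mult[OF 1, of r]
    by (intro sums_from_Suc[where f = "\<lambda>k. real k * (real k - 1) * (r ^ k / fact k * exp (- r))"])
      (auto simp: power2_eq_square)
qed

lemma nn_integral_poisson:
  assumes r: "0 < r" and f: "\<And>k. 0 \<le> f k"
    and sums: "(\<lambda>k. f k * (r ^ k / fact k * exp (- r))) sums c"
  shows "(\<integral>\<^sup>+k. ennreal (f k) \<partial>measure_pmf (poisson_pmf r)) = ennreal c"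
proof -
  have "(\<integral>\<^sup>+k. ennreal (f k) \<partial>measure_pmf (poisson_pmf r))
      = (\<Sum>k. ennreal (f k * (r ^ k / fact k * exp (- r))))"
    using r f by (subst nn_integral_measure_pmf)
      (simp add: nn_integral_count_space_nat ennreal_mult'[symmetric] mult.commute)
  also have "\<dots> = ennreal c"
    using r f sums by (intro suminf_ennreal_eq) auto
  finally show ?thesis .
qed

lemma nn_integral_poisson_mean:
  "0 < r \<Longrightarrow> (\<integral>\<^sup>+k. ennreal (real k) \<partial>measure_pmf (poisson_pmf r)) = ennreal r"
  by (intro nn_integral_poisson poisson_factorial_moments) auto

lemma nn_integral_poisson_square:
  assumes "0 < r"
  shows "(\<integral>\<^sup>+k. ennreal ((real k)\<^sup>2) \<partial>measure_pmf (poisson_pmf r)) = ennreal (r + r\<^sup>2)"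
proof (rule nn_integral_poisson[OF assms])
  have "real k * p + real k * (real k - 1) * p = (real k)\<^sup>2 * p" for k p
    by (simp add: power2_eq_square algebra_simps)
  then show "(\<lambda>k. (real k)\<^sup>2 * (r ^ k / fact k * exp (- r))) sums (r + r\<^sup>2)"
    using sums_add[OF poisson_factorial_moments(2,3)[of r]] by (simp only:)
qed simp

text \<open>The quadratic bound comes from \<open>e\<^sup>-\<^sup>r (1 + r) \<ge> (1 - r) (1 + r)\<close>.\<close>

lemma poisson_ge_2:
  assumes r: "0 < r"
  shows "measure (poisson_pmf r) {2..} \<le> r\<^sup>2"
proof -
  have "measure (poisson_pmf r) {2..} = 1 - measure (poisson_pmf r) {0, 1}"
    by (subst measure_pmf.prob_compl[symmetric]) (auto intro!: arg_cong[where f = "measure _"])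
  also have "measure (poisson_pmf r) {0, 1} = exp (- r) * (1 + r)"
    using r by (subst measure_measure_pmf_finite) (auto simp: algebra_simps)
  also have "1 - exp (- r) * (1 + r) \<le> 1 - (1 - r) * (1 + r)"
    using r exp_ge_add_one_self[of "- r"] by (intro diff_mono mult_right_mono) auto
  finally show ?thesis by (simp add: power2_eq_square algebra_simps)
qed

lemma poisson_less_tendsto_0:
  assumes r: "0 < r"
  shows "(\<lambda>n. measure (poisson_pmf (r * real (Suc n))) {..<k}) \<longlonglongrightarrow> 0"
proof -
  have lim: "filterlim (\<lambda>n. r * real (Suc n)) at_top sequentially"
    using r by (intro filterlim_tendsto_pos_mult_at_top[OF tendsto_const] filterlim_compose[OF filterlim_real_sequentially filterlim_Suc])
  have "(\<lambda>n. (\<Sum>j<k. ((r * real (Suc n)) ^ j / exp (r * real (Suc n))) / fact j)) \<longlonglongrightarrow> (\<Sum>j<k. 0 / fact j)"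
    by (intro tendsto_sum tendsto_divide tendsto_const filterlim_compose[OF tendsto_power_div_exp_0 lim]) auto
  moreover have "measure (poisson_pmf (r * real (Suc n))) {..<k} =
      (\<Sum>j<k. ((r * real (Suc n)) ^ j / exp (r * real (Suc n))) / fact j)" for n
  proof -
    have "0 < r * real (Suc n)" using r by simp
    then show ?thesis
      by (simp add: measure_measure_pmf_finite exp_minus field_simps del: of_nat_Suc)
  qed
  ultimately show ?thesis by simp
qed

lemma nat_diff_event:
  fixes f g :: "'a \<Rightarrow> nat"
  assumes [measurable]: "f \<in> measurable M (count_space UNIV)" "g \<in> measurable M (count_space UNIV)"
  shows "{\<omega>\<in>space M. f \<omega> - g \<omega> \<in> K} \<in> sets M"
  by measurable

locale poisson_with_initial_field = prob_space M
  for M :: "'a measure" +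
  fixes r :: real and F0 :: "'a measure" and N :: "real \<Rightarrow> 'a \<Rightarrow> nat"
  assumes r_pos: "0 < r"
    and pp: "poisson_process M r N"
    and F0_sub: "subalgebra M F0"
    and F0_indep: "indep_set (sets F0)
          (sigma_sets (space M) (\<Union>t\<in>{0..}. {N t -` A \<inter> space M | A. A \<in> UNIV}))"
begin

lemma N_measurable: "0 \<le> t \<Longrightarrow> N t \<in> measurable M (count_space UNIV)"
  using pp by (simp add: poisson_process_def)

lemma N_paths: "AE \<omega> in M. N 0 \<omega> = 0 \<and> mono_on {0..} (\<lambda>t. N t \<omega>) \<and>
        (\<forall>t\<ge>0. continuous (at_right t) (\<lambda>s. real (N s \<omega>)))"
  using pp by (simp add: poisson_process_def)

lemma increment_prob:
  assumes "0 \<le> s" "s < t"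
  shows "prob {\<omega>\<in>space M. N t \<omega> - N s \<omega> \<in> K} = measure (poisson_pmf (r * (t - s))) K"
proof -
  have "measure (distr M (count_space UNIV) (\<lambda>\<omega>. N t \<omega> - N s \<omega>)) K = measure (poisson_pmf (r * (t - s))) K"
    using pp assms by (simp add: poisson_process_def)
  moreover have [measurable]: "N t \<in> measurable M (count_space UNIV)" "N s \<in> measurable M (count_space UNIV)"
    using N_measurable assms by auto
  ultimately show ?thesis
    by (subst (asm) measure_distr) (auto simp: vimage_def Int_def conj_commute)
qed

lemma increments_indep:
  assumes "0 \<le> \<tau> 0" "mono \<tau>"
  shows "indep_vars (\<lambda>_. count_space UNIV) (\<lambda>i \<omega>. N (\<tau> (Suc i)) \<omega> - N (\<tau> i) \<omega>) {..<n::nat}"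
  using pp assms by (simp add: poisson_process_def)

text \<open>Almost surely all jumps have size one. If the value \<open>k\<close> is skipped, then either the process stays
  below \<open>k\<close> up to time \<open>n\<close>, or in every grid of \<open>[0, n]\<close> some cell contains an increment of at least two.
  A cell of length \<open>h\<close> does so with probability at most \<open>(r h)\<^sup>2\<close>, which sums to \<open>O(1 / m)\<close> over \<open>m\<close> cells.\<close>

lemma skip_value_null: "AE \<omega> in M. \<exists>t\<ge>0. N t \<omega> = k"
proof -
  \<comment> \<open>Rational times make the event measurable, and the grids below consist of rational times.\<close>
  define S where "S = {\<omega>\<in>space M. \<forall>q::rat. 0 \<le> q \<longrightarrow> N (of_rat q) \<omega> \<noteq> k}"
  have meas: "N (of_rat q) \<in> measurable M (count_space UNIV)" if "0 \<le> q" for q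
    using that by (intro N_measurable) simp
  have [measurable]: "S \<in> sets M"
    unfolding S_def
  proof (rule sets.sets_Collect_countable_All)
    fix q :: rat
    show "{\<omega>\<in>space M. 0 \<le> q \<longrightarrow> N (of_rat q) \<omega> \<noteq> k} \<in> sets M"
    proof (cases "0 \<le> q")
      case True
      then have [measurable]: "N (of_rat q) \<in> measurable M (count_space UNIV)" by (rule meas)
      show ?thesis by measurable
    qed simp
  qed
  have bound: "prob S \<le> measure (poisson_pmf (r * real (Suc n))) {..<k} + (r * real (Suc n))\<^sup>2 / real (Suc m)"
    (is "_ \<le> ?p + _") for n m :: nat
  proof -
    define g where "g i = real i * (real (Suc n) / real (Suc m))" for i
    have g_nn: "0 \<le> g i" for i by (simp add: g_def)
    have g_rat: "g i = of_rat (of_nat i * (of_nat (Suc n) / of_nat (Suc m)))" for i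
      by (simp add: g_def of_rat_mult of_rat_divide del: of_nat_Suc)
    have g_diff: "g (Suc i) - g i = real (Suc n) / real (Suc m)" for i
      unfolding g_def left_diff_distrib[symmetric] by simp
    have g_last: "g (Suc m) = real (Suc n)" by (simp add: g_def)
    have [measurable]: "N (g i) \<in> measurable M (count_space UNIV)" "N 0 \<in> measurable M (count_space UNIV)" for i
      using N_measurable g_nn by auto
    let ?A = "{\<omega>\<in>space M. N (real (Suc n)) \<omega> - N 0 \<omega> \<in> {..<k}}"
    let ?D = "\<lambda>i. {\<omega>\<in>space M. N (g (Suc i)) \<omega> - N (g i) \<omega> \<in> {2..}}"
    have [measurable]: "?A \<in> sets M"
      unfolding g_last[symmetric] by measurable
    have [measurable]: "?D i \<in> sets M" for i by measurable
    have "AE \<omega> in M. \<omega> \<in> S \<longrightarrow> \<omega> \<in> ?A \<union> (\<Union>i\<in>{..<Suc m}. ?D i)"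
      using N_paths
    proof eventually_elim
      case (elim \<omega>)
      show ?case
      proof
        assume "\<omega> \<in> S"
        then have sp: "\<omega> \<in> space M" and ne: "\<And>i. N (g i) \<omega> \<noteq> k"
          unfolding S_def g_rat using g_nn[unfolded g_rat] by auto
        show "\<omega> \<in> ?A \<union> (\<Union>i\<in>{..<Suc m}. ?D i)"
        proof (cases "k \<le> N (g (Suc m)) \<omega>")
          case True
          define i where "i = (LEAST i. k \<le> N (g i) \<omega>)"
          have i: "k \<le> N (g i) \<omega>" unfolding i_def using True by (rule LeastI)
          have im: "i \<le> Suc m" unfolding i_def using True by (rule Least_le)
          have "i \<noteq> 0" using ne[of 0] i elim by (cases "i = 0") (auto simp: g_def)
          then obtain j where j: "i = Suc j" by (cases i) auto
          have "N (g j) \<omega> < k"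
            using not_less_Least[of j "\<lambda>i. k \<le> N (g i) \<omega>"] j by (simp add: i_def[symmetric])
          moreover have "k < N (g (Suc j)) \<omega>" using i j ne[of "Suc j"] by simp
          ultimately have "\<omega> \<in> ?D j" using sp by simp
          moreover have "j \<in> {..<Suc m}" using im j by simp
          ultimately show ?thesis by blast
        next
          case False
          then show ?thesis using sp elim by (simp add: g_last)
        qed
      qed
    qed
    then have "prob S \<le> prob (?A \<union> (\<Union>i\<in>{..<Suc m}. ?D i))"
      by (rule finite_measure_mono_AE) measurable
    also have "\<dots> \<le> prob ?A + prob (\<Union>i\<in>{..<Suc m}. ?D i)"
      by (rule measure_Un_le) measurable
    also have "prob (\<Union>i\<in>{..<Suc m}. ?D i) \<le> (\<Sum>i<Suc m. prob (?D i))"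
      by (rule finite_measure_subadditive_finite) auto
    also have "\<dots> \<le> (\<Sum>i<Suc m. (r * (real (Suc n) / real (Suc m)))\<^sup>2)"
    proof (rule sum_mono)
      fix i
      have pos: "0 < real (Suc n) / real (Suc m)" by simp
      then have "g i < g (Suc i)" using g_diff[of i] by linarith
      moreover have "0 < r * (real (Suc n) / real (Suc m))" using pos r_pos by (rule mult_pos_pos[rotated])
      ultimately show "prob (?D i) \<le> (r * (real (Suc n) / real (Suc m)))\<^sup>2"
        using increment_prob[OF g_nn, of i "g (Suc i)" "{2..}"] poisson_ge_2 unfolding g_diff by metis
    qed
    also have "\<dots> = (r * real (Suc n))\<^sup>2 / real (Suc m)"
      by (simp add: power2_eq_square divide_simps del: of_nat_Suc)
    finally show ?thesis
      using increment_prob[of 0 "real (Suc n)" "{..<k}"] by simp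
  qed
  have "prob S \<le> measure (poisson_pmf (r * real (Suc n))) {..<k}" for n
  proof (rule LIMSEQ_le_const)
    have "(\<lambda>m. (r * real (Suc n))\<^sup>2 / real (Suc m)) \<longlonglongrightarrow> 0"
      unfolding divide_inverse by (intro tendsto_mult_right_zero LIMSEQ_inverse_real_of_nat)
    then show "(\<lambda>m. measure (poisson_pmf (r * real (Suc n))) {..<k} + (r * real (Suc n))\<^sup>2 / real (Suc m))
        \<longlonglongrightarrow> measure (poisson_pmf (r * real (Suc n))) {..<k}"
      using tendsto_add[OF tendsto_const, of _ 0] by fastforce
  qed (use bound in blast)
  then have "prob S \<le> 0"
    using poisson_less_tendsto_0[OF r_pos, of k] by (intro LIMSEQ_le_const) auto
  then have "S \<in> null_sets M" by (simp add: null_sets_def emeasure_eq_measure measure_le_0_iff)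
  then show ?thesis
  proof (rule AE_I')
    show "{\<omega>\<in>space M. \<not> (\<exists>t\<ge>0. N t \<omega> = k)} \<subseteq> S"
      unfolding S_def using zero_le_of_rat_iff[where 'a = real] by blast
  qed
qed

text \<open>The past is described by finitely many values of \<open>N\<close>. Listing the times in increasing order,
  preceded by \<open>0\<close> and followed by \<open>s\<close> and \<open>t\<close>, these values become partial sums of increments other than the
  last one, and the increments are independent. The field \<open>F0\<close> joins by its
  independence of the whole process.\<close>

lemma past_increment_indep:
  assumes A: "A \<in> sets F0" and J: "finite J" "J \<subseteq> {0<..s}" and st: "0 \<le> s" "s < t"
  shows "prob (A \<inter> {\<omega>\<in>space M. \<forall>u\<in>J. N u \<omega> = \<kappa> u} \<inter> {\<omega>\<in>space M. N t \<omega> - N s \<omega> \<in> K})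
    = prob (A \<inter> {\<omega>\<in>space M. \<forall>u\<in>J. N u \<omega> = \<kappa> u}) * measure (poisson_pmf (r * (t - s))) K"
    (is "prob (A \<inter> ?C \<inter> ?E) = _")
proof -
  define xs where "xs = sorted_list_of_set (insert 0 (insert s J))"
  have xs: "set xs = insert 0 (insert s J)" "sorted xs" "xs \<noteq> []"
    using J by (auto simp: xs_def simp del: sorted_list_of_set_insert_remove)
  define m where "m = length xs - 1"
  have len: "length xs = Suc m" using xs by (simp add: m_def)
  define \<tau> where "\<tau> i = (if i \<le> m then xs ! i else t)" for i
  have in_xs: "0 \<le> x \<and> x \<le> s" if "x \<in> set xs" for x
    using that J st by (auto simp: xs)
  have "mono \<tau>"
  proof (rule monoI)
    fix i j :: nat assume "i \<le> j"
    have "xs ! i \<le> t" if "i \<le> m" using in_xs[of "xs ! i"] that st len by auto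
    then show "\<tau> i \<le> \<tau> j" using \<open>i \<le> j\<close> xs(2) len by (auto simp: \<tau>_def sorted_nth_mono)
  qed
  obtain i0 where "i0 \<le> m" "xs ! i0 = 0" using xs(1) len by (metis in_set_conv_nth insertI1 less_Suc_eq_le)
  then have \<tau>0: "\<tau> 0 = 0" using xs(2) len in_xs[of "xs ! 0"] sorted_nth_mono[of xs 0 i0] by (auto simp: \<tau>_def)
  obtain i1 where "i1 \<le> m" "xs ! i1 = s" using xs(1) len by (metis in_set_conv_nth insertI1 insertI2 less_Suc_eq_le)
  then have \<tau>m: "\<tau> m = s" using xs(2) len in_xs[of "xs ! m"] sorted_nth_mono[of xs i1 m] by (auto simp: \<tau>_def)
  have \<tau>Sm: "\<tau> (Suc m) = t" by (simp add: \<tau>_def)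
  have "\<exists>i\<le>m. \<tau> i = u" if "u \<in> J" for u
    using xs(1) len that by (metis \<tau>_def in_set_conv_nth insertI2 less_Suc_eq_le)
  then obtain idx where idx: "\<And>u. u \<in> J \<Longrightarrow> idx u \<le> m \<and> \<tau> (idx u) = u" by metis
  have \<tau>_nn: "0 \<le> \<tau> i" for i using monoD[OF \<open>mono \<tau>\<close>, of 0 i] \<tau>0 by simp
  define D where "D i \<omega> = N (\<tau> (Suc i)) \<omega> - N (\<tau> i) \<omega>" for i \<omega>
  have [measurable]: "N (\<tau> i) \<in> measurable M (count_space UNIV)" for i
    using N_measurable \<tau>_nn by auto
  have [measurable]: "D i \<in> measurable M (count_space UNIV)" for i unfolding D_def by measurable
  have [measurable]: "N u \<in> measurable M (count_space UNIV)" if "u \<in> J" for u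
    using that J by (intro N_measurable) auto
  have [measurable]: "N s \<in> measurable M (count_space UNIV)" "N t \<in> measurable M (count_space UNIV)"
    using st by (auto intro: N_measurable)
  have C_meas [measurable]: "?C \<in> sets M"
    by (intro sets.sets_Collect_finite_All J(1)) measurable
  have E_meas [measurable]: "?E \<in> sets M" by measurable
  let ?f = "\<lambda>d. \<forall>u\<in>J. (\<Sum>i<idx u. d i) = \<kappa> u"
  have indep: "indep_var (count_space UNIV) (?f \<circ> (\<lambda>\<omega>. restrict (\<lambda>i. D i \<omega>) {..<m}))
      (count_space UNIV) ((\<lambda>d. d m \<in> K) \<circ> (\<lambda>\<omega>. restrict (\<lambda>i. D i \<omega>) {m}))"
  proof (rule indep_var_compose[OF indep_var_restrict])
    show "indep_vars (\<lambda>_. count_space UNIV) D {..<Suc m}"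
      using increments_indep[of \<tau> "Suc m"] \<tau>_nn \<open>mono \<tau>\<close> by (simp add: D_def[abs_def])
    have [measurable]: "(\<lambda>d. \<Sum>i<idx u. d i) \<in> measurable (PiM {..<m} (\<lambda>_. count_space (UNIV::nat set))) (count_space UNIV)"
      if "u \<in> J" for u
      using idx[OF that] by (intro measurable_sum_nat) auto
    show "?f \<in> measurable (PiM {..<m} (\<lambda>_. count_space (UNIV::nat set))) (count_space UNIV)"
      using J(1) by measurable
  qed auto
  have "AE \<omega> in M. \<forall>j\<le>m. (\<Sum>i<j. D i \<omega>) = N (\<tau> j) \<omega>"
    using N_paths
  proof eventually_elim
    case (elim \<omega>)
    show ?case
    proof (intro allI impI)
      fix j assume "j \<le> m"
      show "(\<Sum>i<j. D i \<omega>) = N (\<tau> j) \<omega>"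
      proof (induction j)
        case (Suc j)
        have "N (\<tau> j) \<omega> \<le> N (\<tau> (Suc j)) \<omega>"
          using elim \<tau>_nn monoD[OF \<open>mono \<tau>\<close>, of j "Suc j"] by (auto intro: mono_onD)
        then show ?case using Suc by (simp add: D_def)
      qed (use elim \<tau>0 in simp)
    qed
  qed
  then have C_iff: "AE \<omega> in M. ?f (restrict (\<lambda>i. D i \<omega>) {..<m}) \<longleftrightarrow> (\<forall>u\<in>J. N u \<omega> = \<kappa> u)"
  proof eventually_elim
    case (elim \<omega>)
    have "(\<Sum>i<idx u. restrict (\<lambda>i. D i \<omega>) {..<m} i) = N u \<omega>" if "u \<in> J" for u
      using elim idx[OF that] by (auto intro!: sum.cong)
    then show ?case by simp
  qed
  let ?C' = "{\<omega>\<in>space M. ?f (restrict (\<lambda>i. D i \<omega>) {..<m})}"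
  have f_meas [measurable]: "?C' \<in> sets M"
  proof -
    have "(?f \<circ> (\<lambda>\<omega>. restrict (\<lambda>i. D i \<omega>) {..<m})) \<in> measurable M (count_space UNIV)"
      using indep by (auto dest: indep_var_rv1)
    then show ?thesis by (simp add: pred_def comp_def)
  qed
  have "prob (?C' \<inter> ?E) = prob ?C' * prob ?E"
    using indep_varD[OF indep, of "{True}" "{True}"] by (simp add: vimage_def Int_def D_def \<tau>m \<tau>Sm conj_ac)
  moreover have "prob ?C' = prob ?C"
  proof (rule finite_measure_eq_AE[OF _ f_meas C_meas])
    show "AE \<omega> in M. (\<omega> \<in> ?C') = (\<omega> \<in> ?C)" using C_iff by eventually_elim simp
  qed
  moreover have "prob (?C' \<inter> ?E) = prob (?C \<inter> ?E)"
  proof (rule finite_measure_eq_AE[OF _ sets.Int[OF f_meas E_meas] sets.Int[OF C_meas E_meas]])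
    show "AE \<omega> in M. (\<omega> \<in> ?C' \<inter> ?E) = (\<omega> \<in> ?C \<inter> ?E)" using C_iff by eventually_elim simp
  qed
  ultimately have CE: "prob (?C \<inter> ?E) = prob ?C * prob ?E" by simp
  let ?\<G> = "\<Union>t\<in>{0..}. {N t -` A \<inter> space M | A. A \<in> UNIV}"
  have sub: "?\<G> \<subseteq> Pow (space M)" by auto
  have N_gen: "N u \<in> measurable (sigma (space M) ?\<G>) (count_space UNIV)" if "0 \<le> u" for u
    using that sub by (intro measurableI) (auto simp: sets_measure_of space_measure_of_conv intro!: sigma_sets.Basic)
  have sp: "space (sigma (space M) ?\<G>) = space M" by (simp add: space_measure_of_conv)
  have C: "?C \<in> sigma_sets (space M) ?\<G>"
  proof -
    have "{\<omega>\<in>space (sigma (space M) ?\<G>). \<forall>u\<in>J. N u \<omega> = \<kappa> u} \<in> sets (sigma (space M) ?\<G>)"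
    proof (intro sets.sets_Collect_finite_All J(1))
      fix u assume "u \<in> J"
      then have [measurable]: "N u \<in> measurable (sigma (space M) ?\<G>) (count_space UNIV)"
        using J by (intro N_gen) auto
      show "{\<omega>\<in>space (sigma (space M) ?\<G>). N u \<omega> = \<kappa> u} \<in> sets (sigma (space M) ?\<G>)" by measurable
    qed
    then show ?thesis using sub by (simp add: sp sets_measure_of)
  qed
  have E: "?E \<in> sigma_sets (space M) ?\<G>"
  proof -
    have "{\<omega>\<in>space (sigma (space M) ?\<G>). N t \<omega> - N s \<omega> \<in> K} \<in> sets (sigma (space M) ?\<G>)"
      using st by (intro nat_diff_event N_gen) auto
    then show ?thesis using sub by (simp add: sp sets_measure_of)
  qed
  interpret \<G>: sigma_algebra "space M" "sigma_sets (space M) ?\<G>"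
    by (rule sigma_algebra_sigma_sets[OF sub])
  have CE': "?C \<inter> ?E \<in> sigma_sets (space M) ?\<G>"
    using C E by (rule \<G>.Int)
  show ?thesis
    using indep_setD[OF F0_indep A C] indep_setD[OF F0_indep A CE'] CE increment_prob[OF st]
    by (simp add: Int_assoc)
qed

end

text \<open>A deterministic counting path, used as the value of the process on the exceptional null set.\<close>

lemma floor_counting_path: "counting_path (\<lambda>t. nat \<lfloor>t\<rfloor>)"
proof
  show "nat \<lfloor>t\<rfloor> = 0" if "t \<le> 0" for t :: real using that by simp
  show "mono (\<lambda>t::real. nat \<lfloor>t\<rfloor>)" by (intro monoI nat_mono floor_mono)
  show "continuous (at_right t) (\<lambda>s. real (nat \<lfloor>s\<rfloor>))" for t :: real
  proof -
    have "\<forall>\<^sub>F s in at_right t. real (nat \<lfloor>s\<rfloor>) = real (nat \<lfloor>t\<rfloor>)"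
      unfolding eventually_at_right_field
    proof (intro exI[of _ "of_int (\<lfloor>t\<rfloor> + 1)"] conjI allI impI)
      fix s assume "t < s" "s < of_int (\<lfloor>t\<rfloor> + 1)"
      then have "\<lfloor>s\<rfloor> = \<lfloor>t\<rfloor>" by linarith
      then show "real (nat \<lfloor>s\<rfloor>) = real (nat \<lfloor>t\<rfloor>)" by simp
    qed linarith
    then show ?thesis unfolding continuous_within by (rule tendsto_eventually)
  qed
  show "surj (\<lambda>t::real. nat \<lfloor>t\<rfloor>)"
    by (rule surjI[of _ real]) simp
qed

text \<open>The Poisson process as used from here on: every path is regular, \<open>G\<close> is a
  filtration to which \<open>N\<close> is adapted, and increments are independent of the past.\<close>

locale poisson_counting = prob_space M
  for M :: "'a measure" +
  fixes r :: real and G :: "real \<Rightarrow> 'a measure" and N :: "real \<Rightarrow> 'a \<Rightarrow> nat"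
  assumes r_pos: "0 < r"
    and path: "\<omega> \<in> space M \<Longrightarrow> counting_path (\<lambda>t. N t \<omega>)"
    and G_sub: "subalgebra M (G t)"
    and G_mono: "s \<le> t \<Longrightarrow> sets (G s) \<subseteq> sets (G t)"
    and N_adapted: "N t \<in> measurable (G t) (count_space UNIV)"
    and increment_indep: "0 \<le> s \<Longrightarrow> s < t \<Longrightarrow> A \<in> sets (G s) \<Longrightarrow>
      prob (A \<inter> {\<omega>\<in>space M. N t \<omega> - N s \<omega> \<in> K}) = prob A * measure (poisson_pmf (r * (t - s))) K"

context poisson_with_initial_field
begin

lemma regular_paths: "AE \<omega> in M. counting_path (\<lambda>t. if t \<le> 0 then 0 else N t \<omega>)"
proof -
  have "AE \<omega> in M. \<forall>k. \<exists>t\<ge>0. N t \<omega> = k"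
    using skip_value_null by (simp add: AE_all_countable)
  with N_paths show ?thesis
  proof eventually_elim
    case (elim \<omega>)
    let ?n = "\<lambda>t. if t \<le> 0 then 0 else N t \<omega>"
    show ?case
    proof
      show "mono ?n"
        by (intro monoI) (use elim in \<open>auto intro: mono_onD\<close>)
      show "continuous (at_right t) (\<lambda>s. real (?n s))" for t
      proof (cases "0 \<le> t")
        case True
        then have "((\<lambda>s. real (N s \<omega>)) \<longlongrightarrow> real (?n t)) (at_right t)"
          using elim by (auto simp: continuous_within)
        moreover have "\<forall>\<^sub>F s in at_right t. real (N s \<omega>) = real (?n s)"
          unfolding eventually_at_right_field using True by (intro exI[of _ "t + 1"]) auto
        ultimately show ?thesis
          unfolding continuous_within by (rule Lim_transform_eventually)
      next
        case False
        then have "\<forall>\<^sub>F s in at_right t. real (?n s) = real (?n t)"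
          unfolding eventually_at_right_field by (intro exI[of _ 0]) auto
        then show ?thesis unfolding continuous_within by (rule tendsto_eventually)
      qed
      show "surj ?n"
      proof (rule surjI)
        fix k
        obtain t where "0 \<le> t" "N t \<omega> = k" using elim by blast
        then show "?n (SOME t. ?n t = k) = k" using elim by (intro someI[of "\<lambda>t. ?n t = k" t]) auto
      qed
    qed simp
  qed
qed

text \<open>The filtration at time \<open>s\<close> is generated by \<open>F0\<close> and the modified process up to time \<open>s\<close>. Its generators
  fix the values at finitely many times, so they form a system stable under intersection, on which the
  modification differs from the original process by a null set only; independence
  then extends to the generated \<open>\<sigma>\<close>-field.\<close>

lemma counting_version:
  obtains G :: "real \<Rightarrow> 'a measure" and N' :: "real \<Rightarrow> 'a \<Rightarrow> nat"
  where "poisson_counting M r G N'"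
    and "\<And>s. sets F0 \<subseteq> sets (G s)"
    and "AE \<omega> in M. \<forall>t\<ge>0. N' t \<omega> = N t \<omega>"
proof -
  obtain U where U: "U \<in> null_sets M"
    "\<And>\<omega>. \<omega> \<in> space M - U \<Longrightarrow> counting_path (\<lambda>t. if t \<le> 0 then 0 else N t \<omega>) \<and> N 0 \<omega> = 0"
  proof -
    have "AE \<omega> in M. counting_path (\<lambda>t. if t \<le> 0 then 0 else N t \<omega>) \<and> N 0 \<omega> = 0"
      using regular_paths N_paths by eventually_elim simp
    then show ?thesis using that by (blast elim!: AE_E3)
  qed
  have [measurable]: "U \<in> sets M" using U(1) by auto
  define N' where "N' t \<omega> = (if \<omega> \<in> U then nat \<lfloor>t\<rfloor> else if t \<le> 0 then 0 else N t \<omega>)" for t \<omega>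
  have path: "counting_path (\<lambda>t. N' t \<omega>)" if "\<omega> \<in> space M" for \<omega>
    using that U(2)[of \<omega>] floor_counting_path by (cases "\<omega> \<in> U") (simp_all add: N'_def)
  have N'_neg: "N' t \<omega> = 0" if "t \<le> 0" for t \<omega> using that by (simp add: N'_def)
  have N'_meas [measurable]: "N' t \<in> measurable M (count_space UNIV)" for t
  proof (cases "t \<le> 0")
    case False
    then have [measurable]: "N t \<in> measurable M (count_space UNIV)" by (intro N_measurable) auto
    show ?thesis unfolding N'_def using False by simp
  next
    case True
    then have "N' t = (\<lambda>_. 0)" by (simp add: N'_neg fun_eq_iff)
    then show ?thesis by simp
  qed
  have AE_U: "AE \<omega> in M. \<omega> \<notin> U" using U(1) by (rule AE_not_in)
  have eq: "AE \<omega> in M. \<forall>t\<ge>0. N' t \<omega> = N t \<omega>"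
    using AE_U AE_space by eventually_elim (use U(2) in \<open>auto simp: N'_def\<close>)
  \<comment> \<open>Times \<open>u \<le> 0\<close> may be left out because \<open>N'\<close> vanishes there; the empty set is added for stability under intersection.\<close>
  define cyl where "cyl s = {A \<inter> {\<omega>\<in>space M. \<forall>u\<in>J. N' u \<omega> = \<kappa> u} | A J \<kappa>.
    A \<in> sets F0 \<and> finite J \<and> J \<subseteq> {0<..s}} \<union> {{}}" for s
  have F0: "space F0 = space M" "sets F0 \<subseteq> sets M"
    using F0_sub by (auto simp: subalgebra_def)
  have cylI: "A \<inter> {\<omega>\<in>space M. \<forall>u\<in>J. N' u \<omega> = \<kappa> u} \<in> cyl s"
    if "A \<in> sets F0" "finite J" "J \<subseteq> {0<..s}" for A J \<kappa> s
    unfolding cyl_def using that by blast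
  have event: "{\<omega>\<in>space M. \<forall>u\<in>J. N' u \<omega> = \<kappa> u} \<in> sets M" if "finite J" for J \<kappa>
    using that by (intro sets.sets_Collect_finite_All) measurable
  have cyl_M: "cyl s \<subseteq> sets M" for s
    unfolding cyl_def using F0(2) by (auto intro!: event)
  have cyl_stable: "Int_stable (cyl s)" for s
  proof (rule Int_stableI)
    fix E E' assume E: "E \<in> cyl s" "E' \<in> cyl s"
    show "E \<inter> E' \<in> cyl s"
    proof (cases "E = {} \<or> E' = {}")
      case True
      then show ?thesis by (auto simp: cyl_def)
    next
      case False
      obtain A J \<kappa> where 1: "E = A \<inter> {\<omega>\<in>space M. \<forall>u\<in>J. N' u \<omega> = \<kappa> u}"
        "A \<in> sets F0" "finite J" "J \<subseteq> {0<..s}"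
        using E(1) False by (auto simp: cyl_def)
      obtain A' J' \<kappa>' where 2: "E' = A' \<inter> {\<omega>\<in>space M. \<forall>u\<in>J'. N' u \<omega> = \<kappa>' u}"
        "A' \<in> sets F0" "finite J'" "J' \<subseteq> {0<..s}"
        using E(2) False by (auto simp: cyl_def)
      show ?thesis
      proof (cases "\<forall>u\<in>J \<inter> J'. \<kappa> u = \<kappa>' u")
        case True
        define \<kappa>'' where "\<kappa>'' u = (if u \<in> J then \<kappa> u else \<kappa>' u)" for u
        have "E \<inter> E' = (A \<inter> A') \<inter> {\<omega>\<in>space M. \<forall>u\<in>J \<union> J'. N' u \<omega> = \<kappa>'' u}"
          unfolding 1(1) 2(1) \<kappa>''_def using True by auto
        also have "\<dots> \<in> cyl s" using 1 2 by (intro cylI) auto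
        finally show ?thesis .
      next
        case False
        then have "E \<inter> E' = {}" unfolding 1(1) 2(1) by auto
        then show ?thesis by (simp add: cyl_def)
      qed
    qed
  qed
  define G where "G s = sigma (space M) (cyl s)" for s
  have cyl_Pow: "cyl s \<subseteq> Pow (space M)" for s
    using cyl_M sets.space_closed[of M] by blast
  have G_sets: "sets (G s) = sigma_sets (space M) (cyl s)" and G_space: "space (G s) = space M" for s
    using cyl_Pow by (simp_all add: G_def sets_measure_of space_measure_of)
  have F0_G: "sets F0 \<subseteq> sets (G s)" for s
  proof
    fix A assume "A \<in> sets F0"
    then have "A \<inter> {\<omega>\<in>space M. \<forall>u\<in>{}. N' u \<omega> = 0} \<in> sets (G s)"
      unfolding G_sets by (intro sigma_sets.Basic cylI) auto
    then show "A \<in> sets (G s)"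
      using sets.sets_into_space[OF \<open>A \<in> sets F0\<close>] by (simp add: F0(1) Int_absorb2)
  qed
  have "poisson_counting M r G N'"
  proof (intro poisson_counting.intro poisson_counting_axioms.intro prob_space_axioms)
    show "0 < r" by (rule r_pos)
    show "counting_path (\<lambda>t. N' t \<omega>)" if "\<omega> \<in> space M" for \<omega> using that by (rule path)
    show "subalgebra M (G t)" for t
      unfolding subalgebra_def G_space G_sets using sets.sigma_sets_subset[OF cyl_M] by simp
    show "sets (G s) \<subseteq> sets (G t)" if "s \<le> t" for s t
    proof -
      have "cyl s \<subseteq> cyl t"
      proof
        fix E assume "E \<in> cyl s"
        then consider "E = {}" | A J \<kappa> where "E = A \<inter> {\<omega>\<in>space M. \<forall>u\<in>J. N' u \<omega> = \<kappa> u}"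
            "A \<in> sets F0" "finite J" "J \<subseteq> {0<..s}"
          unfolding cyl_def by blast
        then show "E \<in> cyl t"
        proof cases
          case 2
          have "J \<subseteq> {0<..t}" using 2(4) that by auto
          then show ?thesis unfolding 2(1) using 2 by (intro cylI)
        qed (simp add: cyl_def)
      qed
      then show ?thesis unfolding G_sets by (rule sigma_sets_mono')
    qed
    show "N' t \<in> measurable (G t) (count_space UNIV)" for t
    proof (cases "t \<le> 0")
      case False
      have "{\<omega>\<in>space M. N' t \<omega> = k} \<in> sets (G t)" for k
      proof -
        have "space M \<inter> {\<omega>\<in>space M. \<forall>u\<in>{t}. N' u \<omega> = k} \<in> sets (G t)"
          unfolding G_sets using False F0(1) sets.top[of F0] by (intro sigma_sets.Basic cylI) auto
        then show ?thesis by (simp add: Int_def)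
      qed
      then show ?thesis
        by (subst measurable_count_space_eq2_countable) (auto simp: G_space vimage_def Int_def conj_commute)
    next
      case True
      then have "N' t = (\<lambda>_. 0)" by (simp add: N'_neg fun_eq_iff)
      then show ?thesis by simp
    qed
    fix s t :: real and A K assume st: "0 \<le> s" "s < t" and A: "A \<in> sets (G s)"
    let ?\<D> = "range (\<lambda>K. {\<omega>\<in>space M. N' t \<omega> - N' s \<omega> \<in> K})"
    have D_stable: "Int_stable ?\<D>"
    proof (rule Int_stableI)
      fix E E' assume "E \<in> ?\<D>" "E' \<in> ?\<D>"
      then obtain K K' where "E = {\<omega>\<in>space M. N' t \<omega> - N' s \<omega> \<in> K}" "E' = {\<omega>\<in>space M. N' t \<omega> - N' s \<omega> \<in> K'}"
        by blast
      then have "E \<inter> E' = {\<omega>\<in>space M. N' t \<omega> - N' s \<omega> \<in> K \<inter> K'}" by auto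
      then show "E \<inter> E' \<in> ?\<D>" by blast
    qed
    have [measurable]: "N t \<in> measurable M (count_space UNIV)" "N s \<in> measurable M (count_space UNIV)"
      using st by (auto intro!: N_measurable)
    have cyl_prob: "prob (A \<inter> {\<omega>\<in>space M. \<forall>u\<in>J. N' u \<omega> = \<kappa> u} \<inter> {\<omega>\<in>space M. N' t \<omega> - N' s \<omega> \<in> K})
      = prob (A \<inter> {\<omega>\<in>space M. \<forall>u\<in>J. N' u \<omega> = \<kappa> u}) * measure (poisson_pmf (r * (t - s))) K"
      if A: "A \<in> sets F0" and J: "finite J" "J \<subseteq> {0<..s}" for A J \<kappa> K
    proof -
      have [measurable]: "A \<in> sets M" using A F0 by auto
      have N_u: "N u \<in> measurable M (count_space UNIV)" if "u \<in> J" for u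
        using that J by (intro N_measurable) auto
      have [measurable]: "{\<omega>\<in>space M. \<forall>u\<in>J. N u \<omega> = \<kappa> u} \<in> sets M"
        using J(1) N_u by (intro sets.sets_Collect_finite_All) auto
      have [measurable]: "{\<omega>\<in>space M. \<forall>u\<in>J. N' u \<omega> = \<kappa> u} \<in> sets M" by (rule event[OF J(1)])
      have same: "AE \<omega> in M. (\<forall>u\<in>J. N' u \<omega> = \<kappa> u) = (\<forall>u\<in>J. N u \<omega> = \<kappa> u)
          \<and> N' t \<omega> = N t \<omega> \<and> N' s \<omega> = N s \<omega>"
        using eq
      proof eventually_elim
        case (elim \<omega>)
        have "N' u \<omega> = N u \<omega>" if "u \<in> J" for u using elim that J by auto
        then show ?case using elim st by auto
      qed
      have "prob (A \<inter> {\<omega>\<in>space M. \<forall>u\<in>J. N' u \<omega> = \<kappa> u} \<inter> {\<omega>\<in>space M. N' t \<omega> - N' s \<omega> \<in> K})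
        = prob (A \<inter> {\<omega>\<in>space M. \<forall>u\<in>J. N u \<omega> = \<kappa> u} \<inter> {\<omega>\<in>space M. N t \<omega> - N s \<omega> \<in> K})"
      proof (rule finite_measure_eq_AE)
        show "AE \<omega> in M. (\<omega> \<in> A \<inter> {\<omega>\<in>space M. \<forall>u\<in>J. N' u \<omega> = \<kappa> u} \<inter> {\<omega>\<in>space M. N' t \<omega> - N' s \<omega> \<in> K})
          = (\<omega> \<in> A \<inter> {\<omega>\<in>space M. \<forall>u\<in>J. N u \<omega> = \<kappa> u} \<inter> {\<omega>\<in>space M. N t \<omega> - N s \<omega> \<in> K})"
          using same by eventually_elim simp
      qed measurable
      moreover have "prob (A \<inter> {\<omega>\<in>space M. \<forall>u\<in>J. N' u \<omega> = \<kappa> u}) = prob (A \<inter> {\<omega>\<in>space M. \<forall>u\<in>J. N u \<omega> = \<kappa> u})"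
      proof (rule finite_measure_eq_AE)
        show "AE \<omega> in M. (\<omega> \<in> A \<inter> {\<omega>\<in>space M. \<forall>u\<in>J. N' u \<omega> = \<kappa> u})
          = (\<omega> \<in> A \<inter> {\<omega>\<in>space M. \<forall>u\<in>J. N u \<omega> = \<kappa> u})"
          using same by eventually_elim simp
      qed measurable
      ultimately show ?thesis using past_increment_indep[OF A J st] by simp
    qed
    have increment': "prob {\<omega>\<in>space M. N' t \<omega> - N' s \<omega> \<in> K} = measure (poisson_pmf (r * (t - s))) K" for K
      using cyl_prob[of "space M" "{}" "\<lambda>_. 0" K] sets.top[of F0] F0(1) by (simp add: prob_space Int_def)
    have "indep_set (cyl s) ?\<D>"
    proof (rule indep_setI)
      show "cyl s \<subseteq> events" by (rule cyl_M)
      show "?\<D> \<subseteq> events" by auto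
      fix E D assume "E \<in> cyl s" "D \<in> ?\<D>"
      then obtain K where D: "D = {\<omega>\<in>space M. N' t \<omega> - N' s \<omega> \<in> K}" by blast
      show "prob (E \<inter> D) = prob E * prob D"
      proof (cases "E = {}")
        case False
        then obtain A J \<kappa> where "E = A \<inter> {\<omega>\<in>space M. \<forall>u\<in>J. N' u \<omega> = \<kappa> u}"
          "A \<in> sets F0" "finite J" "J \<subseteq> {0<..s}"
          using \<open>E \<in> cyl s\<close> by (auto simp: cyl_def)
        then show ?thesis using cyl_prob by (simp add: D increment')
      qed simp
    qed
    from indep_set_sigma_sets[OF this cyl_stable D_stable]
    have "prob (A \<inter> {\<omega>\<in>space M. N' t \<omega> - N' s \<omega> \<in> K}) = prob A * prob {\<omega>\<in>space M. N' t \<omega> - N' s \<omega> \<in> K}"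
      using A unfolding G_sets by (rule indep_setD) (rule sigma_sets.Basic, rule rangeI)
    then show "prob (A \<inter> {\<omega>\<in>space M. N' t \<omega> - N' s \<omega> \<in> K}) = prob A * measure (poisson_pmf (r * (t - s))) K"
      by (simp add: increment')
  qed
  then show ?thesis using F0_G eq by (rule that)
qed

end

lemma poisson_process_rescale:
  assumes N: "poisson_process M 1 N" and \<epsilon>: "0 < \<epsilon>" and M: "prob_space M"
  shows "poisson_process M (1 / \<epsilon>) (\<lambda>t. N (t / \<epsilon>))"
  unfolding poisson_process_def
proof (intro conjI allI impI)
  show "N (t / \<epsilon>) \<in> measurable M (count_space UNIV)" if "0 \<le> t" for t
    using N that \<epsilon> by (simp add: poisson_process_def)
  have "AE \<omega> in M. N 0 \<omega> = 0 \<and> mono_on {0..} (\<lambda>t. N t \<omega>) \<and>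
        (\<forall>t\<ge>0. continuous (at_right t) (\<lambda>s. real (N s \<omega>)))"
    using N by (simp add: poisson_process_def)
  then show "AE \<omega> in M. N (0 / \<epsilon>) \<omega> = 0 \<and> mono_on {0..} (\<lambda>t. N (t / \<epsilon>) \<omega>) \<and>
        (\<forall>t\<ge>0. continuous (at_right t) (\<lambda>s. real (N (s / \<epsilon>) \<omega>)))"
  proof eventually_elim
    case (elim \<omega>)
    have "mono_on {0..} (\<lambda>t. N (t / \<epsilon>) \<omega>)"
      using elim \<epsilon> by (auto intro!: mono_onI divide_right_mono elim!: mono_onD)
    moreover have "continuous (at_right t) (\<lambda>s. real (N (s / \<epsilon>) \<omega>))" if "0 \<le> t" for t
    proof -
      have "((\<lambda>s. real (N s \<omega>)) \<longlongrightarrow> real (N (t / \<epsilon>) \<omega>)) (at_right (t / \<epsilon>))"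
        using elim that \<epsilon> by (auto simp: continuous_within)
      moreover have "filterlim (\<lambda>s. s / \<epsilon>) (at_right (t / \<epsilon>)) (at_right t)"
      proof (rule tendsto_imp_filterlim_at_right)
        show "((\<lambda>s. s / \<epsilon>) \<longlongrightarrow> t / \<epsilon>) (at_right t)" by (intro tendsto_intros) (use \<epsilon> in auto)
        show "\<forall>\<^sub>F s in at_right t. t / \<epsilon> < s / \<epsilon>"
          unfolding eventually_at_right_field using \<epsilon> by (intro exI[of _ "t + 1"]) (auto intro: divide_strict_right_mono)
      qed
      ultimately show ?thesis
        unfolding continuous_within by (rule filterlim_compose)
    qed
    ultimately show ?case using elim by simp
  qed
  show "distr M (count_space UNIV) (\<lambda>\<omega>. N (t / \<epsilon>) \<omega> - N (s / \<epsilon>) \<omega>)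
      = measure_pmf (poisson_pmf (1 / \<epsilon> * (t - s)))" if "0 \<le> s \<and> s < t" for s t
  proof -
    have "0 \<le> s / \<epsilon> \<and> s / \<epsilon> < t / \<epsilon>" using that \<epsilon> by (auto intro: divide_strict_right_mono)
    then show ?thesis using N by (simp add: poisson_process_def diff_divide_distrib)
  qed
  show "prob_space.indep_vars M (\<lambda>_. count_space UNIV) (\<lambda>i \<omega>. N (\<tau> (Suc i) / \<epsilon>) \<omega> - N (\<tau> i / \<epsilon>) \<omega>) {..<n}"
    if "0 \<le> \<tau> 0 \<and> mono \<tau>" for \<tau> :: "nat \<Rightarrow> real" and n
  proof -
    have \<tau>: "0 \<le> \<tau> 0 / \<epsilon> \<and> mono (\<lambda>i. \<tau> i / \<epsilon>)"
      using that \<epsilon> by (auto intro!: monoI divide_right_mono dest: monoD)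
    have "prob_space.indep_vars M (\<lambda>_. count_space UNIV) (\<lambda>i \<omega>. N (\<tau> (Suc i)) \<omega> - N (\<tau> i) \<omega>) {..<n}"
      if "0 \<le> \<tau> 0 \<and> mono \<tau>" for \<tau> :: "nat \<Rightarrow> real"
      using N that by (simp add: poisson_process_def)
    from this[OF \<tau>] show ?thesis .
  qed
qed

lemma (in poisson_approximation) rescaled_initial_field:
  assumes \<epsilon>: "0 < \<epsilon>"
  shows "poisson_with_initial_field M (1 / \<epsilon>) F0 (\<lambda>t. N (t / \<epsilon>))"
proof
  show "poisson_process M (1 / \<epsilon>) (\<lambda>t. N (t / \<epsilon>))"
    using poisson_process_rescale[OF poisson \<epsilon>] prob_space_axioms .
  have "(\<lambda>t. t / \<epsilon>) ` {0..} = {0..}"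
  proof (intro equalityI subsetI)
    fix t :: real assume "t \<in> {0..}"
    then show "t \<in> (\<lambda>t. t / \<epsilon>) ` {0..}" using \<epsilon> by (intro image_eqI[of _ _ "t * \<epsilon>"]) auto
  qed (use \<epsilon> in auto)
  then have "(\<Union>t\<in>{0..}. g (t / \<epsilon>)) = (\<Union>t\<in>{0..}. g t)" for g :: "real \<Rightarrow> 'a set set"
    by (metis image_image)
  from this[of "\<lambda>t. {N t -` A \<inter> space M | A. A \<in> UNIV}"]
  show "indep_set (sets F0)
      (sigma_sets (space M) (\<Union>t\<in>{0..}. {N (t / \<epsilon>) -` A \<inter> space M | A. A \<in> UNIV}))"
    using F0_indep by simp
qed (use \<epsilon> F0_sub in auto)

section \<open>Jump sums of predictable processes\<close>

context poisson_counting
begin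

definition T :: "nat \<Rightarrow> 'a \<Rightarrow> real" where
  "T k \<omega> = counting_path.jump_time (\<lambda>t. N t \<omega>) k"

lemma T_le_iff: "\<omega> \<in> space M \<Longrightarrow> T k \<omega> \<le> t \<longleftrightarrow> Suc k \<le> N t \<omega>"
  unfolding T_def by (rule counting_path.jump_time_le_iff[OF path])

lemma jumps_between: "\<omega> \<in> space M \<Longrightarrow> {k. s < T k \<omega> \<and> T k \<omega> \<le> t} = {N s \<omega>..<N t \<omega>}"
  unfolding T_def by (rule counting_path.jumps_Ioc[OF path])

lemma N_mono: "\<omega> \<in> space M \<Longrightarrow> s \<le> t \<Longrightarrow> N s \<omega> \<le> N t \<omega>"
  using counting_path.n_mono[OF path] by (auto dest: monoD)

lemma N_neg: "\<omega> \<in> space M \<Longrightarrow> t \<le> 0 \<Longrightarrow> N t \<omega> = 0"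
  using counting_path.n_neg[OF path] by auto

lemma G_space: "space (G t) = space M" and G_sets: "sets (G t) \<subseteq> sets M"
  using G_sub by (auto simp: subalgebra_def)

lemma G_measurableD: "f \<in> measurable (G s) L \<Longrightarrow> f \<in> measurable M L"
  using measurable_from_subalg[OF G_sub] .

lemma G_measurable_mono: "s \<le> t \<Longrightarrow> f \<in> measurable (G s) L \<Longrightarrow> f \<in> measurable (G t) L"
  by (rule measurable_from_subalg) (auto simp: subalgebra_def G_space G_mono)

lemma N_measurable [measurable]: "N t \<in> measurable M (count_space UNIV)"
  using N_adapted by (rule G_measurableD)

text \<open>Whether the \<open>k\<close>-th jump has occurred before \<open>a < t\<close> is known at time \<open>t\<close>; truncating at \<open>t\<close> discards
  what happens later.\<close>

lemma T_stopped_measurable: "(\<lambda>\<omega>. min (T k \<omega>) t) \<in> borel_measurable (G t)"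
proof (rule borel_measurableI_le)
  fix a
  show "{\<omega>\<in>space (G t). min (T k \<omega>) t \<le> a} \<in> sets (G t)"
  proof (cases "t \<le> a")
    case False
    then have [measurable]: "N a \<in> measurable (G t) (count_space UNIV)"
      by (intro G_measurable_mono[OF _ N_adapted]) auto
    have "{\<omega>\<in>space (G t). min (T k \<omega>) t \<le> a} = {\<omega>\<in>space (G t). Suc k \<le> N a \<omega>}"
      using False by (auto simp: G_space T_le_iff min_le_iff_disj)
    also have "\<dots> \<in> sets (G t)" by measurable
    finally show ?thesis .
  qed (auto simp: min_le_iff_disj)
qed

lemma T_measurable [measurable]: "T k \<in> borel_measurable M"
proof (rule borel_measurableI_le)
  fix a
  have "{\<omega>\<in>space M. T k \<omega> \<le> a} = {\<omega>\<in>space M. Suc k \<le> N a \<omega>}"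
    by (auto simp: T_le_iff)
  also have "\<dots> \<in> sets M" by measurable
  finally show "{\<omega>\<in>space M. T k \<omega> \<le> a} \<in> sets M" .
qed

lemma increment_nn_integral:
  assumes st: "0 \<le> s" "s < t" and A: "A \<in> sets (G s)"
  shows "(\<integral>\<^sup>+\<omega>. indicator A \<omega> * f (N t \<omega> - N s \<omega>) \<partial>M)
    = emeasure M A * (\<integral>\<^sup>+k. f k \<partial>measure_pmf (poisson_pmf (r * (t - s))))"
proof -
  have [measurable]: "A \<in> sets M" using A G_sets by auto
  let ?p = "poisson_pmf (r * (t - s))"
  define E where "E k = A \<inter> {\<omega>\<in>space M. N t \<omega> - N s \<omega> \<in> {k}}" for k
  have [measurable]: "E k \<in> sets M" for k unfolding E_def by measurable
  have E: "emeasure M (E k) = emeasure M A * ennreal (pmf ?p k)" for k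
    using increment_indep[OF st A, of "{k}"] unfolding E_def
    by (simp add: emeasure_eq_measure ennreal_mult' measure_pmf_single)
  have "(\<integral>\<^sup>+\<omega>. indicator A \<omega> * f (N t \<omega> - N s \<omega>) \<partial>M) = (\<integral>\<^sup>+\<omega>. (\<Sum>k. f k * indicator (E k) \<omega>) \<partial>M)"
  proof (rule nn_integral_cong)
    fix \<omega> assume \<omega>: "\<omega> \<in> space M"
    have "disjoint_family E" by (auto simp: disjoint_family_on_def E_def)
    show "indicator A \<omega> * f (N t \<omega> - N s \<omega>) = (\<Sum>k. f k * indicator (E k) \<omega>)"
    proof (cases "\<omega> \<in> A")
      case True
      then have "\<omega> \<in> E (N t \<omega> - N s \<omega>)" using \<omega> by (simp add: E_def)
      with suminf_cmult_indicator[OF \<open>disjoint_family E\<close> this, of f] True show ?thesis by simp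
    qed (simp add: E_def)
  qed
  also have "\<dots> = (\<Sum>k. f k * emeasure M (E k))"
    by (subst nn_integral_suminf) (auto simp: nn_integral_cmult)
  also have "\<dots> = emeasure M A * (\<Sum>k. ennreal (pmf ?p k) * f k)"
    unfolding E by (subst ennreal_suminf_cmult[symmetric]) (simp add: mult_ac)
  also have "(\<Sum>k. ennreal (pmf ?p k) * f k) = (\<integral>\<^sup>+k. f k \<partial>measure_pmf ?p)"
    by (simp add: nn_integral_measure_pmf nn_integral_count_space_nat)
  finally show ?thesis .
qed

lemma increment_mean:
  assumes "0 \<le> s" "s \<le> t" "A \<in> sets (G s)"
  shows "(\<integral>\<^sup>+\<omega>. indicator A \<omega> * ennreal (real (N t \<omega> - N s \<omega>)) \<partial>M) = ennreal (r * (t - s)) * emeasure M A"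
proof (cases "s = t")
  case False
  then have "0 < r * (t - s)" using assms r_pos by simp
  then show ?thesis
    using increment_nn_integral[of s t A "\<lambda>k. ennreal (real k)"] False assms
    by (simp add: nn_integral_poisson_mean mult.commute)
qed simp

text \<open>The predictable \<open>\<sigma>\<close>-field. Negative times are included so that the generating
  rectangles exhaust the space; no jump occurs there.\<close>

definition Pred :: "(real \<times> 'a) measure" where
  "Pred = sigma (UNIV \<times> space M) {{u<..v} \<times> A | u v A. A \<in> sets (G u)}"

lemma Pred_generator: "{{u<..v} \<times> A | (u::real) v A. A \<in> sets (G u)} \<subseteq> Pow (UNIV \<times> space M)"
proof
  fix X assume "X \<in> {{u<..v} \<times> A | (u::real) v A. A \<in> sets (G u)}"
  then obtain u v A where X: "X = {u<..v} \<times> A" "A \<in> sets (G u)" by blast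
  show "X \<in> Pow (UNIV \<times> space M)"
    unfolding X(1) using sets.sets_into_space[OF X(2)] by (auto simp: G_space)
qed

lemma space_Pred [simp]: "space Pred = UNIV \<times> space M"
  unfolding Pred_def using Pred_generator by (rule space_measure_of)

lemma sets_Pred: "sets Pred = sigma_sets (UNIV \<times> space M) {{u<..v} \<times> A | u v A. A \<in> sets (G u)}"
  unfolding Pred_def using Pred_generator by (rule sets_measure_of)

lemma rect_Pred: "A \<in> sets (G u) \<Longrightarrow> {u<..v} \<times> A \<in> sets Pred"
  unfolding sets_Pred by (rule sigma_sets.Basic) blast

text \<open>Stopping at \<open>t\<close> turns a predictable process into one that is jointly measurable with respect to the
  field at time \<open>t\<close>: a rectangle \<open>(u, v] \<times> A\<close> with \<open>u \<ge> t\<close> is never met.\<close>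

lemma stopped_Pred: "(\<lambda>(s, \<omega>). (min s t, \<omega>)) \<in> measurable (borel \<Otimes>\<^sub>M G t) Pred"
  unfolding Pred_def
proof (rule measurable_measure_of[OF Pred_generator])
  show "(\<lambda>(s, \<omega>). (min s t, \<omega>)) \<in> space (borel \<Otimes>\<^sub>M G t) \<rightarrow> UNIV \<times> space M"
    by (auto simp: space_pair_measure G_space)
  fix y assume "y \<in> {{u<..v} \<times> A | (u::real) v A. A \<in> sets (G u)}"
  then obtain u v A where y: "y = {u<..v} \<times> A" "A \<in> sets (G u)" by blast
  show "(\<lambda>(s, \<omega>). (min s t, \<omega>)) -` y \<inter> space (borel \<Otimes>\<^sub>M G t) \<in> sets (borel \<Otimes>\<^sub>M G t)"
  proof (cases "u < t")
    case True
    then have A: "A \<in> sets (G t)" using G_mono[of u t] y(2) by auto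
    have "(\<lambda>(s, \<omega>). (min s t, \<omega>)) -` y \<inter> space (borel \<Otimes>\<^sub>M G t) = {s. u < min s t \<and> min s t \<le> v} \<times> A"
      using sets.sets_into_space[OF A] by (auto simp: y space_pair_measure)
    also have "\<dots> \<in> sets (borel \<Otimes>\<^sub>M G t)" using A by (intro pair_measureI) measurable
    finally show ?thesis .
  next
    case False
    then have "(\<lambda>(s, \<omega>). (min s t, \<omega>)) -` y \<inter> space (borel \<Otimes>\<^sub>M G t) = {}" by (auto simp: y)
    then show ?thesis by simp
  qed
qed

lemma id_Pred: "(\<lambda>p. p) \<in> measurable (borel \<Otimes>\<^sub>M M) Pred"
  unfolding Pred_def
proof (rule measurable_measure_of[OF Pred_generator])
  show "(\<lambda>p. p) \<in> space (borel \<Otimes>\<^sub>M M) \<rightarrow> UNIV \<times> space M"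
    by (auto simp: space_pair_measure)
  fix y assume "y \<in> {{u<..v} \<times> A | (u::real) v A. A \<in> sets (G u)}"
  then obtain u v A where y: "y = {u<..v} \<times> A" "A \<in> sets (G u)" by blast
  have "A \<in> sets M" using y G_sets by auto
  then have "y \<in> sets (borel \<Otimes>\<^sub>M M)" unfolding y by (intro pair_measureI) auto
  then show "(\<lambda>p. p) -` y \<inter> space (borel \<Otimes>\<^sub>M M) \<in> sets (borel \<Otimes>\<^sub>M M)" by simp
qed

lemma Pred_imp_jointly: "f \<in> measurable Pred L \<Longrightarrow> f \<in> measurable (borel \<Otimes>\<^sub>M M) L"
  by (rule measurable_compose[OF id_Pred])

lemma jump_Pred: "(\<lambda>(k, \<omega>). (T k \<omega>, \<omega>)) \<in> measurable (count_space UNIV \<Otimes>\<^sub>M M) Pred"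
proof -
  have "(\<lambda>(k, \<omega>). (T k \<omega>, \<omega>)) \<in> measurable (count_space UNIV \<Otimes>\<^sub>M M) (borel \<Otimes>\<^sub>M M)"
    by measurable
  from measurable_compose[OF this id_Pred] show ?thesis by simp
qed

lemma fst_Pred: "fst \<in> borel_measurable Pred"
proof (rule borel_measurableI_greater)
  fix a
  have top: "space M \<in> sets (G u)" for u using sets.top[of "G u"] by (simp add: G_space)
  have "{p \<in> space Pred. a < fst p} = (\<Union>i::nat. {a<..real i} \<times> space M)"
  proof (intro equalityI subsetI)
    fix p assume p: "p \<in> {p \<in> space Pred. a < fst p}"
    obtain i :: nat where "fst p \<le> i" using real_arch_simple by blast
    then have "p \<in> {a<..real i} \<times> space M" using p by (auto simp: mem_Times_iff)
    then show "p \<in> (\<Union>i::nat. {a<..real i} \<times> space M)" by blast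
  qed auto
  also have "\<dots> \<in> sets Pred" by (intro sets.countable_UN) (auto intro: rect_Pred top)
  finally show "{p \<in> space Pred. a < fst p} \<in> sets Pred" .
qed

text \<open>Lebesgue measure with factor \<open>r\<close> on the positive half line.\<close>

definition intensity :: "real measure" where
  "intensity = density lborel (\<lambda>s. ennreal (r * indicator {0<..} s))"

lemma sets_intensity [simp, measurable_cong]: "sets intensity = sets borel"
  by (simp add: intensity_def)

lemma space_intensity [simp]: "space intensity = UNIV"
  by (simp add: intensity_def)

lemma emeasure_intensity_Ioc: "emeasure intensity {u<..v} = ennreal (r * (max 0 v - max 0 u))"
proof -
  have "emeasure intensity {u<..v} = (\<integral>\<^sup>+s. ennreal r * indicator {max 0 u<..v} s \<partial>lborel)"
    using r_pos unfolding intensity_def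
    by (subst emeasure_density) (auto intro!: nn_integral_cong simp: indicator_def)
  also have "\<dots> = ennreal r * emeasure lborel {max 0 u<..v}"
    by (subst nn_integral_cmult_indicator) auto
  also have "emeasure lborel {max 0 u<..v} = ennreal (max 0 v - max 0 u)"
    by (cases "max 0 u \<le> v") (auto simp: max_def ennreal_neg split: if_splits)
  finally show ?thesis using r_pos by (simp add: ennreal_mult')
qed

sublocale intensity: sigma_finite_measure intensity
  unfolding intensity_def by (subst sigma_finite_measure.sigma_finite_iff_density_finite[OF sigma_finite_lborel]) auto

sublocale intensity_M: pair_sigma_finite intensity M ..

sublocale count_M: pair_sigma_finite "count_space (UNIV :: nat set)" M
  by (intro pair_sigma_finite.intro sigma_finite_measure_count_space sigma_finite_measure_axioms)

text \<open>The left side integrates \<open>H(s, \<omega>)\<close> to \<open>E \<Sum>\<^sub>k H(T\<^sub>k, \<omega>)\<close>, the right side to \<open>r E \<integral> H ds\<close>. On a rectangle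
  \<open>(u, v] \<times> A\<close> the former is the expected number of jumps in \<open>(u, v]\<close> on the event \<open>A\<close>, which by independence
  is \<open>r (v - u) P(A)\<close>; rectangles are stable under intersection.\<close>

theorem jump_measure_eq_intensity:
  "distr (count_space UNIV \<Otimes>\<^sub>M M) Pred (\<lambda>(k, \<omega>). (T k \<omega>, \<omega>)) = distr (intensity \<Otimes>\<^sub>M M) Pred (\<lambda>p. p)"
    (is "?\<nu> = ?\<rho>")
proof (rule measure_eqI_generator_eq)
  let ?E = "{{u<..v} \<times> A | (u::real) v A. A \<in> sets (G u)}"
  show "?E \<subseteq> Pow (UNIV \<times> space M)" by (rule Pred_generator)
  show "sets ?\<nu> = sigma_sets (UNIV \<times> space M) ?E" "sets ?\<rho> = sigma_sets (UNIV \<times> space M) ?E"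
    by (simp_all add: sets_Pred)
  show "Int_stable ?E"
  proof (rule Int_stableI)
    fix X Y assume "X \<in> ?E" "Y \<in> ?E"
    then obtain u v A u' v' A' where X: "X = {u<..v} \<times> A" "A \<in> sets (G u)"
      and Y: "Y = {u'<..v'} \<times> A'" "A' \<in> sets (G u')"
      by blast
    have "X \<inter> Y = {max u u'<..min v v'} \<times> (A \<inter> A')" unfolding X Y by auto
    moreover have "A \<inter> A' \<in> sets (G (max u u'))"
      using X Y G_mono[of u "max u u'"] G_mono[of u' "max u u'"] by auto
    ultimately show "X \<inter> Y \<in> ?E" by blast
  qed
  have id: "(\<lambda>p. p) \<in> measurable (intensity \<Otimes>\<^sub>M M) Pred"
    using id_Pred by (simp cong: measurable_cong_sets)
  have \<rho>: "emeasure ?\<rho> ({u<..v} \<times> A) = ennreal (r * (max 0 v - max 0 u)) * emeasure M A"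
    if "A \<in> sets (G u)" for u v A
  proof -
    have "A \<in> sets M" using that G_sets by auto
    then have "emeasure (intensity \<Otimes>\<^sub>M M) ({u<..v} \<times> A) = ennreal (r * (max 0 v - max 0 u)) * emeasure M A"
      by (subst emeasure_pair_measure_Times) (auto simp: emeasure_intensity_Ioc)
    then show ?thesis
      using that sets.sets_into_space[OF \<open>A \<in> sets M\<close>]
      by (subst emeasure_distr[OF id]) (auto simp: rect_Pred space_pair_measure Times_Int_Times Int_absorb2)
  qed
  have \<nu>: "emeasure ?\<nu> ({u<..v} \<times> A) = ennreal (r * (max 0 v - max 0 u)) * emeasure M A"
    if A: "A \<in> sets (G u)" and "u \<le> v" for u v A
  proof -
    have A_M [measurable]: "A \<in> sets M" using A G_sets by auto
    have A0: "A \<in> sets (G (max 0 u))" using A G_mono[of u "max 0 u"] by auto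
    let ?S = "(\<lambda>(k, \<omega>). (T k \<omega>, \<omega>)) -` ({u<..v} \<times> A) \<inter> space (count_space UNIV \<Otimes>\<^sub>M M)"
    have "emeasure ?\<nu> ({u<..v} \<times> A) = emeasure (count_space UNIV \<Otimes>\<^sub>M M) ?S"
      by (rule emeasure_distr[OF jump_Pred rect_Pred[OF A]])
    also have "\<dots> = (\<integral>\<^sup>+\<omega>. emeasure (count_space UNIV) ((\<lambda>k. (k, \<omega>)) -` ?S) \<partial>M)"
      by (rule count_M.emeasure_pair_measure_alt2[OF measurable_sets[OF jump_Pred rect_Pred[OF A]]])
    also have "\<dots> = (\<integral>\<^sup>+\<omega>. indicator A \<omega> * ennreal (real (N (max 0 v) \<omega> - N (max 0 u) \<omega>)) \<partial>M)"
    proof (rule nn_integral_cong)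
      fix \<omega> assume \<omega>: "\<omega> \<in> space M"
      have N_max: "N (max 0 t) \<omega> = N t \<omega>" for t
        using N_neg[OF \<omega>, of t] N_neg[OF \<omega>, of 0] by (auto simp: max_def)
      have "(\<lambda>k. (k, \<omega>)) -` ?S = (if \<omega> \<in> A then {N u \<omega>..<N v \<omega>} else {})"
        unfolding jumps_between[OF \<omega>, symmetric] using \<omega> by (auto simp: space_pair_measure)
      then show "emeasure (count_space UNIV) ((\<lambda>k. (k, \<omega>)) -` ?S)
          = indicator A \<omega> * ennreal (real (N (max 0 v) \<omega> - N (max 0 u) \<omega>))"
        by (simp add: N_max ennreal_of_nat_eq_real_of_nat)
    qed
    also have "\<dots> = ennreal (r * (max 0 v - max 0 u)) * emeasure M A"
      using \<open>u \<le> v\<close> by (intro increment_mean A0) auto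
    finally show ?thesis .
  qed
  show "emeasure ?\<nu> X = emeasure ?\<rho> X" if "X \<in> ?E" for X
  proof -
    obtain u v A where X: "X = {u<..v} \<times> A" "A \<in> sets (G u)" using \<open>X \<in> ?E\<close> by blast
    show ?thesis
    proof (cases "u \<le> v")
      case True
      then show ?thesis using \<nu> \<rho> X by simp
    qed (simp add: X)
  qed
  have top: "space M \<in> sets (G u)" for u using sets.top[of "G u"] by (simp add: G_space)
  show "range (\<lambda>i::nat. {- real i<..real i} \<times> space M) \<subseteq> ?E" using top by blast
  show "(\<Union>i::nat. {- real i<..real i} \<times> space M) = UNIV \<times> space M"
  proof (intro equalityI subsetI)
    fix p assume p: "p \<in> (UNIV :: real set) \<times> space M"
    obtain i :: nat where "\<bar>fst p\<bar> < i" using reals_Archimedean2 by blast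
    then have "p \<in> {- real i<..real i} \<times> space M" using p by (auto simp: mem_Times_iff)
    then show "p \<in> (\<Union>i::nat. {- real i<..real i} \<times> space M)" by blast
  qed auto
  show "emeasure ?\<nu> ({- real i<..real i} \<times> space M) \<noteq> \<infinity>" for i
    by (subst \<nu>[OF top]) (auto simp: emeasure_space_1 ennreal_mult_eq_top_iff)
qed

lemma nn_integral_jumps:
  assumes "(\<lambda>(s, \<omega>). H s \<omega>) \<in> borel_measurable Pred"
  shows "(\<integral>\<^sup>+\<omega>. (\<Sum>k. H (T k \<omega>) \<omega>) \<partial>M) = (\<integral>\<^sup>+\<omega>. (\<integral>\<^sup>+s. H s \<omega> \<partial>intensity) \<partial>M)"
proof -
  have id: "(\<lambda>p. p) \<in> measurable (intensity \<Otimes>\<^sub>M M) Pred"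
    using id_Pred by (simp cong: measurable_cong_sets)
  have H: "(\<lambda>(k, \<omega>). H (T k \<omega>) \<omega>) \<in> borel_measurable (count_space UNIV \<Otimes>\<^sub>M M)"
    using measurable_compose[OF jump_Pred assms] by (simp add: case_prod_beta)
  have "(\<integral>\<^sup>+p. (\<lambda>(s, \<omega>). H s \<omega>) p \<partial>distr (count_space UNIV \<Otimes>\<^sub>M M) Pred (\<lambda>(k, \<omega>). (T k \<omega>, \<omega>)))
      = (\<integral>\<^sup>+(k, \<omega>). H (T k \<omega>) \<omega> \<partial>(count_space UNIV \<Otimes>\<^sub>M M))"
    using assms by (subst nn_integral_distr[OF jump_Pred]) (simp_all add: case_prod_beta')
  also have "\<dots> = (\<integral>\<^sup>+\<omega>. (\<Sum>k. H (T k \<omega>) \<omega>) \<partial>M)"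
    using count_M.nn_integral_snd[OF H] by (simp add: nn_integral_count_space_nat)
  finally show ?thesis
    unfolding jump_measure_eq_intensity
    using intensity_M.nn_integral_snd[of "\<lambda>(s, \<omega>). H s \<omega>"] measurable_compose[OF id assms] assms
    by (simp add: nn_integral_distr[OF id] case_prod_beta')
qed

text \<open>A deterministic process is predictable, so the expected number of jumps in \<open>Z\<close> is \<open>r\<close> times its Lebesgue
  measure.\<close>

lemma jumps_avoid_null_set:
  assumes Z: "Z \<in> null_sets lborel"
  shows "AE \<omega> in M. \<forall>k. T k \<omega> \<notin> Z"
proof -
  have "AE \<omega> in M. T k \<omega> \<notin> Z" for k
  proof -
    have [measurable]: "Z \<in> sets borel" using Z by auto
    have "(\<integral>\<^sup>+\<omega>. (\<Sum>k. indicator Z (T k \<omega>)) \<partial>M) = (\<integral>\<^sup>+\<omega>. (\<integral>\<^sup>+s. indicator Z s \<partial>intensity) \<partial>M)"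
      using fst_Pred by (intro nn_integral_jumps) (simp add: case_prod_beta)
    also have "(\<integral>\<^sup>+s. indicator Z s \<partial>intensity) = emeasure intensity Z" by simp
    also have "emeasure intensity Z = 0"
    proof -
      have "(\<lambda>s::real. ennreal (r * indicator {0<..} s)) \<in> borel_measurable lborel" by measurable
      from absolutely_continuousI_density[OF this] Z show ?thesis
        unfolding intensity_def absolutely_continuous_def by auto
    qed
    finally have "(\<integral>\<^sup>+\<omega>. (\<Sum>k. indicator Z (T k \<omega>)) \<partial>M) = 0" by simp
    then have "AE \<omega> in M. (\<Sum>k. indicator Z (T k \<omega>) :: ennreal) = 0"
      by (subst (asm) nn_integral_0_iff_AE) auto
    then show ?thesis
    proof eventually_elim
      case (elim \<omega>)
      then have "indicator Z (T k \<omega>) = (0 :: ennreal)" by (simp add: suminf_eq_zero_iff)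
      then show ?case by (simp split: split_indicator_asm)
    qed
  qed
  then show ?thesis by (simp add: AE_all_countable)
qed

text \<open>The identity of the two measures for integrands of either sign. A bound \<open>c(\<omega>)\<close> with finite
  expectation suffices, however large the number of jumps, because integrability may be checked
  on the time integral.\<close>

lemma compensation_formula:
  assumes st: "0 \<le> s" "s \<le> t"
    and meas: "(\<lambda>(u, \<omega>). indicator {s<..t} u * g u \<omega>) \<in> borel_measurable Pred"
    and bound: "\<And>u \<omega>. \<omega> \<in> space M \<Longrightarrow> s < u \<Longrightarrow> u \<le> t \<Longrightarrow> \<bar>g u \<omega>\<bar> \<le> c \<omega>"
    and c: "integrable M c"
  shows "integrable M (\<lambda>\<omega>. \<Sum>k\<in>{N s \<omega>..<N t \<omega>}. g (T k \<omega>) \<omega>)"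
    and "integrable M (\<lambda>\<omega>. LINT u:{s<..t}|lborel. g u \<omega>)"
    and "(\<integral>\<omega>. (\<Sum>k\<in>{N s \<omega>..<N t \<omega>}. g (T k \<omega>) \<omega>) \<partial>M) = r * (\<integral>\<omega>. (LINT u:{s<..t}|lborel. g u \<omega>) \<partial>M)"
proof -
  define H where "H u \<omega> = indicator {s<..t} u * g u \<omega>" for u \<omega>
  have H_Pred: "(\<lambda>(u, \<omega>). H u \<omega>) \<in> borel_measurable Pred" using meas by (simp add: H_def)
  have id: "(\<lambda>p. p) \<in> measurable (intensity \<Otimes>\<^sub>M M) Pred"
    using id_Pred by (simp cong: measurable_cong_sets)
  have H_meas [measurable]: "(\<lambda>(u, \<omega>). H u \<omega>) \<in> borel_measurable (intensity \<Otimes>\<^sub>M M)"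
    using measurable_compose[OF id H_Pred] .
  have H_bound: "\<bar>H u \<omega>\<bar> \<le> indicator {s<..t} u * \<bar>c \<omega>\<bar>" if "\<omega> \<in> space M" for u \<omega>
    using bound[OF that, of u] by (auto simp: H_def indicator_def)
  have [measurable]: "c \<in> borel_measurable M" using c by auto
  have ind: "integrable intensity (\<lambda>u. indicator {s<..t} u * a)" for a :: real
    by (intro integrable_mult_left integrable_real_indicator) (auto simp: emeasure_intensity_Ioc)
  have "integrable (intensity \<Otimes>\<^sub>M M) (\<lambda>(u, \<omega>). indicator {s<..t} u * \<bar>c \<omega>\<bar>)"
  proof (rule intensity_M.Fubini_integrable)
    show "integrable intensity (\<lambda>u. \<integral>\<omega>. norm (case (u, \<omega>) of (u, \<omega>) \<Rightarrow> indicator {s<..t} u * \<bar>c \<omega>\<bar>) \<partial>M)"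
      using ind[of "\<integral>\<omega>. \<bar>c \<omega>\<bar> \<partial>M"] by (simp add: abs_mult)
  qed (use c in auto)
  then have H_int: "integrable (intensity \<Otimes>\<^sub>M M) (\<lambda>(u, \<omega>). H u \<omega>)"
    by (rule Bochner_Integration.integrable_bound) (auto simp: space_pair_measure H_bound intro!: AE_I2)
  then have "integrable (distr (intensity \<Otimes>\<^sub>M M) Pred (\<lambda>p. p)) (\<lambda>(u, \<omega>). H u \<omega>)"
    by (subst integrable_distr_eq[OF id H_Pred]) simp
  then have J_int: "integrable (count_space UNIV \<Otimes>\<^sub>M M) (\<lambda>(k, \<omega>). H (T k \<omega>) \<omega>)"
    unfolding jump_measure_eq_intensity[symmetric]
    by (subst (asm) integrable_distr_eq[OF jump_Pred H_Pred]) (simp add: case_prod_beta')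
  have "(\<integral>p. (\<lambda>(k, \<omega>). H (T k \<omega>) \<omega>) p \<partial>(count_space UNIV \<Otimes>\<^sub>M M))
      = (\<integral>p. (\<lambda>(u, \<omega>). H u \<omega>) p \<partial>distr (count_space UNIV \<Otimes>\<^sub>M M) Pred (\<lambda>(k, \<omega>). (T k \<omega>, \<omega>)))"
    by (subst integral_distr[OF jump_Pred H_Pred]) (simp add: case_prod_beta')
  also have "\<dots> = (\<integral>p. (\<lambda>(u, \<omega>). H u \<omega>) p \<partial>(intensity \<Otimes>\<^sub>M M))"
    unfolding jump_measure_eq_intensity by (subst integral_distr[OF id H_Pred]) simp
  finally have eq: "(\<integral>\<omega>. (\<integral>k. H (T k \<omega>) \<omega> \<partial>count_space UNIV) \<partial>M) = (\<integral>\<omega>. (\<integral>u. H u \<omega> \<partial>intensity) \<partial>M)"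
    using count_M.integral_snd[OF J_int] intensity_M.integral_snd[OF H_int] by simp
  have sum: "(\<integral>k. H (T k \<omega>) \<omega> \<partial>count_space UNIV) = (\<Sum>k\<in>{N s \<omega>..<N t \<omega>}. g (T k \<omega>) \<omega>)"
    if \<omega>: "\<omega> \<in> space M" for \<omega>
  proof -
    have iff: "H (T k \<omega>) \<omega> = (if k \<in> {N s \<omega>..<N t \<omega>} then g (T k \<omega>) \<omega> else 0)" for k
      unfolding H_def jumps_between[OF \<omega>, of s t, symmetric] by (auto simp: indicator_def)
    show ?thesis
      unfolding iff by (subst lebesgue_integral_count_space_finite_support)
        (auto intro: finite_subset[of _ "{N s \<omega>..<N t \<omega>}"] intro!: sum.mono_neutral_cong_left split: if_splits)
  qed
  have int: "(\<integral>u. H u \<omega> \<partial>intensity) = r * (LINT u:{s<..t}|lborel. g u \<omega>)" if \<omega>: "\<omega> \<in> space M" for \<omega>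
  proof -
    have [measurable]: "(\<lambda>u. H u \<omega>) \<in> borel_measurable lborel"
      using measurable_Pair1[OF H_meas \<omega>] by (simp cong: measurable_cong_sets)
    have "(\<integral>u. H u \<omega> \<partial>intensity) = (\<integral>u. r * indicator {0<..} u * H u \<omega> \<partial>lborel)"
      unfolding intensity_def using r_pos by (subst integral_real_density) auto
    also have "\<dots> = (\<integral>u. r * (indicator {s<..t} u *\<^sub>R g u \<omega>) \<partial>lborel)"
      using st(1) by (intro Bochner_Integration.integral_cong) (auto simp: H_def indicator_def)
    finally show ?thesis by (simp add: set_lebesgue_integral_def)
  qed
  show "integrable M (\<lambda>\<omega>. \<Sum>k\<in>{N s \<omega>..<N t \<omega>}. g (T k \<omega>) \<omega>)"
    using count_M.integrable_snd[OF J_int]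
    by (subst Bochner_Integration.integrable_cong[OF refl sum[symmetric]])
  have "integrable M (\<lambda>\<omega>. r * (LINT u:{s<..t}|lborel. g u \<omega>))"
    using intensity_M.integrable_snd[OF H_int]
    by (subst Bochner_Integration.integrable_cong[OF refl int[symmetric]])
  then show "integrable M (\<lambda>\<omega>. LINT u:{s<..t}|lborel. g u \<omega>)" using r_pos by simp
  have "(\<integral>\<omega>. (\<Sum>k\<in>{N s \<omega>..<N t \<omega>}. g (T k \<omega>) \<omega>) \<partial>M) = (\<integral>\<omega>. (\<integral>k. H (T k \<omega>) \<omega> \<partial>count_space UNIV) \<partial>M)"
    by (intro Bochner_Integration.integral_cong) (auto simp: sum)
  also have "\<dots> = (\<integral>\<omega>. r * (LINT u:{s<..t}|lborel. g u \<omega>) \<partial>M)"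
    unfolding eq by (intro Bochner_Integration.integral_cong) (auto simp: int)
  finally show "(\<integral>\<omega>. (\<Sum>k\<in>{N s \<omega>..<N t \<omega>}. g (T k \<omega>) \<omega>) \<partial>M) = r * (\<integral>\<omega>. (LINT u:{s<..t}|lborel. g u \<omega>) \<partial>M)"
    by simp
qed

end

section \<open>The compensated jump martingale\<close>

context poisson_counting
begin

lemma increment_moments:
  assumes "0 \<le> s" "s \<le> t"
  shows "integrable M (\<lambda>\<omega>. real (N t \<omega> - N s \<omega>))"
    and "(\<integral>\<omega>. real (N t \<omega> - N s \<omega>) \<partial>M) = r * (t - s)"
    and "integrable M (\<lambda>\<omega>. (real (N t \<omega> - N s \<omega>))\<^sup>2)"
    and "(\<integral>\<omega>. (real (N t \<omega> - N s \<omega>))\<^sup>2 \<partial>M) = r * (t - s) + (r * (t - s))\<^sup>2"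
proof -
  have nn: "0 \<le> r * (t - s)" using assms r_pos by simp
  have top: "space M \<in> sets (G s)" using sets.top[of "G s"] by (simp add: G_space)
  have 1: "(\<integral>\<^sup>+\<omega>. ennreal (real (N t \<omega> - N s \<omega>)) \<partial>M) = ennreal (r * (t - s))"
  proof -
    have "(\<integral>\<^sup>+\<omega>. ennreal (real (N t \<omega> - N s \<omega>)) \<partial>M)
        = (\<integral>\<^sup>+\<omega>. indicator (space M) \<omega> * ennreal (real (N t \<omega> - N s \<omega>)) \<partial>M)"
      by (intro nn_integral_cong) simp
    then show ?thesis using increment_mean[OF assms top] by (simp add: emeasure_space_1)
  qed
  have 2: "(\<integral>\<^sup>+\<omega>. ennreal ((real (N t \<omega> - N s \<omega>))\<^sup>2) \<partial>M) = ennreal (r * (t - s) + (r * (t - s))\<^sup>2)"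
  proof (cases "s = t")
    case False
    then have pos: "0 < r * (t - s)" "s < t" using assms r_pos by auto
    have "(\<integral>\<^sup>+\<omega>. ennreal ((real (N t \<omega> - N s \<omega>))\<^sup>2) \<partial>M)
        = (\<integral>\<^sup>+\<omega>. indicator (space M) \<omega> * ennreal ((real (N t \<omega> - N s \<omega>))\<^sup>2) \<partial>M)"
      by (intro nn_integral_cong) simp
    then show ?thesis
      using increment_nn_integral[OF assms(1) pos(2) top, of "\<lambda>k. ennreal ((real k)\<^sup>2)"]
        nn_integral_poisson_square[OF pos(1)] by (simp add: emeasure_space_1)
  qed simp
  show int: "integrable M (\<lambda>\<omega>. real (N t \<omega> - N s \<omega>))"
    by (rule integrableI_nn_integral_finite[OF _ _ 1]) auto
  show "(\<integral>\<omega>. real (N t \<omega> - N s \<omega>) \<partial>M) = r * (t - s)"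
    by (subst integral_eq_nn_integral) (use 1 nn in auto)
  show "integrable M (\<lambda>\<omega>. (real (N t \<omega> - N s \<omega>))\<^sup>2)"
    by (rule integrableI_nn_integral_finite[OF _ _ 2]) auto
  show "(\<integral>\<omega>. (real (N t \<omega> - N s \<omega>))\<^sup>2 \<partial>M) = r * (t - s) + (r * (t - s))\<^sup>2"
    by (subst integral_eq_nn_integral) (use 2 nn in \<open>auto simp del: ennreal_plus\<close>)
qed

text \<open>An integrand that is known at time \<open>s\<close> and used on \<open>(s, t]\<close> only is predictable.\<close>

lemma rect_indicator_Pred:
  fixes \<xi> :: "'a \<Rightarrow> 'v::euclidean_space"
  assumes \<xi>: "\<xi> \<in> borel_measurable (G s)"
  shows "(\<lambda>(u, \<omega>). indicator {s<..t} u *\<^sub>R \<xi> \<omega>) \<in> borel_measurable Pred"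
proof (rule borel_measurableI)
  fix S :: "'v set" assume "open S"
  then have A: "\<xi> -` S \<inter> space M \<in> sets (G s)"
    using measurable_sets[OF \<xi>, of S] by (simp add: G_space)
  have top: "space M \<in> sets (G s)" using sets.top[of "G s"] by (simp add: G_space)
  have "(\<lambda>(u, \<omega>). indicator {s<..t} u *\<^sub>R \<xi> \<omega>) -` S \<inter> space Pred
    = {s<..t} \<times> (\<xi> -` S \<inter> space M) \<union> (if 0 \<in> S then space Pred - {s<..t} \<times> space M else {})"
    by (auto split: split_indicator split_indicator_asm)
  also have "\<dots> \<in> sets Pred"
    using rect_Pred[OF A] rect_Pred[OF top] by (auto simp del: space_Pred)
  finally show "(\<lambda>(u, \<omega>). indicator {s<..t} u *\<^sub>R \<xi> \<omega>) -` S \<inter> space Pred \<in> sets Pred" .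
qed

end

locale predictable_integrand = poisson_counting M r G N
  for M :: "'a measure" and r G N +
  fixes h :: "real \<Rightarrow> 'a \<Rightarrow> 'v::euclidean_space" and B :: real
  assumes h_Pred: "(\<lambda>(u, \<omega>). h u \<omega>) \<in> borel_measurable Pred"
    and h_bound: "\<omega> \<in> space M \<Longrightarrow> norm (h u \<omega>) \<le> B"
begin

definition Mart :: "real \<Rightarrow> 'a \<Rightarrow> 'v" where
  "Mart t \<omega> = (1 / r) *\<^sub>R (\<Sum>k<N t \<omega>. h (T k \<omega>) \<omega>) - (LINT u:{0<..t}|lborel. h u \<omega>)"

lemma B_nonneg: "0 \<le> B"
proof -
  obtain \<omega> where "\<omega> \<in> space M" using not_empty by blast
  from h_bound[OF this, of 0] show ?thesis by (rule order_trans[OF norm_ge_zero])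
qed

lemma h_jointly: "(\<lambda>(u, \<omega>). h u \<omega>) \<in> borel_measurable (borel \<Otimes>\<^sub>M M)"
  using h_Pred by (rule Pred_imp_jointly)

lemma h_set_integrable:
  assumes \<omega>: "\<omega> \<in> space M"
  shows "set_integrable lborel {s<..t} (\<lambda>u. h u \<omega>)"
  unfolding set_integrable_def
proof (rule integrableI_bounded_set_indicator)
  show "(\<lambda>u. h u \<omega>) \<in> borel_measurable lborel"
    using measurable_Pair1[OF h_jointly \<omega>] by simp
  show "emeasure lborel {s<..t} < \<infinity>" by (cases "s \<le> t") auto
  show "AE u in lborel. u \<in> {s<..t} \<longrightarrow> norm (h u \<omega>) \<le> B" using h_bound[OF \<omega>] by simp
qed simp

lemma Mart_diff:
  assumes st: "0 \<le> s" "s \<le> t" and \<omega>: "\<omega> \<in> space M"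
  shows "Mart t \<omega> - Mart s \<omega>
    = (1 / r) *\<^sub>R (\<Sum>k\<in>{N s \<omega>..<N t \<omega>}. h (T k \<omega>) \<omega>) - (LINT u:{s<..t}|lborel. h u \<omega>)"
proof -
  have "(\<Sum>k<N t \<omega>. h (T k \<omega>) \<omega>) = (\<Sum>k<N s \<omega>. h (T k \<omega>) \<omega>) + (\<Sum>k\<in>{N s \<omega>..<N t \<omega>}. h (T k \<omega>) \<omega>)"
    using N_mono[OF \<omega> st(2)] sum.atLeastLessThan_concat[of 0 "N s \<omega>" "N t \<omega>" "\<lambda>k. h (T k \<omega>) \<omega>"]
    by (simp add: atLeast0LessThan)
  moreover have "{0<..t} = {0<..s} \<union> {s<..t}" using st by auto
  then have "(LINT u:{0<..t}|lborel. h u \<omega>) = (LINT u:{0<..s}|lborel. h u \<omega>) + (LINT u:{s<..t}|lborel. h u \<omega>)"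
    using h_set_integrable[OF \<omega>] by (simp add: set_integral_Un Int_def)
  ultimately show ?thesis by (simp add: Mart_def scaleR_add_right)
qed

lemma Mart_0: "\<omega> \<in> space M \<Longrightarrow> Mart 0 \<omega> = 0"
  by (simp add: Mart_def N_neg set_lebesgue_integral_def)

lemma Mart_increment_bound:
  assumes st: "0 \<le> s" "s \<le> t" and \<omega>: "\<omega> \<in> space M"
  shows "norm (Mart t \<omega> - Mart s \<omega>) \<le> B * (real (N t \<omega> - N s \<omega>) / r + (t - s))"
proof -
  have "norm (\<Sum>k\<in>{N s \<omega>..<N t \<omega>}. h (T k \<omega>) \<omega>) \<le> real (N t \<omega> - N s \<omega>) * B"
    using sum_norm_bound[of "{N s \<omega>..<N t \<omega>}" "\<lambda>k. h (T k \<omega>) \<omega>" B] h_bound[OF \<omega>] by simp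
  then have "norm ((1 / r) *\<^sub>R (\<Sum>k\<in>{N s \<omega>..<N t \<omega>}. h (T k \<omega>) \<omega>)) \<le> B * (real (N t \<omega> - N s \<omega>) / r)"
    using r_pos by (simp add: divide_simps mult.commute)
  moreover have "norm (LINT u:{s<..t}|lborel. h u \<omega>) \<le> (LINT u:{s<..t}|lborel. B)"
  proof -
    have "norm (LINT u:{s<..t}|lborel. h u \<omega>) \<le> (LINT u:{s<..t}|lborel. norm (h u \<omega>))"
      by (rule set_integral_norm_bound[OF h_set_integrable[OF \<omega>]])
    also have "\<dots> \<le> (LINT u:{s<..t}|lborel. B)"
    proof (rule set_integral_mono[OF set_integrable_norm[OF h_set_integrable[OF \<omega>]]])
      show "set_integrable lborel {s<..t} (\<lambda>_. B)" using st by (auto simp: set_integrable_def)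
    qed (use h_bound[OF \<omega>] in auto)
    finally show ?thesis .
  qed
  moreover have "(LINT u:{s<..t}|lborel. B) = B * (t - s)"
    using st by (simp add: set_lebesgue_integral_def)
  ultimately show ?thesis
    unfolding Mart_diff[OF st \<omega>]
    by (intro order_trans[OF norm_triangle_ineq4]) (simp add: distrib_left)
qed

text \<open>Both the jump sum and the time integral up to \<open>t\<close> involve only the integrand stopped at \<open>t\<close>.\<close>

lemma Mart_adapted: "Mart t \<in> borel_measurable (G t)"
proof -
  have N_G [measurable]: "N t \<in> measurable (G t) (count_space UNIV)" by (rule N_adapted)
  have stop [measurable]: "(\<lambda>(u, \<omega>). h (min u t) \<omega>) \<in> borel_measurable (borel \<Otimes>\<^sub>M G t)"
    using measurable_compose[OF stopped_Pred h_Pred] by (simp add: case_prod_beta')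
  have "(\<lambda>\<omega>. h (min (min (T k \<omega>) t) t) \<omega>) \<in> borel_measurable (G t)" for k
    using measurable_compose[OF measurable_Pair[OF T_stopped_measurable[of k t] measurable_ident] stop]
    by simp
  then have [measurable]: "(\<lambda>\<omega>. h (min (T k \<omega>) t) \<omega>) \<in> borel_measurable (G t)" for k
    by simp
  have 1: "(\<lambda>\<omega>. \<Sum>k<N t \<omega>. h (min (T k \<omega>) t) \<omega>) \<in> borel_measurable (G t)"
    by (rule measurable_compose_countable[where f = "\<lambda>m \<omega>. \<Sum>k<m. h (min (T k \<omega>) t) \<omega>"]) measurable
  have swap: "(\<lambda>(\<omega>, u). h (min u t) \<omega>) \<in> borel_measurable (G t \<Otimes>\<^sub>M lborel)"
    using measurable_compose[OF measurable_pair_swap' stop] by (simp add: case_prod_beta' cong: measurable_cong_sets)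
  then have [measurable]: "(\<lambda>p. h (min (snd p) t) (fst p)) \<in> borel_measurable (G t \<Otimes>\<^sub>M lborel)"
    by (simp add: case_prod_beta')
  have "(\<lambda>(\<omega>, u). indicator {0<..t} u *\<^sub>R h (min u t) \<omega>) \<in> borel_measurable (G t \<Otimes>\<^sub>M lborel)"
    unfolding case_prod_beta' by measurable
  then have 2: "(\<lambda>\<omega>. LINT u|lborel. indicator {0<..t} u *\<^sub>R h (min u t) \<omega>) \<in> borel_measurable (G t)"
    by (rule lborel.borel_measurable_lebesgue_integral)
  have "(\<lambda>\<omega>. (1 / r) *\<^sub>R (\<Sum>k<N t \<omega>. h (min (T k \<omega>) t) \<omega>)
      - (LINT u|lborel. indicator {0<..t} u *\<^sub>R h (min u t) \<omega>)) \<in> borel_measurable (G t)"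
    by (intro borel_measurable_diff borel_measurable_scaleR borel_measurable_const 1 2)
  moreover have "Mart t \<omega> = (1 / r) *\<^sub>R (\<Sum>k<N t \<omega>. h (min (T k \<omega>) t) \<omega>)
      - (LINT u|lborel. indicator {0<..t} u *\<^sub>R h (min u t) \<omega>)" if \<omega>: "\<omega> \<in> space (G t)" for \<omega>
  proof -
    have "T k \<omega> \<le> t" if "k < N t \<omega>" for k using that \<omega> by (simp add: G_space T_le_iff)
    moreover have "(\<lambda>u. indicator {0<..t} u *\<^sub>R h (min u t) \<omega>) = (\<lambda>u. indicator {0<..t} u *\<^sub>R h u \<omega>)"
      by (auto simp: indicator_def fun_eq_iff min_def)
    ultimately show ?thesis by (simp add: Mart_def set_lebesgue_integral_def min_absorb1)
  qed
  ultimately show ?thesis by (simp cong: measurable_cong)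
qed

lemma Mart_measurable [measurable]: "Mart t \<in> borel_measurable M"
  using Mart_adapted by (rule G_measurableD)

text \<open>The martingale property, in the form in which it is used: an increment is orthogonal to every
  integrable vector known at its beginning. It is the compensation formula for the predictable process
  \<open>\<xi> \<bullet> h\<close> on \<open>(s, t]\<close>.\<close>

theorem Mart_orthogonal:
  assumes st: "0 \<le> s" "s \<le> t" and \<xi>: "\<xi> \<in> borel_measurable (G s)" "integrable M \<xi>"
  shows "integrable M (\<lambda>\<omega>. \<xi> \<omega> \<bullet> (Mart t \<omega> - Mart s \<omega>))"
    and "(\<integral>\<omega>. \<xi> \<omega> \<bullet> (Mart t \<omega> - Mart s \<omega>) \<partial>M) = 0"
proof -
  define g where "g u \<omega> = \<xi> \<omega> \<bullet> h u \<omega>" for u \<omega>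
  have "(\<lambda>p. (case p of (u, \<omega>) \<Rightarrow> indicator {s<..t} u *\<^sub>R \<xi> \<omega>) \<bullet> (case p of (u, \<omega>) \<Rightarrow> h u \<omega>)) \<in> borel_measurable Pred"
    by (intro borel_measurable_inner rect_indicator_Pred \<xi> h_Pred)
  then have g_Pred: "(\<lambda>(u, \<omega>). indicator {s<..t} u * g u \<omega>) \<in> borel_measurable Pred"
    by (simp add: g_def case_prod_beta')
  have g_bound: "\<bar>g u \<omega>\<bar> \<le> norm (\<xi> \<omega>) * B" if "\<omega> \<in> space M" for u \<omega>
    unfolding g_def using h_bound[OF that, of u]
    by (intro order_trans[OF Cauchy_Schwarz_ineq2] mult_left_mono) auto
  have c: "integrable M (\<lambda>\<omega>. norm (\<xi> \<omega>) * B)" using \<xi>(2) by auto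
  note comp = compensation_formula[OF st g_Pred g_bound c]
  have eq: "\<xi> \<omega> \<bullet> (Mart t \<omega> - Mart s \<omega>)
      = (1 / r) * (\<Sum>k\<in>{N s \<omega>..<N t \<omega>}. g (T k \<omega>) \<omega>) - (LINT u:{s<..t}|lborel. g u \<omega>)"
    if \<omega>: "\<omega> \<in> space M" for \<omega>
  proof -
    have "\<xi> \<omega> \<bullet> (LINT u:{s<..t}|lborel. h u \<omega>) = (LINT u:{s<..t}|lborel. g u \<omega>)"
      using h_set_integrable[OF \<omega>, of s t]
      unfolding set_lebesgue_integral_def set_integrable_def g_def
      by (subst integral_inner_right[symmetric]) auto
    then show ?thesis
      unfolding Mart_diff[OF st \<omega>] by (simp add: inner_diff_right inner_sum_right g_def)
  qed
  have int: "integrable M (\<lambda>\<omega>. (1 / r) * (\<Sum>k\<in>{N s \<omega>..<N t \<omega>}. g (T k \<omega>) \<omega>) - (LINT u:{s<..t}|lborel. g u \<omega>))"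
    using comp(1,2) by auto
  then show "integrable M (\<lambda>\<omega>. \<xi> \<omega> \<bullet> (Mart t \<omega> - Mart s \<omega>))"
    by (subst Bochner_Integration.integrable_cong[OF refl eq])
  have "(\<integral>\<omega>. \<xi> \<omega> \<bullet> (Mart t \<omega> - Mart s \<omega>) \<partial>M)
    = (\<integral>\<omega>. (1 / r) * (\<Sum>k\<in>{N s \<omega>..<N t \<omega>}. g (T k \<omega>) \<omega>) - (LINT u:{s<..t}|lborel. g u \<omega>) \<partial>M)"
    by (rule Bochner_Integration.integral_cong[OF refl eq])
  also have "\<dots> = 0"
    using comp r_pos by (subst Bochner_Integration.integral_diff) auto
  finally show "(\<integral>\<omega>. \<xi> \<omega> \<bullet> (Mart t \<omega> - Mart s \<omega>) \<partial>M) = 0" .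
qed

text \<open>The drift part makes this bound larger than \<open>B\<^sup>2 (t - s) / r\<close>, but only by a term of second order in
  \<open>t - s\<close>, which disappears when increments are summed over a fine grid.\<close>

lemma Mart_increment_square:
  assumes st: "0 \<le> s" "s \<le> t"
  shows "integrable M (\<lambda>\<omega>. (norm (Mart t \<omega> - Mart s \<omega>))\<^sup>2)"
    and "(\<integral>\<omega>. (norm (Mart t \<omega> - Mart s \<omega>))\<^sup>2 \<partial>M) \<le> B\<^sup>2 * ((t - s) / r + 4 * (t - s)\<^sup>2)"
proof -
  note mom = increment_moments[OF st]
  let ?R = "\<lambda>\<omega>. B\<^sup>2 * ((real (N t \<omega> - N s \<omega>))\<^sup>2 / r\<^sup>2 + 2 * (t - s) / r * real (N t \<omega> - N s \<omega>) + (t - s)\<^sup>2)"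
  have le: "(norm (Mart t \<omega> - Mart s \<omega>))\<^sup>2 \<le> ?R \<omega>" if "\<omega> \<in> space M" for \<omega>
  proof -
    have "(norm (Mart t \<omega> - Mart s \<omega>))\<^sup>2 \<le> (B * (real (N t \<omega> - N s \<omega>) / r + (t - s)))\<^sup>2"
      by (intro power_mono Mart_increment_bound[OF st that]) simp
    also have "\<dots> = ?R \<omega>"
      by (simp add: power_mult_distrib power2_sum power_divide)
    finally show ?thesis .
  qed
  have int: "integrable M ?R"
    using mom by (intro integrable_mult_right Bochner_Integration.integrable_add integrable_divide integrable_const)
  show 1: "integrable M (\<lambda>\<omega>. (norm (Mart t \<omega> - Mart s \<omega>))\<^sup>2)"
  proof (rule Bochner_Integration.integrable_bound[OF int])
    show "AE \<omega> in M. norm ((norm (Mart t \<omega> - Mart s \<omega>))\<^sup>2) \<le> norm (?R \<omega>)"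
    proof (rule AE_I2)
      fix \<omega> assume "\<omega> \<in> space M"
      from order_trans[OF le[OF this] abs_ge_self]
      show "norm ((norm (Mart t \<omega> - Mart s \<omega>))\<^sup>2) \<le> norm (?R \<omega>)" by simp
    qed
  qed measurable
  have "(\<integral>\<omega>. (norm (Mart t \<omega> - Mart s \<omega>))\<^sup>2 \<partial>M) \<le> (\<integral>\<omega>. ?R \<omega> \<partial>M)"
    by (rule integral_mono[OF 1 int le])
  also have "\<dots> = B\<^sup>2 * ((\<integral>\<omega>. (real (N t \<omega> - N s \<omega>))\<^sup>2 \<partial>M) / r\<^sup>2
      + 2 * (t - s) / r * (\<integral>\<omega>. real (N t \<omega> - N s \<omega>) \<partial>M) + (t - s)\<^sup>2)"
    using mom by (simp add: prob_space)
  also have "\<dots> = B\<^sup>2 * ((t - s) / r + 4 * (t - s)\<^sup>2)"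
    using r_pos unfolding mom(2,4) by (simp add: field_simps power2_eq_square)
  finally show "(\<integral>\<omega>. (norm (Mart t \<omega> - Mart s \<omega>))\<^sup>2 \<partial>M) \<le> B\<^sup>2 * ((t - s) / r + 4 * (t - s)\<^sup>2)" .
qed

lemma Mart_square_integrable: "0 \<le> t \<Longrightarrow> integrable M (\<lambda>\<omega>. (norm (Mart t \<omega>))\<^sup>2)"
  using Mart_increment_square(1)[of 0 t]
  by (rule Bochner_Integration.integrable_cong[OF refl, THEN iffD1, rotated -1]) (auto simp: Mart_0)

lemma Mart_integrable:
  assumes "0 \<le> t"
  shows "integrable M (Mart t)"
proof (rule Bochner_Integration.integrable_bound)
  show "integrable M (\<lambda>\<omega>. 1 + (norm (Mart t \<omega>))\<^sup>2)"
    using Mart_square_integrable[OF assms] by auto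
  show "AE \<omega> in M. norm (Mart t \<omega>) \<le> norm (1 + (norm (Mart t \<omega>))\<^sup>2)"
    using norm_le_1_plus_square by (intro AE_I2) (simp add: abs_of_nonneg add_nonneg_nonneg)
qed measurable

lemma Mart_square_step:
  assumes st: "0 \<le> s" "s \<le> t"
  shows "(\<integral>\<omega>. (norm (Mart t \<omega>))\<^sup>2 \<partial>M)
    = (\<integral>\<omega>. (norm (Mart s \<omega>))\<^sup>2 \<partial>M) + (\<integral>\<omega>. (norm (Mart t \<omega> - Mart s \<omega>))\<^sup>2 \<partial>M)"
proof -
  note orth = Mart_orthogonal[OF st Mart_adapted Mart_integrable[OF st(1)]]
  have "(norm (Mart t \<omega>))\<^sup>2 = (norm (Mart s \<omega>))\<^sup>2 + (norm (Mart t \<omega> - Mart s \<omega>))\<^sup>2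
      + 2 * (Mart s \<omega> \<bullet> (Mart t \<omega> - Mart s \<omega>))" for \<omega>
    by (simp add: power2_norm_eq_inner algebra_simps inner_commute)
  then show ?thesis
    using orth Mart_square_integrable[OF st(1)] Mart_increment_square(1)[OF st] by simp
qed

text \<open>Increments over the cells of a grid are orthogonal, so their second moments add up; letting
  the mesh tend to zero removes the second order terms.\<close>

theorem Mart_L2:
  assumes t: "0 \<le> t"
  shows "(\<integral>\<omega>. (norm (Mart t \<omega>))\<^sup>2 \<partial>M) \<le> B\<^sup>2 * t / r"
proof (rule LIMSEQ_le_const)
  let ?c = "\<lambda>n. B\<^sup>2 * (t / real (Suc n) / r + 4 * (t / real (Suc n))\<^sup>2)"
  have grid: "(\<integral>\<omega>. (norm (Mart (real i * (t / real (Suc n))) \<omega>))\<^sup>2 \<partial>M) \<le> real i * ?c n" for i n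
  proof (induction i)
    case 0
    have "(\<integral>\<omega>. (norm (Mart 0 \<omega>))\<^sup>2 \<partial>M) = (\<integral>\<omega>. 0 \<partial>M)"
      by (rule Bochner_Integration.integral_cong) (auto simp: Mart_0)
    then show ?case by simp
  next
    case (Suc i)
    let ?s = "real i * (t / real (Suc n))" and ?u = "real (Suc i) * (t / real (Suc n))"
    have diff: "?u - ?s = t / real (Suc n)"
      unfolding left_diff_distrib[symmetric] by simp
    have nn: "0 \<le> t / real (Suc n)" using t by simp
    then have "0 \<le> ?s" by (intro mult_nonneg_nonneg) auto
    moreover have "?s \<le> ?u" using diff nn by linarith
    ultimately have su: "0 \<le> ?s" "?s \<le> ?u" .
    show ?case
      using Suc Mart_increment_square(2)[OF su] unfolding Mart_square_step[OF su] diff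
      by (simp add: distrib_right)
  qed
  have "real (Suc n) * ?c n = B\<^sup>2 * t / r + 4 * B\<^sup>2 * t\<^sup>2 * inverse (real (Suc n))" for n
    using r_pos by (simp add: field_simps power2_eq_square del: of_nat_Suc)
  then show "\<exists>n0. \<forall>n\<ge>n0. (\<integral>\<omega>. (norm (Mart t \<omega>))\<^sup>2 \<partial>M)
      \<le> B\<^sup>2 * t / r + 4 * B\<^sup>2 * t\<^sup>2 * inverse (real (Suc n))"
    using grid[of "Suc n" n for n] by (simp del: of_nat_Suc)
  show "(\<lambda>n. B\<^sup>2 * t / r + 4 * B\<^sup>2 * t\<^sup>2 * inverse (real (Suc n))) \<longlonglongrightarrow> B\<^sup>2 * t / r"
    using tendsto_add[OF tendsto_const tendsto_mult_right_zero[OF LIMSEQ_inverse_real_of_nat]] by fastforce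
qed

lemma Mart_right_continuous:
  assumes t: "0 \<le> t" and \<omega>: "\<omega> \<in> space M"
  shows "continuous (at t within {t..}) (\<lambda>s. Mart s \<omega>)"
proof -
  have "((\<lambda>s. Mart s \<omega> - Mart t \<omega>) \<longlongrightarrow> 0) (at_right t)"
  proof (rule tendsto_norm_zero_cancel, rule tendsto_sandwich[where f = "\<lambda>_. 0" and h = "\<lambda>s. B * (s - t)"])
    show "((\<lambda>s. B * (s - t)) \<longlongrightarrow> 0) (at_right t)"
      by (auto intro!: tendsto_eq_intros)
    have "\<forall>\<^sub>F s in at_right t. N s \<omega> = N t \<omega>"
      by (rule counting_path.eventually_n_right[OF path[OF \<omega>]])
    moreover have "\<forall>\<^sub>F s in at_right t. t < s" by (simp add: eventually_at_filter)
    ultimately show "\<forall>\<^sub>F s in at_right t. norm (Mart s \<omega> - Mart t \<omega>) \<le> B * (s - t)"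
    proof eventually_elim
      case (elim s)
      then show ?case using Mart_increment_bound[OF t less_imp_le[OF elim(2)] \<omega>] by simp
    qed
  qed auto
  then show ?thesis
    unfolding continuous_within at_within_Ici_at_right by (simp add: LIM_zero_iff)
qed

text \<open>The expectation of \<open>doob_pathwise\<close>. The sum there dominates
  \<open>\<Sum> a\<^sub>i \<langle>sgn M\<^sub>i, M\<^sub>i\<^sub>+\<^sub>1 - M\<^sub>i\<rangle>\<close>, a sum of martingale increments against vectors of the past, because
  \<open>|M\<^sub>i\<^sub>+\<^sub>1| \<ge> \<langle>sgn M\<^sub>i, M\<^sub>i\<^sub>+\<^sub>1\<rangle>\<close> with equality when \<open>i + 1\<close> is replaced by \<open>i\<close>.\<close>

lemma Mart_grid_maximal:
  fixes g :: "nat \<Rightarrow> real"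
  assumes g: "mono g" "g 0 = 0"
  shows "(\<integral>\<^sup>+\<omega>. ennreal ((Max ((\<lambda>i. norm (Mart (g i) \<omega>)) ` {..n}))\<^sup>2) \<partial>M) \<le> ennreal (4 * (B\<^sup>2 * g n / r))"
proof -
  have g_nn: "0 \<le> g i" for i using monoD[OF g(1), of 0 i] g(2) by simp
  have g_Suc: "g i \<le> g (Suc i)" for i using monoD[OF g(1), of i "Suc i"] by simp
  define a where "a i \<omega> = Max ((\<lambda>i. norm (Mart (g i) \<omega>)) ` {..i})" for i \<omega>
  have a_nn: "0 \<le> a i \<omega>" for i \<omega>
    unfolding a_def by (rule order_trans[OF norm_ge_zero Max_ge]) auto
  have a_le: "a i \<omega> \<le> (\<Sum>j\<le>i. norm (Mart (g j) \<omega>))" for i \<omega>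
    unfolding a_def by (subst Max_le_iff) (auto intro!: member_le_sum)
  have a_sq: "(a i \<omega>)\<^sup>2 \<le> (\<Sum>j\<le>i. (norm (Mart (g j) \<omega>))\<^sup>2)" for i \<omega>
  proof -
    have "a i \<omega> \<in> (\<lambda>i. norm (Mart (g i) \<omega>)) ` {..i}" unfolding a_def by (rule Max_in) auto
    then obtain j where "j \<le> i" "a i \<omega> = norm (Mart (g j) \<omega>)" by auto
    then show ?thesis
      using member_le_sum[of j "{..i}" "\<lambda>j. (norm (Mart (g j) \<omega>))\<^sup>2"] by simp
  qed
  have a_adapted: "a i \<in> borel_measurable (G (g i))" for i
    unfolding a_def
    using G_measurable_mono[OF monoD[OF g(1)] Mart_adapted]
    by (intro borel_measurable_Max borel_measurable_norm) auto
  have [measurable]: "a i \<in> borel_measurable M" for i using a_adapted by (rule G_measurableD)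
  define \<xi> where "\<xi> i \<omega> = a i \<omega> *\<^sub>R sgn (Mart (g i) \<omega>)" for i \<omega>
  have \<xi>_adapted: "\<xi> i \<in> borel_measurable (G (g i))" for i
  proof -
    have [measurable]: "Mart (g i) \<in> borel_measurable (G (g i))" "a i \<in> borel_measurable (G (g i))"
      by (rule Mart_adapted, rule a_adapted)
    show ?thesis unfolding \<xi>_def sgn_div_norm by measurable
  qed
  have \<xi>_int: "integrable M (\<xi> i)" for i
  proof (rule Bochner_Integration.integrable_bound)
    show "integrable M (\<lambda>\<omega>. \<Sum>j\<le>i. norm (Mart (g j) \<omega>))"
      using Mart_integrable[OF g_nn] by auto
    show "\<xi> i \<in> borel_measurable M" using \<xi>_adapted by (rule G_measurableD)
    have "norm (\<xi> i \<omega>) \<le> a i \<omega>" for \<omega>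
      using a_nn[of i \<omega>] by (auto simp: \<xi>_def norm_sgn)
    then have "norm (\<xi> i \<omega>) \<le> norm (\<Sum>j\<le>i. norm (Mart (g j) \<omega>))" for \<omega>
      using a_le[of i \<omega>] a_nn[of i \<omega>] by (simp only: real_norm_def) (meson abs_ge_self order_trans)
    then show "AE \<omega> in M. norm (\<xi> i \<omega>) \<le> norm (\<Sum>j\<le>i. norm (Mart (g j) \<omega>))" by simp
  qed
  note orth = Mart_orthogonal[OF g_nn g_Suc \<xi>_adapted \<xi>_int]
  have sub: "\<xi> i \<omega> \<bullet> (Mart (g (Suc i)) \<omega> - Mart (g i) \<omega>)
      \<le> a i \<omega> * (norm (Mart (g (Suc i)) \<omega>) - norm (Mart (g i) \<omega>))" for i \<omega>
  proof -
    have "sgn (Mart (g i) \<omega>) \<bullet> Mart (g (Suc i)) \<omega> \<le> norm (sgn (Mart (g i) \<omega>)) * norm (Mart (g (Suc i)) \<omega>)"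
      by (rule norm_cauchy_schwarz)
    also have "\<dots> \<le> norm (Mart (g (Suc i)) \<omega>)" by (simp add: norm_sgn)
    finally have 1: "sgn (Mart (g i) \<omega>) \<bullet> Mart (g (Suc i)) \<omega> \<le> norm (Mart (g (Suc i)) \<omega>)" .
    have 2: "sgn (Mart (g i) \<omega>) \<bullet> Mart (g i) \<omega> = norm (Mart (g i) \<omega>)"
      by (cases "Mart (g i) \<omega> = 0") (simp_all add: sgn_div_norm power2_norm_eq_inner[symmetric] power2_eq_square)
    have "\<xi> i \<omega> \<bullet> (Mart (g (Suc i)) \<omega> - Mart (g i) \<omega>)
      = a i \<omega> * (sgn (Mart (g i) \<omega>) \<bullet> Mart (g (Suc i)) \<omega> - norm (Mart (g i) \<omega>))"
      by (simp add: \<xi>_def inner_diff_right right_diff_distrib 2)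
    also have "\<dots> \<le> a i \<omega> * (norm (Mart (g (Suc i)) \<omega>) - norm (Mart (g i) \<omega>))"
      using 1 a_nn by (intro mult_left_mono) auto
    finally show ?thesis .
  qed
  have le: "(a n \<omega>)\<^sup>2 \<le> 4 * (norm (Mart (g n) \<omega>))\<^sup>2
      - 4 * (\<Sum>i<n. \<xi> i \<omega> \<bullet> (Mart (g (Suc i)) \<omega> - Mart (g i) \<omega>))" for \<omega>
  proof -
    have "(\<Sum>i<n. \<xi> i \<omega> \<bullet> (Mart (g (Suc i)) \<omega> - Mart (g i) \<omega>))
        \<le> (\<Sum>i<n. a i \<omega> * (norm (Mart (g (Suc i)) \<omega>) - norm (Mart (g i) \<omega>)))"
      by (intro sum_mono sub)
    then show ?thesis
      using doob_pathwise[of "\<lambda>i. norm (Mart (g i) \<omega>)" n] unfolding a_def[symmetric] by simp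
  qed
  have a_int: "integrable M (\<lambda>\<omega>. (a n \<omega>)\<^sup>2)"
  proof (rule Bochner_Integration.integrable_bound)
    show "integrable M (\<lambda>\<omega>. \<Sum>j\<le>n. (norm (Mart (g j) \<omega>))\<^sup>2)"
      using Mart_square_integrable[OF g_nn] by auto
    show "AE \<omega> in M. norm ((a n \<omega>)\<^sup>2) \<le> norm (\<Sum>j\<le>n. (norm (Mart (g j) \<omega>))\<^sup>2)"
      using order_trans[OF a_sq abs_ge_self] by (intro AE_I2) simp
  qed measurable
  have "(\<integral>\<omega>. (a n \<omega>)\<^sup>2 \<partial>M) \<le> (\<integral>\<omega>. 4 * (norm (Mart (g n) \<omega>))\<^sup>2
      - 4 * (\<Sum>i<n. \<xi> i \<omega> \<bullet> (Mart (g (Suc i)) \<omega> - Mart (g i) \<omega>)) \<partial>M)"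
    using Mart_square_integrable[OF g_nn] orth(1) by (intro integral_mono[OF a_int _ le]) auto
  also have "\<dots> = 4 * (\<integral>\<omega>. (norm (Mart (g n) \<omega>))\<^sup>2 \<partial>M)"
    using Mart_square_integrable[OF g_nn] orth by (subst Bochner_Integration.integral_diff) auto
  also have "\<dots> \<le> 4 * (B\<^sup>2 * g n / r)"
    by (rule mult_left_mono[OF Mart_L2[OF g_nn]]) simp
  finally have "(\<integral>\<omega>. (a n \<omega>)\<^sup>2 \<partial>M) \<le> 4 * (B\<^sup>2 * g n / r)" .
  then show ?thesis
    unfolding a_def[symmetric] by (subst nn_integral_eq_integral[OF a_int]) (auto intro: ennreal_leI)
qed

text \<open>The supremum over an interval is an uncountable one, so a measurable upper bound takes its place: the
  lower limit of the maxima over ever finer grids. It dominates every \<open>|M\<^sub>t|\<^sup>2\<close> by right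
  continuity, through grid points that tend to \<open>t\<close> from the right, and Fatou's lemma bounds
  its expectation.\<close>

theorem Mart_maximal:
  assumes \<tau>: "0 < \<tau>"
  obtains W where "W \<in> borel_measurable M"
    and "\<And>\<omega> t. \<omega> \<in> space M \<Longrightarrow> 0 \<le> t \<Longrightarrow> t \<le> \<tau> \<Longrightarrow> ennreal ((norm (Mart t \<omega>))\<^sup>2) \<le> W \<omega>"
    and "(\<integral>\<^sup>+\<omega>. W \<omega> \<partial>M) \<le> ennreal (4 * (B\<^sup>2 * \<tau> / r))"
proof -
  define g where "g n i = real i * (\<tau> / real (Suc n))" for n i
  define a where "a n \<omega> = Max ((\<lambda>i. norm (Mart (g n i) \<omega>)) ` {..Suc n})" for n \<omega>
  have [measurable]: "a n \<in> borel_measurable M" for n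
    unfolding a_def by (intro borel_measurable_Max borel_measurable_norm) auto
  have upper: "ennreal ((norm (Mart t \<omega>))\<^sup>2) \<le> liminf (\<lambda>n. ennreal ((a n \<omega>)\<^sup>2))"
    if \<omega>: "\<omega> \<in> space M" and "0 \<le> t" "t \<le> \<tau>" for \<omega> t
  proof -
    have t: "t \<in> {0..\<tau>}" using that by simp
    define i where "i n = nat \<lceil>t / (\<tau> / real (Suc n))\<rceil>" for n
    have pos: "0 < \<tau> / real (Suc n)" for n using \<tau> by simp
    have "t / (\<tau> / real (Suc n)) \<le> real (Suc n)" for n
      using t \<tau> by (simp add: divide_le_eq mult_right_mono del: of_nat_Suc)
    then have i_le: "i n \<le> Suc n" for n
      unfolding i_def by (metis ceiling_le_iff nat_le_iff of_int_of_nat_eq)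
    have q_nn: "0 \<le> t / (\<tau> / real (Suc n))" for n using t pos[of n] by (simp del: of_nat_Suc)
    have i_bounds: "t / (\<tau> / real (Suc n)) \<le> real (i n)" "real (i n) \<le> t / (\<tau> / real (Suc n)) + 1" for n
      using q_nn[of n] unfolding i_def by linarith+
    have lower: "t \<le> g n (i n)" for n
      using i_bounds(1)[of n] pos[of n] unfolding g_def by (subst (asm) pos_divide_le_eq)
    have upper: "g n (i n) \<le> t + \<tau> * inverse (real (Suc n))" for n
    proof -
      have "g n (i n) \<le> (t / (\<tau> / real (Suc n)) + 1) * (\<tau> / real (Suc n))"
        unfolding g_def using i_bounds(2)[of n] pos[of n] by (intro mult_right_mono) auto
      also have "\<dots> = t + \<tau> * inverse (real (Suc n))"
      proof -
        have "(t / (\<tau> / x) + 1) * (\<tau> / x) = t + \<tau> * inverse x" if "0 < x" for x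
          using \<tau> that by (simp add: field_simps)
        then show ?thesis by simp
      qed
      finally show ?thesis .
    qed
    have lim: "(\<lambda>n. g n (i n)) \<longlonglongrightarrow> t"
    proof (rule tendsto_sandwich[OF _ _ tendsto_const])
      show "(\<lambda>n. t + \<tau> * inverse (real (Suc n))) \<longlonglongrightarrow> t"
        using tendsto_add[OF tendsto_const tendsto_mult_right_zero[OF LIMSEQ_inverse_real_of_nat]] by fastforce
    qed (use lower upper in auto)
    have "continuous (at t within {t..}) (\<lambda>s. Mart s \<omega>)"
      using t by (intro Mart_right_continuous \<omega>) auto
    then have "(\<lambda>n. Mart (g n (i n)) \<omega>) \<longlonglongrightarrow> Mart t \<omega>"
      by (rule continuous_within_tendsto_compose') (use lower lim in auto)
    then have "(\<lambda>n. ennreal ((norm (Mart (g n (i n)) \<omega>))\<^sup>2)) \<longlonglongrightarrow> ennreal ((norm (Mart t \<omega>))\<^sup>2)"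
      by (intro tendsto_ennrealI tendsto_intros)
    then have "ennreal ((norm (Mart t \<omega>))\<^sup>2) = liminf (\<lambda>n. ennreal ((norm (Mart (g n (i n)) \<omega>))\<^sup>2))"
      by (intro lim_imp_Liminf[symmetric]) auto
    also have "\<dots> \<le> liminf (\<lambda>n. ennreal ((a n \<omega>)\<^sup>2))"
    proof (intro Liminf_mono always_eventually allI ennreal_leI power_mono)
      show "norm (Mart (g n (i n)) \<omega>) \<le> a n \<omega>" for n
        unfolding a_def using i_le[of n] by (intro Max_ge) auto
    qed simp
    finally show "ennreal ((norm (Mart t \<omega>))\<^sup>2) \<le> liminf (\<lambda>n. ennreal ((a n \<omega>)\<^sup>2))" .
  qed
  have "(\<integral>\<^sup>+\<omega>. liminf (\<lambda>n. ennreal ((a n \<omega>)\<^sup>2)) \<partial>M) \<le> liminf (\<lambda>n. \<integral>\<^sup>+\<omega>. ennreal ((a n \<omega>)\<^sup>2) \<partial>M)"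
    by (rule nn_integral_liminf) measurable
  also have "\<dots> \<le> liminf (\<lambda>n::nat. ennreal (4 * (B\<^sup>2 * \<tau> / r)))"
  proof (intro Liminf_mono always_eventually allI)
    fix n
    have "mono (g n)"
      unfolding g_def using \<tau> by (intro monoI mult_right_mono) auto
    moreover have "g n (Suc n) = \<tau>" "g n 0 = 0" by (simp_all add: g_def)
    ultimately show "(\<integral>\<^sup>+\<omega>. ennreal ((a n \<omega>)\<^sup>2) \<partial>M) \<le> ennreal (4 * (B\<^sup>2 * \<tau> / r))"
      using Mart_grid_maximal[of "g n" "Suc n"] by (simp add: a_def)
  qed
  also have "\<dots> = ennreal (4 * (B\<^sup>2 * \<tau> / r))" by (simp add: Liminf_const)
  finally have "(\<integral>\<^sup>+\<omega>. liminf (\<lambda>n. ennreal ((a n \<omega>)\<^sup>2)) \<partial>M) \<le> ennreal (4 * (B\<^sup>2 * \<tau> / r))" .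
  with upper show ?thesis by (intro that[of "\<lambda>\<omega>. liminf (\<lambda>n. ennreal ((a n \<omega>)\<^sup>2))"]) measurable
qed

end

section \<open>The flow and the jump scheme\<close>

lemma bounded_set_integrable:
  fixes f :: "real \<Rightarrow> 'v::euclidean_space"
  assumes "f \<in> borel_measurable borel" "\<And>s. norm (f s) \<le> B"
  shows "set_integrable lborel {0..t} f"
  unfolding set_integrable_def
proof (rule integrableI_bounded_set_indicator)
  show "f \<in> borel_measurable lborel" using assms by simp
  show "emeasure lborel {0..t} < \<infinity>" by (cases "0 \<le> t") auto
qed (use assms in auto)

lemma norm_set_integral_le:
  fixes f :: "real \<Rightarrow> 'v::euclidean_space"
  assumes f: "set_integrable lborel A f" and g: "set_integrable lborel A g"
    and le: "AE s in lborel. s \<in> A \<longrightarrow> norm (f s) \<le> g s"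
  shows "norm (LINT s:A|lborel. f s) \<le> (LINT s:A|lborel. g s)"
proof -
  have "norm (LINT s:A|lborel. f s) \<le> (LINT s:A|lborel. norm (f s))"
    by (rule set_integral_norm_bound[OF f])
  also have "\<dots> \<le> (LINT s:A|lborel. g s)"
    unfolding set_lebesgue_integral_def
  proof (rule integral_mono_AE)
    show "integrable lborel (\<lambda>s. indicator A s *\<^sub>R norm (f s))"
      using set_integrable_norm[OF f] by (simp add: set_integrable_def)
    show "integrable lborel (\<lambda>s. indicator A s *\<^sub>R g s)"
      using g by (simp add: set_integrable_def)
    show "AE s in lborel. indicator A s *\<^sub>R norm (f s) \<le> indicator A s *\<^sub>R g s"
      using le by eventually_elim (simp add: indicator_def)
  qed
  finally show ?thesis .
qed

locale lipschitz_field =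
  fixes b :: "real \<Rightarrow> 'v::euclidean_space \<Rightarrow> 'v" and B L :: real
  assumes b_meas: "(\<lambda>(t, x). b t x) \<in> borel_measurable (borel \<Otimes>\<^sub>M borel)"
    and b_bound: "norm (b t x) \<le> B"
    and b_lip: "L-lipschitz_on UNIV (b t)"
begin

lemma b_meas2 [measurable (raw)]:
  assumes [measurable]: "f \<in> borel_measurable M" "g \<in> borel_measurable M"
  shows "(\<lambda>x. b (f x) (g x)) \<in> borel_measurable M"
proof -
  have "(\<lambda>x. (f x, g x)) \<in> measurable M (borel \<Otimes>\<^sub>M borel)" by measurable
  from measurable_compose[OF this b_meas] show ?thesis by simp
qed

lemma B_nonneg: "0 \<le> B"
  using b_bound[of 0 0] by (rule order_trans[OF norm_ge_zero])

lemma L_nonneg: "0 \<le> L"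
  using b_lip by (rule lipschitz_on_nonneg)

lemma b_lipD: "norm (b t x - b t y) \<le> L * norm (x - y)"
  using lipschitz_onD[OF b_lip, of x y t] by (simp add: dist_norm)

fun picard :: "nat \<Rightarrow> real \<Rightarrow> 'v \<Rightarrow> 'v" where
  "picard 0 t x = x"
| "picard (Suc n) t x = x + (LINT s:{0..t}|lborel. b s (picard n s x))"

lemma picard_measurable: "(\<lambda>(t, x). picard n t x) \<in> borel_measurable (borel \<Otimes>\<^sub>M borel)"
proof (induction n)
  case (Suc n)
  have [measurable]: "(\<lambda>p. picard n (f p) (g p)) \<in> borel_measurable M"
    if "f \<in> borel_measurable M" "g \<in> borel_measurable M" for M f and g :: "_ \<Rightarrow> 'v"
    using measurable_compose[OF measurable_Pair[OF that] Suc] by simp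
  have "(\<lambda>(p, s). (if 0 \<le> s \<and> s \<le> fst p then 1 else 0) *\<^sub>R b s (picard n s (snd p)))
      \<in> borel_measurable ((borel \<Otimes>\<^sub>M borel) \<Otimes>\<^sub>M lborel)"
    by measurable
  then have [measurable]: "(\<lambda>p. LINT s|lborel. (if 0 \<le> s \<and> s \<le> fst p then 1 else 0) *\<^sub>R b s (picard n s (snd p)))
      \<in> borel_measurable (borel \<Otimes>\<^sub>M borel)"
    by (rule lborel.borel_measurable_lebesgue_integral)
  have "(\<lambda>p. snd p + (LINT s|lborel. (if 0 \<le> s \<and> s \<le> fst p then 1 else 0) *\<^sub>R b s (picard n s (snd p))))
      \<in> borel_measurable (borel \<Otimes>\<^sub>M borel)"
    by measurable
  moreover have "(if 0 \<le> s \<and> s \<le> t then 1 else 0) = (indicator {0..t} s :: real)" for s t :: real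
    by simp
  ultimately show ?case
    by (simp add: set_lebesgue_integral_def case_prod_beta')
qed simp

lemma picard_section: "(\<lambda>s. picard n s x) \<in> borel_measurable borel"
  using measurable_Pair1[OF picard_measurable, of x n] by simp

text \<open>The flow enters only as a measurable function of the initial value that agrees with every
  solution. Convergence of the iterates is proved where a solution exists, as their distance to it.\<close>

definition flow :: "real \<Rightarrow> 'v \<Rightarrow> 'v" where
  "flow t x = lim (\<lambda>n. picard n t x)"

lemma flow_measurable: "(\<lambda>(t, x). flow t x) \<in> borel_measurable (borel \<Otimes>\<^sub>M borel)"
proof -
  have "(\<lambda>p. lim (\<lambda>n. (\<lambda>(t, x). picard n t x) p)) \<in> borel_measurable (borel \<Otimes>\<^sub>M borel)"
    by (rule borel_measurable_lim_metric[OF picard_measurable])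
  then show ?thesis by (simp add: flow_def case_prod_beta')
qed

lemma flow_measurable2 [measurable (raw)]:
  assumes [measurable]: "f \<in> borel_measurable M" "g \<in> borel_measurable M"
  shows "(\<lambda>x. flow (f x) (g x)) \<in> borel_measurable M"
proof -
  have "(\<lambda>x. (f x, g x)) \<in> measurable M (borel \<Otimes>\<^sub>M borel)" by measurable
  from measurable_compose[OF this flow_measurable] show ?thesis by simp
qed

lemma ode_solution_integral_bound:
  assumes x: "ode_solution b x0 x" and t: "0 \<le> t"
  shows "norm (x t - x0) \<le> B * t"
proof -
  have "norm (LINT s:{0..t}|lborel. b s (x s)) \<le> (LINT s:{0..t}|lborel. B)"
    using x t b_bound by (intro norm_set_integral_le) (auto simp: ode_solution_def set_integrable_def)
  also have "\<dots> = B * t" using t by (simp add: set_lebesgue_integral_def)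
  finally show ?thesis using x t by (simp add: ode_solution_def)
qed

text \<open>Comparing the iterates with a given solution yields uniqueness and convergence in one
  induction.\<close>

lemma picard_error:
  assumes x: "ode_solution b x0 x" and t: "0 \<le> t" "t \<le> \<tau>"
  shows "norm (picard n t x0 - x t) \<le> B * \<tau> * (L * t) ^ n / fact n"
  using t
proof (induction n arbitrary: t)
  case 0
  then have "norm (x0 - x t) \<le> B * t"
    using ode_solution_integral_bound[OF x, of t] by (simp add: norm_minus_commute)
  also have "\<dots> \<le> B * \<tau>" using 0 B_nonneg by (intro mult_left_mono) auto
  finally show ?case by simp
next
  case (Suc n)
  have 1: "set_integrable lborel {0..t} (\<lambda>s. b s (picard n s x0))"
    using picard_section[of n x0] by (intro bounded_set_integrable[OF _ b_bound]) measurable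
  have 2: "set_integrable lborel {0..t} (\<lambda>s. b s (x s))" and xt: "x t = x0 + (LINT s:{0..t}|lborel. b s (x s))"
    using x Suc.prems(1) by (auto simp: ode_solution_def)
  have "norm (picard (Suc n) t x0 - x t) = norm (LINT s:{0..t}|lborel. b s (picard n s x0) - b s (x s))"
    using 1 2 by (simp add: xt)
  also have "\<dots> \<le> (LINT s:{0..t}|lborel. L * (B * \<tau> * (L * s) ^ n / fact n))"
  proof (rule norm_set_integral_le[OF set_integral_diff(1)[OF 1 2]])
    show "set_integrable lborel {0..t} (\<lambda>s. L * (B * \<tau> * (L * s) ^ n / fact n))"
      by (intro set_integrable_mult_right set_integral_power_0(1) Suc.prems(1))
    have "norm (b s (picard n s x0) - b s (x s)) \<le> L * (B * \<tau> * (L * s) ^ n / fact n)"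
      if "s \<in> {0..t}" for s
      using Suc.IH[of s] Suc.prems that L_nonneg
      by (intro order_trans[OF b_lipD] mult_left_mono) auto
    then show "AE s in lborel. s \<in> {0..t} \<longrightarrow>
        norm (b s (picard n s x0) - b s (x s)) \<le> L * (B * \<tau> * (L * s) ^ n / fact n)"
      by simp
  qed
  also have "\<dots> = L * (LINT s:{0..t}|lborel. B * \<tau> * (L * s) ^ n / fact n)"
    by (rule set_integral_mult_right)
  also have "\<dots> = B * \<tau> * (L * t) ^ Suc n / fact (Suc n)"
    by (rule set_integral_power_0(2)[OF Suc.prems(1)])
  finally show ?case .
qed

lemma flow_eq_solution:
  assumes x: "ode_solution b x0 x" and t: "0 \<le> t"
  shows "flow t x0 = x t"
proof -
  have "(\<lambda>n. (L * t) ^ n / fact n) \<longlonglongrightarrow> 0"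
    using summable_LIMSEQ_zero[OF summable_exp[of "L * t"]] by (simp add: divide_inverse mult.commute)
  then have "(\<lambda>n. B * t * ((L * t) ^ n / fact n)) \<longlonglongrightarrow> 0"
    by (rule tendsto_mult_right_zero)
  then have "(\<lambda>n. picard n t x0 - x t) \<longlonglongrightarrow> 0"
    by (rule Lim_null_comparison[rotated]) (use picard_error[OF x t order_refl] in simp)
  then have "(\<lambda>n. picard n t x0) \<longlonglongrightarrow> x t"
    by (simp add: LIM_zero_iff)
  then show ?thesis unfolding flow_def by (rule limI)
qed

end

context poisson_counting
begin

definition N_left :: "real \<Rightarrow> 'a \<Rightarrow> nat" where
  "N_left u \<omega> = counting_path.n_left (\<lambda>t. N t \<omega>) u"

text \<open>The left limits of an adapted pure jump process are predictable: on each cell \<open>(c, d]\<close> of a fine grid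
  the current value is replaced by the value at \<open>c\<close>, and as the mesh tends to zero these values
  become equal to the left limit.\<close>

lemma left_limit_Pred:
  fixes Y :: "nat \<Rightarrow> 'a \<Rightarrow> 'v::euclidean_space"
  assumes adapted: "\<And>t. (\<lambda>\<omega>. Y (N t \<omega>) \<omega>) \<in> borel_measurable (G t)"
  shows "(\<lambda>(u, \<omega>). Y (N_left u \<omega>) \<omega>) \<in> borel_measurable Pred"
proof -
  define g where "g m u = (of_int \<lceil>real (Suc m) * u\<rceil> - 1) / real (Suc m)" for m u
  have g: "u - inverse (real (Suc m)) \<le> g m u" "g m u < u" for m u
  proof -
    have *: "(of_int \<lceil>x * u\<rceil> - 1) / x < u" "u - inverse x \<le> (of_int \<lceil>x * u\<rceil> - 1) / x" if "0 < x" for x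
      using that ceiling_correct[of "x * u"] by (auto simp: field_simps)
    show "g m u < u" "u - inverse (real (Suc m)) \<le> g m u"
      unfolding g_def by (rule *; simp)+
  qed
  have cell: "g m u = (of_int j - 1) / real (Suc m) \<longleftrightarrow>
      (of_int j - 1) / real (Suc m) < u \<and> u \<le> of_int j / real (Suc m)" for m u and j :: int
  proof -
    have "\<lceil>x * u\<rceil> = j \<longleftrightarrow> (of_int j - 1) / x < u \<and> u \<le> of_int j / x" if "0 < x" for x
      using that by (simp add: ceiling_eq_iff field_simps)
    moreover have "g m u = (of_int j - 1) / real (Suc m) \<longleftrightarrow> \<lceil>real (Suc m) * u\<rceil> = j"
      unfolding g_def by (simp add: divide_cancel_right del: of_nat_Suc)
    ultimately show ?thesis by simp
  qed
  have "(\<lambda>p. Y (N (g m (fst p)) (snd p)) (snd p)) \<in> borel_measurable Pred" for m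
  proof (rule measurableI)
    fix S :: "'v set" assume S: "S \<in> sets borel"
    let ?c = "\<lambda>j::int. (of_int j - 1) / real (Suc m)"
    have "(\<lambda>p. Y (N (g m (fst p)) (snd p)) (snd p)) -` S \<inter> space Pred
      = (\<Union>j. {?c j<..of_int j / real (Suc m)} \<times> ((\<lambda>\<omega>. Y (N (?c j) \<omega>) \<omega>) -` S \<inter> space M))"
    proof (intro equalityI subsetI)
      fix p assume p: "p \<in> (\<lambda>p. Y (N (g m (fst p)) (snd p)) (snd p)) -` S \<inter> space Pred"
      define j where "j = \<lceil>real (Suc m) * fst p\<rceil>"
      have gj: "g m (fst p) = ?c j" by (simp add: g_def j_def)
      then have "?c j < fst p \<and> fst p \<le> of_int j / real (Suc m)" using cell by blast
      then have "p \<in> {?c j<..of_int j / real (Suc m)} \<times> ((\<lambda>\<omega>. Y (N (?c j) \<omega>) \<omega>) -` S \<inter> space M)"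
        using p unfolding mem_Times_iff gj[symmetric] by (auto simp: mem_Times_iff)
      then show "p \<in> (\<Union>j. {?c j<..of_int j / real (Suc m)} \<times> ((\<lambda>\<omega>. Y (N (?c j) \<omega>) \<omega>) -` S \<inter> space M))"
        by blast
    next
      fix p assume "p \<in> (\<Union>j. {?c j<..of_int j / real (Suc m)} \<times> ((\<lambda>\<omega>. Y (N (?c j) \<omega>) \<omega>) -` S \<inter> space M))"
      then obtain j where j: "p \<in> {?c j<..of_int j / real (Suc m)} \<times> ((\<lambda>\<omega>. Y (N (?c j) \<omega>) \<omega>) -` S \<inter> space M)"
        by blast
      then have "g m (fst p) = ?c j" unfolding cell by (auto simp: mem_Times_iff)
      then show "p \<in> (\<lambda>p. Y (N (g m (fst p)) (snd p)) (snd p)) -` S \<inter> space Pred"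
        using j by (auto simp: mem_Times_iff)
    qed
    also have "\<dots> \<in> sets Pred"
    proof (intro sets.countable_UN, intro image_subsetI)
      fix j :: int
      have "(\<lambda>\<omega>. Y (N (?c j) \<omega>) \<omega>) -` S \<inter> space M \<in> sets (G (?c j))"
        using measurable_sets[OF adapted S, of "?c j"] by (simp only: G_space)
      then show "{?c j<..of_int j / real (Suc m)} \<times> ((\<lambda>\<omega>. Y (N (?c j) \<omega>) \<omega>) -` S \<inter> space M) \<in> sets Pred"
        by (rule rect_Pred)
    qed
    finally show "(\<lambda>p. Y (N (g m (fst p)) (snd p)) (snd p)) -` S \<inter> space Pred \<in> sets Pred" .
  qed simp
  then have "(\<lambda>p. Y (N_left (fst p) (snd p)) (snd p)) \<in> borel_measurable Pred"
  proof (rule borel_measurable_LIMSEQ_metric)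
    fix p assume "p \<in> space Pred"
    then have \<omega>: "snd p \<in> space M" by auto
    have "\<forall>\<^sub>F s in at_left (fst p). N s (snd p) = N_left (fst p) (snd p)"
      unfolding N_left_def by (rule counting_path.eventually_n_left[OF path[OF \<omega>]])
    then obtain c where c: "c < fst p" "\<And>s. c < s \<Longrightarrow> s < fst p \<Longrightarrow> N s (snd p) = N_left (fst p) (snd p)"
      unfolding eventually_at_left_field by blast
    have "(\<lambda>m. fst p - inverse (real (Suc m))) \<longlonglongrightarrow> fst p - 0"
      by (intro tendsto_diff tendsto_const LIMSEQ_inverse_real_of_nat)
    then have "\<forall>\<^sub>F m in sequentially. c < fst p - inverse (real (Suc m))"
      using c(1) by (intro order_tendstoD) auto
    then have "\<forall>\<^sub>F m in sequentially. Y (N (g m (fst p)) (snd p)) (snd p) = Y (N_left (fst p) (snd p)) (snd p)"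
    proof eventually_elim
      case (elim m)
      then show ?case using c(2)[of "g m (fst p)"] less_le_trans[OF elim g(1)] g(2) by simp
    qed
    then show "(\<lambda>m. Y (N (g m (fst p)) (snd p)) (snd p)) \<longlonglongrightarrow> Y (N_left (fst p) (snd p)) (snd p)"
      by (rule tendsto_eventually)
  qed
  then show ?thesis by (simp add: case_prod_beta')
qed

end

locale jump_scheme = poisson_counting M r G N + lipschitz_field b B L
  for M :: "'a measure" and r G N and b :: "real \<Rightarrow> 'v::euclidean_space \<Rightarrow> 'v" and B L :: real +
  fixes X0 :: "'a \<Rightarrow> 'v"
  assumes X0_adapted: "X0 \<in> borel_measurable (G s)"
begin

definition Y :: "nat \<Rightarrow> 'a \<Rightarrow> 'v" where
  "Y k \<omega> = jump_chain (1 / r) b (\<lambda>j. T j \<omega>) (X0 \<omega>) k"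

definition XN :: "real \<Rightarrow> 'a \<Rightarrow> 'v" where
  "XN t \<omega> = Y (N t \<omega>) \<omega>"

definition XN_left :: "real \<Rightarrow> 'a \<Rightarrow> 'v" where
  "XN_left u \<omega> = Y (N_left u \<omega>) \<omega>"

text \<open>By induction on \<open>k\<close>, the value after \<open>k\<close> jumps is known at time \<open>t\<close> on the event that \<open>k\<close> jumps have occurred
  by then.\<close>

lemma XN_adapted: "XN t \<in> borel_measurable (G t)"
proof -
  have [measurable]: "N t \<in> measurable (G t) (count_space UNIV)" by (rule N_adapted)
  have [measurable]: "X0 \<in> borel_measurable (G t)" by (rule X0_adapted)
  have [measurable]: "(\<lambda>\<omega>. min (T k \<omega>) t) \<in> borel_measurable (G t)" for k by (rule T_stopped_measurable)
  have *: "(\<lambda>\<omega>. if k \<le> N t \<omega> then Y k \<omega> else 0) \<in> borel_measurable (G t)" for k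
  proof (induction k)
    case 0
    then show ?case by (simp add: Y_def)
  next
    case (Suc k)
    define W where "W \<omega> = (if k \<le> N t \<omega> then Y k \<omega> else 0)" for \<omega>
    have [measurable]: "W \<in> borel_measurable (G t)" using Suc by (simp add: W_def[abs_def])
    have "(\<lambda>\<omega>. if Suc k \<le> N t \<omega> then W \<omega> + (1 / r) *\<^sub>R b (min (T k \<omega>) t) (W \<omega>) else 0) \<in> borel_measurable (G t)"
      by measurable
    moreover have "(if Suc k \<le> N t \<omega> then Y (Suc k) \<omega> else 0)
        = (if Suc k \<le> N t \<omega> then W \<omega> + (1 / r) *\<^sub>R b (min (T k \<omega>) t) (W \<omega>) else 0)"
      if "\<omega> \<in> space (G t)" for \<omega>
      using that T_le_iff[of \<omega> k t] by (simp add: W_def Y_def G_space min_absorb1)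
    ultimately show ?case by (simp cong: measurable_cong)
  qed
  have "(\<lambda>\<omega>. if N t \<omega> \<le> N t \<omega> then Y (N t \<omega>) \<omega> else 0) \<in> borel_measurable (G t)"
    by (rule measurable_compose_countable[OF *]) measurable
  then show ?thesis by (simp add: XN_def[abs_def])
qed

lemma XN_measurable [measurable]: "XN t \<in> borel_measurable M"
  using XN_adapted by (rule G_measurableD)

lemma XN_left_Pred: "(\<lambda>(u, \<omega>). XN_left u \<omega>) \<in> borel_measurable Pred"
  unfolding XN_left_def by (rule left_limit_Pred) (use XN_adapted in \<open>simp add: XN_def[abs_def]\<close>)

sublocale predictable_integrand M r G N "\<lambda>u \<omega>. b u (XN_left u \<omega>)" B
proof
  have [measurable]: "fst \<in> borel_measurable Pred" by (rule fst_Pred)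
  have [measurable]: "(\<lambda>p. XN_left (fst p) (snd p)) \<in> borel_measurable Pred"
    using XN_left_Pred by (simp add: case_prod_beta')
  show "(\<lambda>(u, \<omega>). b u (XN_left u \<omega>)) \<in> borel_measurable Pred"
    unfolding case_prod_beta' by measurable
qed (rule b_bound)

lemma XN_left_eq: "\<omega> \<in> space M \<Longrightarrow> u \<notin> range (\<lambda>k. T k \<omega>) \<Longrightarrow> XN_left u \<omega> = XN u \<omega>"
  unfolding XN_left_def XN_def N_left_def T_def
  using counting_path.n_eq_n_left[OF path] by (metis (no_types, lifting) rangeE rangeI)

text \<open>The scheme is the sum of initial value, martingale and drift; the left limit at the \<open>k\<close>-th jump time is
  the \<open>k\<close>-th value of the recursion.\<close>

lemma XN_decomposition:
  assumes "\<omega> \<in> space M"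
  shows "XN t \<omega> = X0 \<omega> + Mart t \<omega> + (LINT u:{0<..t}|lborel. b u (XN_left u \<omega>))"
proof -
  have "XN_left (T k \<omega>) \<omega> = Y k \<omega>" for k
    unfolding XN_left_def N_left_def T_def
    by (simp add: counting_path.n_left_jump_time[OF path[OF assms]])
  then show ?thesis
    unfolding XN_def Mart_def by (subst Y_def, subst jump_chain_sum) (simp add: Y_def)
qed

end

section \<open>Strong error\<close>

lemma set_integral_Ioc_Icc:
  fixes f :: "real \<Rightarrow> 'v::euclidean_space"
  assumes "set_integrable lborel {0..t} f"
  shows "(LINT u:{0<..t}|lborel. f u) = (LINT u:{0..t}|lborel. f u)"
proof -
  have ae: "AE u in lborel. u \<noteq> (0::real)" by (rule AE_lborel_singleton)
  have "set_integrable lborel {0<..t} f"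
    by (rule set_integrable_subset[OF assms]) auto
  then show ?thesis
    using assms unfolding set_lebesgue_integral_def set_integrable_def
    by (intro integral_cong_AE) (use ae in \<open>auto elim!: eventually_mono simp: indicator_def\<close>)
qed

context jump_scheme
begin

lemma jump_times_null: "range (\<lambda>k. T k \<omega>) \<in> null_sets lborel"
  by (intro countable_imp_null_set_lborel) auto

lemma XN_left_AE: "\<omega> \<in> space M \<Longrightarrow> AE u in lborel. XN_left u \<omega> = XN u \<omega>"
  using AE_not_in[OF jump_times_null[of \<omega>]] by eventually_elim (rule XN_left_eq)

lemma jump_field_integrable:
  assumes \<omega>: "\<omega> \<in> space M"
  shows "set_integrable lborel {0..t} (\<lambda>u. b u (XN_left u \<omega>))"
  using measurable_Pair1[OF h_jointly \<omega>] by (intro bounded_set_integrable[OF _ b_bound]) simp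

lemma error_decomposition:
  assumes \<omega>: "\<omega> \<in> space M" and x: "ode_solution b (X0 \<omega>) x" and t: "0 \<le> t"
  shows "set_integrable lborel {0..t} (\<lambda>u. b u (XN_left u \<omega>) - b u (x u))"
    and "XN t \<omega> - x t = Mart t \<omega> + (LINT u:{0..t}|lborel. b u (XN_left u \<omega>) - b u (x u))"
proof -
  have 1: "set_integrable lborel {0..t} (\<lambda>u. b u (XN_left u \<omega>))"
    by (rule jump_field_integrable[OF \<omega>])
  have 2: "set_integrable lborel {0..t} (\<lambda>u. b u (x u))" "x t = X0 \<omega> + (LINT u:{0..t}|lborel. b u (x u))"
    using x t by (auto simp: ode_solution_def)
  show "set_integrable lborel {0..t} (\<lambda>u. b u (XN_left u \<omega>) - b u (x u))"
    by (rule set_integral_diff(1)[OF 1 2(1)])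
  show "XN t \<omega> - x t = Mart t \<omega> + (LINT u:{0..t}|lborel. b u (XN_left u \<omega>) - b u (x u))"
    using 1 2 by (simp add: XN_decomposition[OF \<omega>] set_integral_Ioc_Icc)
qed

text \<open>Gronwall's inequality for the single function \<open>t \<mapsto> |X\<^sup>\<epsilon>\<^sub>t - X\<^sub>t|\<close>, where the left limits of the scheme may be
  replaced by its values at almost every time.\<close>

lemma pathwise_error:
  assumes \<omega>: "\<omega> \<in> space M" and x: "ode_solution b (X0 \<omega>) x"
    and a: "\<And>t. 0 \<le> t \<Longrightarrow> t \<le> \<tau> \<Longrightarrow> norm (Mart t \<omega>) \<le> a" and t: "0 \<le> t" "t \<le> \<tau>"
  shows "norm (XN t \<omega> - x t) \<le> a * exp (L * t)"
proof (rule gronwall_family[where \<phi> = "\<lambda>t (_::unit). norm (XN t \<omega> - x t)" and I = UNIV and T = \<tau> and S = "a + 2 * B * \<tau>"])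
  fix t :: real assume t: "0 \<le> t" "t \<le> \<tau>"
  note err = error_decomposition[OF \<omega> x t(1)]
  have split: "norm (XN t \<omega> - x t) \<le> a + norm (LINT u:{0..t}|lborel. b u (XN_left u \<omega>) - b u (x u))"
    unfolding err(2) using a[OF t] by (intro order_trans[OF norm_triangle_ineq]) simp
  have "norm (LINT u:{0..t}|lborel. b u (XN_left u \<omega>) - b u (x u)) \<le> (LINT u:{0..t}|lborel. 2 * B)"
  proof (rule norm_set_integral_le[OF err(1)])
    have "norm (b u (XN_left u \<omega>) - b u (x u)) \<le> 2 * B" for u
      using norm_triangle_ineq4[of "b u (XN_left u \<omega>)" "b u (x u)"] b_bound[of u] by (smt (verit))
    then show "AE u in lborel. u \<in> {0..t} \<longrightarrow> norm (b u (XN_left u \<omega>) - b u (x u)) \<le> 2 * B" by simp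
  qed (use t in \<open>simp add: set_integrable_def\<close>)
  also have "\<dots> = 2 * B * t" using t by (simp add: set_lebesgue_integral_def)
  also have "\<dots> \<le> 2 * B * \<tau>" using t B_nonneg by (intro mult_left_mono) auto
  finally show "norm (XN t \<omega> - x t) \<le> a + 2 * B * \<tau>" using split by simp
  fix \<psi> assume \<psi>: "set_integrable lborel {0..t} \<psi>"
    "\<And>s j. 0 \<le> s \<Longrightarrow> s \<le> t \<Longrightarrow> j \<in> UNIV \<Longrightarrow> norm (XN s \<omega> - x s) \<le> \<psi> s"
  have "norm (LINT u:{0..t}|lborel. b u (XN_left u \<omega>) - b u (x u)) \<le> (LINT u:{0..t}|lborel. L * \<psi> u)"
  proof (rule norm_set_integral_le[OF err(1)])
    show "AE u in lborel. u \<in> {0..t} \<longrightarrow> norm (b u (XN_left u \<omega>) - b u (x u)) \<le> L * \<psi> u"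
      using XN_left_AE[OF \<omega>]
    proof eventually_elim
      case (elim u)
      show ?case
      proof
        assume u: "u \<in> {0..t}"
        have "norm (b u (XN_left u \<omega>) - b u (x u)) \<le> L * norm (XN u \<omega> - x u)"
          using b_lipD elim by metis
        also have "\<dots> \<le> L * \<psi> u" using \<psi>(2)[of u] u L_nonneg by (intro mult_left_mono) auto
        finally show "norm (b u (XN_left u \<omega>) - b u (x u)) \<le> L * \<psi> u" .
      qed
    qed
  qed (intro set_integrable_mult_right \<psi>(1))
  then show "norm (XN t \<omega> - x t) \<le> a + L * (LINT s:{0..t}|lborel. \<psi> s)"
    using split by (simp add: set_integral_mult_right)
qed (use t in auto)

theorem strong_error:
  assumes X: "AE \<omega> in M. ode_solution b (X0 \<omega>) (\<lambda>t. X t \<omega>)" and \<tau>: "0 < \<tau>"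
  shows "(\<integral>\<^sup>+\<omega>. (SUP t\<in>{0..\<tau>}. ennreal ((norm (XN t \<omega> - X t \<omega>))\<^sup>2)) \<partial>M)
    \<le> ennreal (4 * exp (2 * L * \<tau>) * B\<^sup>2 * \<tau> * (1 / r))"
proof -
  obtain S where S_meas [measurable]: "S \<in> borel_measurable M"
    and S_upper: "\<And>\<omega> t. \<omega> \<in> space M \<Longrightarrow> 0 \<le> t \<Longrightarrow> t \<le> \<tau> \<Longrightarrow> ennreal ((norm (Mart t \<omega>))\<^sup>2) \<le> S \<omega>"
    and S_int: "(\<integral>\<^sup>+\<omega>. S \<omega> \<partial>M) \<le> ennreal (4 * (B\<^sup>2 * \<tau> / r))"
    by (rule Mart_maximal[OF \<tau>]) blast
  have "AE \<omega> in M. (SUP t\<in>{0..\<tau>}. ennreal ((norm (XN t \<omega> - X t \<omega>))\<^sup>2)) \<le> ennreal (exp (2 * L * \<tau>)) * S \<omega>"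
    using X AE_space
  proof eventually_elim
    case (elim \<omega>)
    show ?case
    proof (cases "S \<omega> = \<infinity>")
      case True
      then show ?thesis by (simp add: ennreal_mult_top)
    next
      case False
      define a where "a = sqrt (enn2real (S \<omega>))"
      have S: "S \<omega> = ennreal (a\<^sup>2)" using False by (simp add: a_def top.not_eq_extremum)
      have a0: "0 \<le> a" by (simp add: a_def)
      have a: "norm (Mart t \<omega>) \<le> a" if "0 \<le> t" "t \<le> \<tau>" for t
      proof -
        have "ennreal ((norm (Mart t \<omega>))\<^sup>2) \<le> S \<omega>"
          using S_upper[OF elim(2) that] .
        then have "(norm (Mart t \<omega>))\<^sup>2 \<le> a\<^sup>2" by (simp add: S)
        then show ?thesis using a0 by (rule power2_le_imp_le)
      qed
      have "ennreal ((norm (XN t \<omega> - X t \<omega>))\<^sup>2) \<le> ennreal (exp (2 * L * \<tau>)) * S \<omega>" if t: "t \<in> {0..\<tau>}" for t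
      proof -
        have "norm (XN t \<omega> - X t \<omega>) \<le> a * exp (L * t)"
          using pathwise_error[OF elim(2,1) a, of \<tau> t] t by auto
        also have "\<dots> \<le> a * exp (L * \<tau>)"
          using t a0 L_nonneg by (intro mult_left_mono) (auto intro: mult_left_mono)
        finally have "(norm (XN t \<omega> - X t \<omega>))\<^sup>2 \<le> (a * exp (L * \<tau>))\<^sup>2"
          by (intro power_mono) auto
        also have "\<dots> = exp (2 * L * \<tau>) * a\<^sup>2"
          by (simp add: power_mult_distrib exp_double[symmetric] mult_ac)
        finally show ?thesis unfolding S by (simp add: ennreal_mult[symmetric] ennreal_leI)
      qed
      then show ?thesis by (rule SUP_least)
    qed
  qed
  then have "(\<integral>\<^sup>+\<omega>. (SUP t\<in>{0..\<tau>}. ennreal ((norm (XN t \<omega> - X t \<omega>))\<^sup>2)) \<partial>M)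
      \<le> (\<integral>\<^sup>+\<omega>. ennreal (exp (2 * L * \<tau>)) * S \<omega> \<partial>M)"
    by (rule nn_integral_mono_AE)
  also have "\<dots> \<le> ennreal (exp (2 * L * \<tau>)) * ennreal (4 * (B\<^sup>2 * \<tau> / r))"
  proof -
    have "(\<integral>\<^sup>+\<omega>. ennreal (exp (2 * L * \<tau>)) * S \<omega> \<partial>M)
        = ennreal (exp (2 * L * \<tau>)) * (\<integral>\<^sup>+\<omega>. S \<omega> \<partial>M)"
      by (rule nn_integral_cmult) measurable
    also have "\<dots> \<le> ennreal (exp (2 * L * \<tau>)) * ennreal (4 * (B\<^sup>2 * \<tau> / r))"
      using S_int by (intro mult_left_mono) auto
    finally show ?thesis .
  qed
  also have "\<dots> = ennreal (4 * exp (2 * L * \<tau>) * B\<^sup>2 * \<tau> * (1 / r))"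
    using \<tau> r_pos by (simp add: ennreal_mult[symmetric] mult_ac)
  finally show ?thesis .
qed

end

section \<open>Weak error\<close>

locale smooth_jump_scheme = jump_scheme M r G N b B L X0
  for M :: "'a measure" and r G N and b :: "real \<Rightarrow> 'v::euclidean_space \<Rightarrow> 'v" and B L X0 +
  fixes H :: real and X :: "real \<Rightarrow> 'a \<Rightarrow> 'v"
  assumes b_diff: "b t differentiable (at x)"
    and b_hess: "H-lipschitz_on UNIV (gradient_map (b t))"
    and X_solution: "AE \<omega> in M. ode_solution b (X0 \<omega>) (\<lambda>t. X t \<omega>)"
begin

text \<open>The solution as a function of the initial value. It is known at time \<open>0\<close>, whereas \<open>X\<close> itself is
  measurable with respect to the ambient field only.\<close>

definition Xf :: "real \<Rightarrow> 'a \<Rightarrow> 'v" where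
  "Xf t \<omega> = flow t (X0 \<omega>)"

lemma Xf_adapted: "Xf t \<in> borel_measurable (G s)"
proof -
  have [measurable]: "X0 \<in> borel_measurable (G s)" by (rule X0_adapted)
  show ?thesis unfolding Xf_def by measurable
qed

lemma Xf_measurable [measurable]: "Xf t \<in> borel_measurable M"
  using Xf_adapted by (rule G_measurableD)

lemma Xf_jointly: "(\<lambda>(t, \<omega>). Xf t \<omega>) \<in> borel_measurable (borel \<Otimes>\<^sub>M M)"
proof -
  have [measurable]: "X0 \<in> borel_measurable M" using X0_adapted by (rule G_measurableD)
  show ?thesis unfolding Xf_def by measurable
qed

lemma Xf_eq_X: "AE \<omega> in M. \<forall>t\<ge>0. Xf t \<omega> = X t \<omega>"
  using X_solution by eventually_elim (auto simp: Xf_def flow_eq_solution)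

lemma Xf_solution: "AE \<omega> in M. ode_solution b (X0 \<omega>) (\<lambda>t. Xf t \<omega>)"
  using X_solution Xf_eq_X
proof eventually_elim
  case (elim \<omega>)
  have "set_integrable lborel {0..t} (\<lambda>s. b s (Xf s \<omega>)) = set_integrable lborel {0..t} (\<lambda>s. b s (X s \<omega>))"
    and "(LINT s:{0..t}|lborel. b s (Xf s \<omega>)) = (LINT s:{0..t}|lborel. b s (X s \<omega>))" for t
    unfolding set_integrable_def set_lebesgue_integral_def using elim(2)
    by (auto intro!: Bochner_Integration.integrable_cong Bochner_Integration.integral_cong simp: indicator_def)
  then show ?case using elim unfolding ode_solution_def by simp
qed

definition Z :: "real \<Rightarrow> 'a \<Rightarrow> 'v" where
  "Z t \<omega> = XN t \<omega> - Xf t \<omega>"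

lemma Z_measurable [measurable]: "Z t \<in> borel_measurable M"
  unfolding Z_def by measurable

definition V :: "real \<Rightarrow> real" where
  "V \<tau> = 4 * exp (2 * L * \<tau>) * B\<^sup>2 * \<tau> * (1 / r)"

lemma V_nonneg: "0 \<le> \<tau> \<Longrightarrow> 0 \<le> V \<tau>"
  using r_pos by (simp add: V_def)

lemma Z_square:
  assumes t: "0 \<le> t" "t \<le> \<tau>" and \<tau>: "0 < \<tau>"
  shows "integrable M (\<lambda>\<omega>. (norm (Z t \<omega>))\<^sup>2)" and "(\<integral>\<omega>. (norm (Z t \<omega>))\<^sup>2 \<partial>M) \<le> V \<tau>"
proof -
  have "(\<integral>\<^sup>+\<omega>. ennreal ((norm (Z t \<omega>))\<^sup>2) \<partial>M)
      \<le> (\<integral>\<^sup>+\<omega>. (SUP t\<in>{0..\<tau>}. ennreal ((norm (XN t \<omega> - Xf t \<omega>))\<^sup>2)) \<partial>M)"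
    unfolding Z_def by (intro nn_integral_mono SUP_upper) (use t in auto)
  also have "\<dots> \<le> ennreal (V \<tau>)"
    using strong_error[OF Xf_solution \<tau>] by (simp add: V_def)
  finally have le: "(\<integral>\<^sup>+\<omega>. ennreal ((norm (Z t \<omega>))\<^sup>2) \<partial>M) \<le> ennreal (V \<tau>)" .
  show int: "integrable M (\<lambda>\<omega>. (norm (Z t \<omega>))\<^sup>2)"
    using le by (intro integrableI_bounded) (auto intro: le_less_trans)
  show "(\<integral>\<omega>. (norm (Z t \<omega>))\<^sup>2 \<partial>M) \<le> V \<tau>"
    using le V_nonneg[of \<tau>] \<tau> by (subst (asm) nn_integral_eq_integral[OF int]) auto
qed

lemma Z_integrable:
  assumes "0 \<le> t"
  shows "integrable M (\<lambda>\<omega>. norm (Z t \<omega>))"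
proof (rule Bochner_Integration.integrable_bound)
  show "integrable M (\<lambda>\<omega>. 1 + (norm (Z t \<omega>))\<^sup>2)"
    using Z_square(1)[OF assms order.strict_implies_order[OF less_add_one]] assms by auto
  show "AE \<omega> in M. norm (norm (Z t \<omega>)) \<le> norm (1 + (norm (Z t \<omega>))\<^sup>2)"
    using norm_le_1_plus_square by (intro AE_I2) (simp add: abs_of_nonneg add_nonneg_nonneg)
qed measurable

lemma pairing_integrable:
  assumes "0 \<le> t" and \<xi>: "\<xi> \<in> borel_measurable M" "\<And>\<omega>. \<omega> \<in> space M \<Longrightarrow> norm (\<xi> \<omega>) \<le> c"
  shows "integrable M (\<lambda>\<omega>. \<xi> \<omega> \<bullet> Z t \<omega>)"
proof (rule Bochner_Integration.integrable_bound)
  show "integrable M (\<lambda>\<omega>. c * norm (Z t \<omega>))" using Z_integrable[OF assms(1)] by simp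
  show "AE \<omega> in M. norm (\<xi> \<omega> \<bullet> Z t \<omega>) \<le> norm (c * norm (Z t \<omega>))"
  proof (rule AE_I2)
    fix \<omega> assume "\<omega> \<in> space M"
    have "norm (\<xi> \<omega> \<bullet> Z t \<omega>) \<le> norm (\<xi> \<omega>) * norm (Z t \<omega>)" by (simp add: Cauchy_Schwarz_ineq2)
    also have "\<dots> \<le> c * norm (Z t \<omega>)" using \<xi>(2)[OF \<open>\<omega> \<in> space M\<close>] by (intro mult_right_mono) auto
    finally show "norm (\<xi> \<omega> \<bullet> Z t \<omega>) \<le> norm (c * norm (Z t \<omega>))" by simp
  qed
qed (use \<xi>(1) in measurable)

text \<open>The index set of the Gronwall argument: the unit ball of bounded vector fields known at time \<open>0\<close>.\<close>

definition test_fields :: "('a \<Rightarrow> 'v) set" where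
  "test_fields = {\<xi>. \<xi> \<in> borel_measurable (G 0) \<and> (\<forall>\<omega>\<in>space M. norm (\<xi> \<omega>) \<le> 1)}"

lemma gradient_map_b_measurable:
  "(\<lambda>x. blinfun_apply (gradient_map (b s) x) e) \<in> borel_measurable borel"
  by (intro borel_measurable_continuous_onI continuous_intros lipschitz_on_continuous_on[OF b_hess])

text \<open>The gradient of the field is moved onto the test field: \<open>\<eta> = \<nabla>b(s, X\<^sub>s)\<^sup>T \<xi>\<close> is \<open>L\<close> times a test field, and the Taylor
  remainder is controlled by the strong error.\<close>

lemma linearised_drift:
  assumes s: "0 \<le> s" "s \<le> \<tau>" and \<tau>: "0 < \<tau>" and \<xi>: "\<xi> \<in> test_fields"
    and \<psi>: "\<And>\<eta>. \<eta> \<in> test_fields \<Longrightarrow> (\<integral>\<omega>. \<eta> \<omega> \<bullet> Z s \<omega> \<partial>M) \<le> c"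
  shows "(\<integral>\<omega>. \<xi> \<omega> \<bullet> (b s (XN s \<omega>) - b s (Xf s \<omega>)) \<partial>M) \<le> L * c + H * V \<tau>"
proof -
  have \<xi>_G [measurable]: "\<xi> \<in> borel_measurable (G 0)" and \<xi>_1: "\<And>\<omega>. \<omega> \<in> space M \<Longrightarrow> norm (\<xi> \<omega>) \<le> 1"
    using \<xi> by (auto simp: test_fields_def)
  have \<xi>_M [measurable]: "\<xi> \<in> borel_measurable M" using \<xi>_G by (rule G_measurableD)
  have H0: "0 \<le> H" using b_hess by (rule lipschitz_on_nonneg)
  let ?D = "\<lambda>\<omega>. blinfun_apply (gradient_map (b s) (Xf s \<omega>))"
  define \<eta> where "\<eta> \<omega> = riesz_vector (\<lambda>z. \<xi> \<omega> \<bullet> ?D \<omega> z)" for \<omega>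
  have lin: "bounded_linear (\<lambda>z. \<xi> \<omega> \<bullet> ?D \<omega> z)" for \<omega>
    by (intro bounded_linear_compose[OF bounded_linear_inner_right blinfun.bounded_linear_right])
  have \<eta>_inner: "\<eta> \<omega> \<bullet> z = \<xi> \<omega> \<bullet> ?D \<omega> z" for \<omega> z
    unfolding \<eta>_def by (rule inner_riesz_vector[OF lin])
  have \<eta>_bound: "norm (\<eta> \<omega>) \<le> L" if "\<omega> \<in> space M" for \<omega>
    unfolding \<eta>_def
  proof (rule norm_riesz_vector_le[OF lin L_nonneg])
    fix z
    have "\<bar>\<xi> \<omega> \<bullet> ?D \<omega> z\<bar> \<le> norm (\<xi> \<omega>) * norm (?D \<omega> z)" by (rule Cauchy_Schwarz_ineq2)
    also have "\<dots> \<le> 1 * (L * norm z)"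
      using \<xi>_1[OF that] gradient_map_bound[OF b_diff b_lip, of s "Xf s \<omega>"] L_nonneg
      by (intro mult_mono order_trans[OF norm_blinfun mult_right_mono]) auto
    finally show "\<bar>\<xi> \<omega> \<bullet> ?D \<omega> z\<bar> \<le> L * norm z" by simp
  qed
  have [measurable]: "Xf s \<in> borel_measurable (G 0)" by (rule Xf_adapted)
  have [measurable]: "(\<lambda>\<omega>. ?D \<omega> e) \<in> borel_measurable (G 0)" for e
    by (rule measurable_compose[OF _ gradient_map_b_measurable]) measurable
  have \<eta>_meas [measurable]: "\<eta> \<in> borel_measurable (G 0)" unfolding \<eta>_def riesz_vector_def by measurable
  have "(\<lambda>\<omega>. (1 / L) *\<^sub>R \<eta> \<omega>) \<in> test_fields"
    using \<eta>_bound L_nonneg unfolding test_fields_def by (auto simp: divide_le_eq)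
  note le = \<psi>[OF this]
  \<comment> \<open>If \<open>L = 0\<close> then \<open>\<eta> = 0\<close>, and \<open>1 / L = 0\<close> agrees with this.\<close>
  have L_\<eta>: "L *\<^sub>R ((1 / L) *\<^sub>R \<eta> \<omega>) = \<eta> \<omega>" if "\<omega> \<in> space M" for \<omega>
    using \<eta>_bound[OF that] by (cases "L = 0") auto
  have \<eta>_Z: "(\<integral>\<omega>. \<eta> \<omega> \<bullet> Z s \<omega> \<partial>M) \<le> L * c"
  proof -
    have "(\<integral>\<omega>. \<eta> \<omega> \<bullet> Z s \<omega> \<partial>M) = (\<integral>\<omega>. L * (((1 / L) *\<^sub>R \<eta> \<omega>) \<bullet> Z s \<omega>) \<partial>M)"
      by (intro Bochner_Integration.integral_cong refl) (metis L_\<eta> inner_scaleR_left)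
    also have "\<dots> = L * (\<integral>\<omega>. ((1 / L) *\<^sub>R \<eta> \<omega>) \<bullet> Z s \<omega> \<partial>M)"
      by (rule integral_mult_right_zero)
    also have "\<dots> \<le> L * c" using le L_nonneg by (rule mult_left_mono)
    finally show ?thesis .
  qed
  have b_diff_bound: "norm (b s (XN s \<omega>) - b s (Xf s \<omega>)) \<le> 2 * B" for \<omega>
    using norm_triangle_ineq4[of "b s (XN s \<omega>)" "b s (Xf s \<omega>)"] b_bound[of s] by (smt (verit))
  have int: "integrable M (\<lambda>\<omega>. \<xi> \<omega> \<bullet> (b s (XN s \<omega>) - b s (Xf s \<omega>)))"
  proof (rule integrable_const_bound[where B = "2 * B"])
    show "AE \<omega> in M. norm (\<xi> \<omega> \<bullet> (b s (XN s \<omega>) - b s (Xf s \<omega>))) \<le> 2 * B"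
    proof (rule AE_I2)
      fix \<omega> assume "\<omega> \<in> space M"
      have "norm (\<xi> \<omega> \<bullet> (b s (XN s \<omega>) - b s (Xf s \<omega>))) \<le> norm (\<xi> \<omega>) * norm (b s (XN s \<omega>) - b s (Xf s \<omega>))"
        by (simp add: Cauchy_Schwarz_ineq2)
      also have "\<dots> \<le> 1 * (2 * B)" using \<xi>_1[OF \<open>\<omega> \<in> space M\<close>] b_diff_bound by (intro mult_mono) auto
      finally show "norm (\<xi> \<omega> \<bullet> (b s (XN s \<omega>) - b s (Xf s \<omega>))) \<le> 2 * B" by simp
    qed
  qed measurable
  have \<eta>_int: "integrable M (\<lambda>\<omega>. \<eta> \<omega> \<bullet> Z s \<omega>)"
    by (rule pairing_integrable[OF s(1) G_measurableD[OF \<eta>_meas] \<eta>_bound])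
  have point: "\<xi> \<omega> \<bullet> (b s (XN s \<omega>) - b s (Xf s \<omega>)) \<le> \<eta> \<omega> \<bullet> Z s \<omega> + H * (norm (Z s \<omega>))\<^sup>2"
    if "\<omega> \<in> space M" for \<omega>
  proof -
    let ?R = "b s (XN s \<omega>) - b s (Xf s \<omega>) - ?D \<omega> (Z s \<omega>)"
    have R: "norm ?R \<le> H * (norm (Z s \<omega>))\<^sup>2"
      using taylor_lipschitz_gradient[OF b_diff b_hess, of s "XN s \<omega>" "Xf s \<omega>"] by (simp add: Z_def)
    have "\<xi> \<omega> \<bullet> ?R \<le> norm (\<xi> \<omega>) * norm ?R" by (rule norm_cauchy_schwarz)
    also have "\<dots> \<le> 1 * (H * (norm (Z s \<omega>))\<^sup>2)" using R \<xi>_1[OF that] by (intro mult_mono) auto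
    finally show ?thesis by (simp add: \<eta>_inner inner_diff_right)
  qed
  have "(\<integral>\<omega>. \<xi> \<omega> \<bullet> (b s (XN s \<omega>) - b s (Xf s \<omega>)) \<partial>M)
      \<le> (\<integral>\<omega>. \<eta> \<omega> \<bullet> Z s \<omega> + H * (norm (Z s \<omega>))\<^sup>2 \<partial>M)"
    using \<eta>_int Z_square(1)[OF s \<tau>] by (intro integral_mono[OF int _ point]) auto
  also have "\<dots> = (\<integral>\<omega>. \<eta> \<omega> \<bullet> Z s \<omega> \<partial>M) + H * (\<integral>\<omega>. (norm (Z s \<omega>))\<^sup>2 \<partial>M)"
    using \<eta>_int Z_square(1)[OF s \<tau>] by simp
  also have "\<dots> \<le> L * c + H * V \<tau>"
    using \<eta>_Z Z_square(2)[OF s \<tau>] H0 by (intro add_mono mult_left_mono)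
  finally show ?thesis .
qed

text \<open>Pairing with a test field eliminates the martingale. After exchanging expectation and time integral,
  the drift at a fixed time \<open>s\<close> is linearised; there the left limit of the scheme equals its value
  because almost surely no jump occurs at \<open>s\<close>.\<close>

theorem pairing_bound:
  assumes t: "0 \<le> t" "t \<le> \<tau>" and \<tau>: "0 < \<tau>" and \<xi>: "\<xi> \<in> test_fields"
  shows "(\<integral>\<omega>. \<xi> \<omega> \<bullet> Z t \<omega> \<partial>M) \<le> H * V \<tau> * \<tau> * exp (L * t)"
proof (rule gronwall_family[where \<phi> = "\<lambda>t \<xi>. \<integral>\<omega>. \<xi> \<omega> \<bullet> Z t \<omega> \<partial>M" and I = test_fields and T = \<tau> and S = "1 + V \<tau>"])
  fix t \<xi> assume t: "0 \<le> t" "t \<le> \<tau>" and \<xi>: "\<xi> \<in> test_fields"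
  have \<xi>_G: "\<xi> \<in> borel_measurable (G 0)" and \<xi>_1: "\<And>\<omega>. \<omega> \<in> space M \<Longrightarrow> norm (\<xi> \<omega>) \<le> 1"
    using \<xi> by (auto simp: test_fields_def)
  have \<xi>_M [measurable]: "\<xi> \<in> borel_measurable M" using \<xi>_G by (rule G_measurableD)
  have \<xi>Z: "integrable M (\<lambda>\<omega>. \<xi> \<omega> \<bullet> Z t \<omega>)" by (rule pairing_integrable[OF t(1) \<xi>_M \<xi>_1])
  have "(\<integral>\<omega>. \<xi> \<omega> \<bullet> Z t \<omega> \<partial>M) \<le> (\<integral>\<omega>. 1 + (norm (Z t \<omega>))\<^sup>2 \<partial>M)"
  proof (rule integral_mono[OF \<xi>Z])
    show "\<xi> \<omega> \<bullet> Z t \<omega> \<le> 1 + (norm (Z t \<omega>))\<^sup>2" if "\<omega> \<in> space M" for \<omega>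
      using norm_cauchy_schwarz[of "\<xi> \<omega>" "Z t \<omega>"] mult_right_mono[OF \<xi>_1[OF that], of "norm (Z t \<omega>)"]
        norm_le_1_plus_square[of "Z t \<omega>"] by simp
  qed (use Z_square(1)[OF t \<tau>] in auto)
  also have "\<dots> \<le> 1 + V \<tau>"
    using Z_square[OF t \<tau>] by (simp add: prob_space)
  finally show "(\<integral>\<omega>. \<xi> \<omega> \<bullet> Z t \<omega> \<partial>M) \<le> 1 + V \<tau>" .
  fix \<psi> assume \<psi>: "set_integrable lborel {0..t} \<psi>"
    "\<And>s \<eta>. 0 \<le> s \<Longrightarrow> s \<le> t \<Longrightarrow> \<eta> \<in> test_fields \<Longrightarrow> (\<integral>\<omega>. \<eta> \<omega> \<bullet> Z s \<omega> \<partial>M) \<le> \<psi> s"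
  define d where "d s \<omega> = \<xi> \<omega> \<bullet> (b s (XN_left s \<omega>) - b s (Xf s \<omega>))" for s \<omega>
  interpret LM: pair_sigma_finite lborel M ..
  have [measurable]: "(\<lambda>p. XN_left (fst p) (snd p)) \<in> borel_measurable (lborel \<Otimes>\<^sub>M M)"
    using Pred_imp_jointly[OF XN_left_Pred] by (simp add: case_prod_beta' cong: measurable_cong_sets)
  have [measurable]: "(\<lambda>p. Xf (fst p) (snd p)) \<in> borel_measurable (lborel \<Otimes>\<^sub>M M)"
    using Xf_jointly by (simp add: case_prod_beta' cong: measurable_cong_sets)
  have d_bound: "\<bar>d s \<omega>\<bar> \<le> 2 * B" if "\<omega> \<in> space M" for s \<omega>
  proof -
    have "norm (b s (XN_left s \<omega>) - b s (Xf s \<omega>)) \<le> 2 * B"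
      using norm_triangle_ineq4[of "b s (XN_left s \<omega>)" "b s (Xf s \<omega>)"] b_bound[of s] by (smt (verit))
    then have "norm (\<xi> \<omega>) * norm (b s (XN_left s \<omega>) - b s (Xf s \<omega>)) \<le> 1 * (2 * B)"
      using \<xi>_1[OF that] by (intro mult_mono) auto
    then show ?thesis unfolding d_def using Cauchy_Schwarz_ineq2 order_trans by fastforce
  qed
  have d_meas: "(\<lambda>(s, \<omega>). indicator {0..t} s * d s \<omega>) \<in> borel_measurable (lborel \<Otimes>\<^sub>M M)"
    unfolding d_def case_prod_beta' by measurable
  have d_int: "integrable (lborel \<Otimes>\<^sub>M M) (\<lambda>(s, \<omega>). indicator {0..t} s * d s \<omega>)"
  proof (rule integrableI_bounded_set[where A = "{0..t} \<times> space M" and B = "2 * B"])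
    show "emeasure (lborel \<Otimes>\<^sub>M M) ({0..t} \<times> space M) < \<infinity>"
      using t by (subst emeasure_pair_measure_Times) (auto simp: emeasure_space_1)
    show "AE p in lborel \<Otimes>\<^sub>M M. p \<in> {0..t} \<times> space M \<longrightarrow> norm (case p of (s, \<omega>) \<Rightarrow> indicator {0..t} s * d s \<omega>) \<le> 2 * B"
      using d_bound by (auto simp: indicator_def intro!: AE_I2)
    show "AE p in lborel \<Otimes>\<^sub>M M. p \<notin> {0..t} \<times> space M \<longrightarrow> (case p of (s, \<omega>) \<Rightarrow> indicator {0..t} s * d s \<omega>) = 0"
      by (auto simp: indicator_def space_pair_measure intro!: AE_I2)
  qed (use d_meas in auto)
  have fubini: "(\<integral>\<omega>. (\<integral>s. indicator {0..t} s * d s \<omega> \<partial>lborel) \<partial>M) = (\<integral>s. (\<integral>\<omega>. indicator {0..t} s * d s \<omega> \<partial>M) \<partial>lborel)"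
    using LM.integral_fst[OF d_int] LM.integral_snd[OF d_int] by simp
  have Mart0: "integrable M (\<lambda>\<omega>. \<xi> \<omega> \<bullet> Mart t \<omega>)" "(\<integral>\<omega>. \<xi> \<omega> \<bullet> Mart t \<omega> \<partial>M) = 0"
  proof -
    have "integrable M \<xi>" using \<xi>_1 by (intro integrable_const_bound[where B = 1]) auto
    note orth = Mart_orthogonal[OF order_refl t(1) \<xi>_G this]
    have eq: "\<xi> \<omega> \<bullet> Mart t \<omega> = \<xi> \<omega> \<bullet> (Mart t \<omega> - Mart 0 \<omega>)" if "\<omega> \<in> space M" for \<omega>
      using Mart_0[OF that] by simp
    show "integrable M (\<lambda>\<omega>. \<xi> \<omega> \<bullet> Mart t \<omega>)"
      using orth(1) by (subst Bochner_Integration.integrable_cong[OF refl eq])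
    show "(\<integral>\<omega>. \<xi> \<omega> \<bullet> Mart t \<omega> \<partial>M) = 0"
      using orth(2) by (subst Bochner_Integration.integral_cong[OF refl eq])
  qed
  have "(\<integral>\<omega>. \<xi> \<omega> \<bullet> Z t \<omega> \<partial>M) = (\<integral>\<omega>. \<xi> \<omega> \<bullet> Mart t \<omega> + (\<integral>s. indicator {0..t} s * d s \<omega> \<partial>lborel) \<partial>M)"
  proof (rule integral_cong_AE)
    show "AE \<omega> in M. \<xi> \<omega> \<bullet> Z t \<omega> = \<xi> \<omega> \<bullet> Mart t \<omega> + (\<integral>s. indicator {0..t} s * d s \<omega> \<partial>lborel)"
      using Xf_solution AE_space
    proof eventually_elim
      case (elim \<omega>)
      note err = error_decomposition[OF elim(2,1) t(1)]
      have "\<xi> \<omega> \<bullet> (LINT u:{0..t}|lborel. b u (XN_left u \<omega>) - b u (Xf u \<omega>)) = (\<integral>s. indicator {0..t} s * d s \<omega> \<partial>lborel)"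
        using err(1) unfolding set_lebesgue_integral_def set_integrable_def d_def
        by (subst integral_inner_right[symmetric]) auto
      then show ?case unfolding Z_def err(2) by (simp add: inner_add_right)
    qed
    show "(\<lambda>\<omega>. \<xi> \<omega> \<bullet> Mart t \<omega> + (\<integral>s. indicator {0..t} s * d s \<omega> \<partial>lborel)) \<in> borel_measurable M"
      using Mart0(1) LM.integrable_snd[OF d_int] by (auto intro!: borel_measurable_add)
  qed measurable
  also have "\<dots> = (\<integral>s. (\<integral>\<omega>. indicator {0..t} s * d s \<omega> \<partial>M) \<partial>lborel)"
    using Mart0 LM.integrable_snd[OF d_int] fubini by (subst Bochner_Integration.integral_add) auto
  also have "\<dots> \<le> (\<integral>s. indicator {0..t} s *\<^sub>R (L * \<psi> s + H * V \<tau>) \<partial>lborel)"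
  proof (rule integral_mono)
    show "integrable lborel (\<lambda>s. \<integral>\<omega>. indicator {0..t} s * d s \<omega> \<partial>M)"
      using LM.integrable_fst[OF d_int] by simp
    have "set_integrable lborel {0..t} (\<lambda>s. L * \<psi> s + H * V \<tau>)"
      using \<psi>(1) t by (intro set_integral_add set_integrable_mult_right) (auto simp: set_integrable_def)
    then show "integrable lborel (\<lambda>s. indicator {0..t} s *\<^sub>R (L * \<psi> s + H * V \<tau>))"
      by (simp add: set_integrable_def)
    fix s
    show "(\<integral>\<omega>. indicator {0..t} s * d s \<omega> \<partial>M) \<le> indicator {0..t} s *\<^sub>R (L * \<psi> s + H * V \<tau>)"
    proof (cases "s \<in> {0..t}")
      case True
      have "AE \<omega> in M. \<forall>k. T k \<omega> \<notin> {s}" by (rule jumps_avoid_null_set) auto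
      then have "AE \<omega> in M. d s \<omega> = \<xi> \<omega> \<bullet> (b s (XN s \<omega>) - b s (Xf s \<omega>))"
        using AE_space
      proof eventually_elim
        case (elim \<omega>)
        then have "s \<notin> range (\<lambda>k. T k \<omega>)" by auto
        then show ?case using XN_left_eq[OF elim(2)] by (simp add: d_def)
      qed
      then have "(\<integral>\<omega>. d s \<omega> \<partial>M) = (\<integral>\<omega>. \<xi> \<omega> \<bullet> (b s (XN s \<omega>) - b s (Xf s \<omega>)) \<partial>M)"
      proof (rule integral_cong_AE[rotated 2])
        have [measurable]: "(\<lambda>\<omega>. XN_left s \<omega>) \<in> borel_measurable M"
          using measurable_Pair2[OF Pred_imp_jointly[OF XN_left_Pred], of s] by simp
        show "d s \<in> borel_measurable M" unfolding d_def by measurable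
      qed measurable
      also have "\<dots> \<le> L * \<psi> s + H * V \<tau>"
        using True t \<psi>(2)[of s] by (intro linearised_drift \<xi> \<tau>) auto
      finally show ?thesis using True by simp
    qed simp
  qed
  also have "\<dots> = (LINT s:{0..t}|lborel. L * \<psi> s + H * V \<tau>)"
    by (simp add: set_lebesgue_integral_def)
  also have "\<dots> = L * (LINT s:{0..t}|lborel. \<psi> s) + H * V \<tau> * t"
  proof -
    have "set_integrable lborel {0..t} (\<lambda>s. L * \<psi> s)" by (intro set_integrable_mult_right \<psi>(1))
    moreover have "set_integrable lborel {0..t} (\<lambda>s. H * V \<tau>)" using t by (simp add: set_integrable_def)
    ultimately have "(LINT s:{0..t}|lborel. L * \<psi> s + H * V \<tau>)
        = (LINT s:{0..t}|lborel. L * \<psi> s) + (LINT s:{0..t}|lborel. H * V \<tau>)"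
      by (rule set_integral_add(2))
    also have "(LINT s:{0..t}|lborel. H * V \<tau>) = H * V \<tau> * t"
      using t by (simp add: set_lebesgue_integral_def)
    finally show ?thesis by (simp only: set_integral_mult_right)
  qed
  also have "\<dots> \<le> H * V \<tau> * \<tau> + L * (LINT s:{0..t}|lborel. \<psi> s)"
    using t V_nonneg[of \<tau>] \<tau> lipschitz_on_nonneg[OF b_hess] by (simp add: mult_left_mono)
  finally show "(\<integral>\<omega>. \<xi> \<omega> \<bullet> Z t \<omega> \<partial>M) \<le> H * V \<tau> * \<tau> + L * (LINT s:{0..t}|lborel. \<psi> s)" .
qed (use t \<xi> in auto)

end

context smooth_jump_scheme
begin

text \<open>Test fields may be multiplied by constants of either sign.\<close>

lemma pairing_bound_scaled:
  assumes t: "0 \<le> t" "t \<le> \<tau>" and \<tau>: "0 < \<tau>" and \<xi>: "\<xi> \<in> borel_measurable (G 0)"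
    and c: "\<And>\<omega>. \<omega> \<in> space M \<Longrightarrow> norm (\<xi> \<omega>) \<le> c"
  shows "\<bar>\<integral>\<omega>. \<xi> \<omega> \<bullet> Z t \<omega> \<partial>M\<bar> \<le> c * (H * V \<tau> * \<tau> * exp (L * \<tau>))"
proof -
  obtain \<omega>0 where "\<omega>0 \<in> space M" using not_empty by blast
  then have c0: "0 \<le> c" using c[of \<omega>0] by (meson norm_ge_zero order_trans)
  have le: "a * (\<integral>\<omega>. \<xi> \<omega> \<bullet> Z t \<omega> \<partial>M) \<le> c * (H * V \<tau> * \<tau> * exp (L * \<tau>))" if a: "\<bar>a\<bar> = 1" for a :: real
  proof -
    have "(\<lambda>\<omega>. (a / c) *\<^sub>R \<xi> \<omega>) \<in> test_fields"
      unfolding test_fields_def using c a c0 \<xi> by (auto simp: divide_le_eq intro!: borel_measurable_scaleR)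
    from pairing_bound[OF t \<tau> this]
    have "(\<integral>\<omega>. ((a / c) *\<^sub>R \<xi> \<omega>) \<bullet> Z t \<omega> \<partial>M) \<le> H * V \<tau> * \<tau> * exp (L * t)" .
    also have "\<dots> \<le> H * V \<tau> * \<tau> * exp (L * \<tau>)"
      using t \<tau> V_nonneg[of \<tau>] lipschitz_on_nonneg[OF b_hess] L_nonneg
      by (intro mult_left_mono) (auto intro: mult_left_mono)
    finally have "c * (\<integral>\<omega>. ((a / c) *\<^sub>R \<xi> \<omega>) \<bullet> Z t \<omega> \<partial>M) \<le> c * (H * V \<tau> * \<tau> * exp (L * \<tau>))"
      using c0 by (rule mult_left_mono)
    moreover have "a * (\<integral>\<omega>. \<xi> \<omega> \<bullet> Z t \<omega> \<partial>M) = c * (\<integral>\<omega>. ((a / c) *\<^sub>R \<xi> \<omega>) \<bullet> Z t \<omega> \<partial>M)"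
    proof (cases "c = 0")
      case True
      then have "\<xi> \<omega> = 0" if "\<omega> \<in> space M" for \<omega> using c[OF that] by simp
      then have "(\<integral>\<omega>. \<xi> \<omega> \<bullet> Z t \<omega> \<partial>M) = (\<integral>\<omega>. 0 \<partial>M)"
        by (intro Bochner_Integration.integral_cong) auto
      then show ?thesis using True by simp
    qed simp
    ultimately show ?thesis by (simp only:)
  qed
  show ?thesis using le[of 1] le[of "-1"] by (intro abs_leI) (simp_all only: abs_one abs_minus_cancel mult_1 mult_minus1)
qed

text \<open>Taylor expansion of \<open>f\<close> at the solution: the linear term is a pairing, with the gradient of \<open>f\<close> as test
  field, and the remainder is controlled by the strong error.\<close>

theorem weak_error:
  fixes f :: "'v \<Rightarrow> real"
  assumes f_diff: "\<And>x. f differentiable (at x)" and f_lip: "F1-lipschitz_on UNIV f"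
    and f_hess: "F2-lipschitz_on UNIV (gradient_map f)"
    and t: "0 \<le> t" "t \<le> \<tau>" and \<tau>: "0 < \<tau>"
  shows "integrable M (\<lambda>\<omega>. f (XN t \<omega>) - f (Xf t \<omega>))"
    and "\<bar>\<integral>\<omega>. f (XN t \<omega>) - f (Xf t \<omega>) \<partial>M\<bar> \<le> F1 * (H * V \<tau> * \<tau> * exp (L * \<tau>)) + F2 * V \<tau>"
proof -
  have [measurable]: "f \<in> borel_measurable borel"
    using lipschitz_on_continuous_on[OF f_lip] by (rule borel_measurable_continuous_onI)
  have F2: "0 \<le> F2" using f_hess by (rule lipschitz_on_nonneg)
  have F1: "0 \<le> F1" using f_lip by (rule lipschitz_on_nonneg)
  show int: "integrable M (\<lambda>\<omega>. f (XN t \<omega>) - f (Xf t \<omega>))"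
  proof (rule Bochner_Integration.integrable_bound)
    show "integrable M (\<lambda>\<omega>. F1 * norm (Z t \<omega>))" using Z_integrable[OF t(1)] by simp
    show "AE \<omega> in M. norm (f (XN t \<omega>) - f (Xf t \<omega>)) \<le> norm (F1 * norm (Z t \<omega>))"
      using lipschitz_onD[OF f_lip] F1 by (intro AE_I2) (simp add: Z_def dist_norm abs_mult)
  qed measurable
  let ?D = "\<lambda>\<omega>. blinfun_apply (gradient_map f (Xf t \<omega>))"
  define \<xi> where "\<xi> \<omega> = riesz_vector (?D \<omega>)" for \<omega>
  have \<xi>_inner: "\<xi> \<omega> \<bullet> z = ?D \<omega> z" for \<omega> z
    unfolding \<xi>_def by (rule inner_riesz_vector[OF blinfun.bounded_linear_right])
  have \<xi>_bound: "norm (\<xi> \<omega>) \<le> F1" for \<omega>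
    unfolding \<xi>_def
  proof (rule norm_riesz_vector_le[OF blinfun.bounded_linear_right F1])
    show "\<bar>?D \<omega> z\<bar> \<le> F1 * norm z" for z
      using norm_blinfun[of "gradient_map f (Xf t \<omega>)" z] gradient_map_bound[OF f_diff f_lip, of "Xf t \<omega>"]
      by (simp add: mult_right_mono order_trans)
  qed
  have [measurable]: "(\<lambda>\<omega>. ?D \<omega> e) \<in> borel_measurable (G 0)" for e
  proof (rule measurable_compose[OF Xf_adapted])
    show "(\<lambda>x. blinfun_apply (gradient_map f x) e) \<in> borel_measurable borel"
      by (intro borel_measurable_continuous_onI continuous_intros lipschitz_on_continuous_on[OF f_hess])
  qed
  have \<xi>_meas: "\<xi> \<in> borel_measurable (G 0)" unfolding \<xi>_def riesz_vector_def by measurable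
  have \<xi>Z: "integrable M (\<lambda>\<omega>. \<xi> \<omega> \<bullet> Z t \<omega>)"
    by (rule pairing_integrable[OF t(1) G_measurableD[OF \<xi>_meas] \<xi>_bound])
  note Z2 = Z_square[OF t \<tau>]
  have point: "\<bar>(f (XN t \<omega>) - f (Xf t \<omega>)) - \<xi> \<omega> \<bullet> Z t \<omega>\<bar> \<le> F2 * (norm (Z t \<omega>))\<^sup>2" for \<omega>
    using taylor_lipschitz_gradient[OF f_diff f_hess, of "XN t \<omega>" "Xf t \<omega>"] by (simp add: \<xi>_inner Z_def)
  have "\<bar>\<integral>\<omega>. (f (XN t \<omega>) - f (Xf t \<omega>)) - \<xi> \<omega> \<bullet> Z t \<omega> \<partial>M\<bar>
      \<le> (\<integral>\<omega>. \<bar>(f (XN t \<omega>) - f (Xf t \<omega>)) - \<xi> \<omega> \<bullet> Z t \<omega>\<bar> \<partial>M)"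
    by (rule integral_abs_bound)
  also have "\<dots> \<le> (\<integral>\<omega>. F2 * (norm (Z t \<omega>))\<^sup>2 \<partial>M)"
    using int \<xi>Z Z2(1) point by (intro integral_mono) auto
  also have "\<dots> \<le> F2 * V \<tau>" using Z2 F2 by (simp add: mult_left_mono)
  finally have "\<bar>(\<integral>\<omega>. f (XN t \<omega>) - f (Xf t \<omega>) \<partial>M) - (\<integral>\<omega>. \<xi> \<omega> \<bullet> Z t \<omega> \<partial>M)\<bar> \<le> F2 * V \<tau>"
    by (simp only: Bochner_Integration.integral_diff[OF int \<xi>Z])
  then show "\<bar>\<integral>\<omega>. f (XN t \<omega>) - f (Xf t \<omega>) \<partial>M\<bar> \<le> F1 * (H * V \<tau> * \<tau> * exp (L * \<tau>)) + F2 * V \<tau>"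
    using pairing_bound_scaled[OF t \<tau> \<xi>_meas \<xi>_bound] by linarith
qed

end

section \<open>Transfer to the given processes\<close>

lemma ode_solution_cong_AE:
  assumes x: "ode_solution b x0 x" and Z: "Z \<in> null_sets lborel"
    and b': "\<And>t. 0 \<le> t \<Longrightarrow> t \<notin> Z \<Longrightarrow> b' t = b t" "\<And>t. t \<in> Z \<Longrightarrow> b' t = (\<lambda>_. 0)"
  shows "ode_solution b' x0 x"
  unfolding ode_solution_def
proof (intro allI impI)
  fix t :: real assume "0 \<le> t"
  then have int: "integrable lborel (\<lambda>s. indicator {0..t} s *\<^sub>R b s (x s))"
    and xt: "x t = x0 + (\<integral>s. indicator {0..t} s *\<^sub>R b s (x s) \<partial>lborel)"
    using x by (auto simp: ode_solution_def set_integrable_def set_lebesgue_integral_def)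
  have [measurable]: "Z \<in> sets borel" using Z by auto
  have eq: "(\<lambda>s. indicator {0..t} s *\<^sub>R b' s (x s))
      = (\<lambda>s. indicator (- Z) s *\<^sub>R (indicator {0..t} s *\<^sub>R b s (x s)))"
  proof
    fix s
    show "indicator {0..t} s *\<^sub>R b' s (x s) = indicator (- Z) s *\<^sub>R (indicator {0..t} s *\<^sub>R b s (x s))"
      using b'[of s] by (cases "s \<in> Z"; cases "s \<in> {0..t}") simp_all
  qed
  have int': "integrable lborel (\<lambda>s. indicator {0..t} s *\<^sub>R b' s (x s))"
    unfolding eq using int by (rule integrable_mult_indicator[rotated]) auto
  have "AE s in lborel. indicator {0..t} s *\<^sub>R b' s (x s) = indicator {0..t} s *\<^sub>R b s (x s)"
    using AE_not_in[OF Z] 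
  proof eventually_elim
    case (elim s)
    then show ?case using b'(1)[of s] by (cases "s \<in> {0..t}") simp_all
  qed
  then have "(\<integral>s. indicator {0..t} s *\<^sub>R b' s (x s) \<partial>lborel) = (\<integral>s. indicator {0..t} s *\<^sub>R b s (x s) \<partial>lborel)"
    using int int' by (intro integral_cong_AE) auto
  then show "set_integrable lborel {0..t} (\<lambda>s. b' s (x s)) \<and> x t = x0 + (LINT s:{0..t}|lborel. b' s (x s))"
    using int' xt by (simp add: set_integrable_def set_lebesgue_integral_def)
qed

context poisson_approximation
begin

text \<open>The given solution coincides almost surely, for all times at once, with the scheme driven by the
  regular version and the regularised field: their jump times agree, and the two fields
  agree at all of them.\<close>

lemma regular_scheme:
  assumes \<epsilon>: "0 < \<epsilon>" "\<epsilon> < 1"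
  obtains G N' b' where
    "jump_scheme M (1 / \<epsilon>) G N' b' (enn2real (Linf_norm b)) (enn2real (Linf_grad b)) X0"
    and "AE \<omega> in M. ode_solution b' (X0 \<omega>) (\<lambda>t. X t \<omega>)"
    and "AE \<omega> in M. \<forall>t\<ge>0. Xe \<epsilon> t \<omega> = jump_chain \<epsilon> b' (counting_path.jump_time (\<lambda>t. N' t \<omega>)) (X0 \<omega>) (N' t \<omega>)"
    and "\<And>t x. Linf_hess b < \<infinity> \<Longrightarrow> b' t differentiable (at x)"
    and "\<And>t. Linf_hess b < \<infinity> \<Longrightarrow> (enn2real (Linf_hess b))-lipschitz_on UNIV (gradient_map (b' t))"
proof -
  obtain b' Z where Z: "Z \<in> null_sets lborel"
    and b'_meas: "(\<lambda>(t, x). b' t x) \<in> borel_measurable (borel \<Otimes>\<^sub>M borel)"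
    and b'_bound: "\<And>t x. norm (b' t x) \<le> enn2real (Linf_norm b)"
    and b'_lip: "\<And>t. (enn2real (Linf_grad b))-lipschitz_on UNIV (b' t)"
    and b'_eq: "\<And>t. 0 \<le> t \<Longrightarrow> t \<notin> Z \<Longrightarrow> b' t = b t" and b'_0: "\<And>t. t \<in> Z \<Longrightarrow> b' t = (\<lambda>_. 0)"
    and b'_diff: "\<And>t x. Linf_hess b < \<infinity> \<Longrightarrow> b' t differentiable (at x)"
    and b'_hess: "\<And>t. Linf_hess b < \<infinity> \<Longrightarrow> (enn2real (Linf_hess b))-lipschitz_on UNIV (gradient_map (b' t))"
    by (rule regularized_field[OF b_measurable b_finite]) (rule that; assumption)
  interpret P: poisson_with_initial_field M "1 / \<epsilon>" F0 "\<lambda>t. N (t / \<epsilon>)"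
    using rescaled_initial_field[OF \<epsilon>(1)] .
  obtain G N' where GN: "poisson_counting M (1 / \<epsilon>) G N'"
    and F0_G: "\<And>s. sets F0 \<subseteq> sets (G s)" and N'_eq: "AE \<omega> in M. \<forall>t\<ge>0. N' t \<omega> = N (t / \<epsilon>) \<omega>"
    by (rule P.counting_version) (rule that; assumption)
  interpret C: poisson_counting M "1 / \<epsilon>" G N' by (rule GN)
  have "X0 \<in> borel_measurable (G s)" for s
    using X0_measurable F0_sub F0_G
    by (rule_tac measurable_from_subalg) (auto simp: subalgebra_def C.G_space)
  then have scheme: "jump_scheme M (1 / \<epsilon>) G N' b' (enn2real (Linf_norm b)) (enn2real (Linf_grad b)) X0"
    using b'_meas b'_bound b'_lip
    by (intro jump_scheme.intro jump_scheme_axioms.intro lipschitz_field.intro GN) auto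
  have ode: "AE \<omega> in M. ode_solution b' (X0 \<omega>) (\<lambda>t. X t \<omega>)"
    using X_solution by eventually_elim (rule ode_solution_cong_AE[OF _ Z b'_eq b'_0])
  have jump: "AE \<omega> in M. \<forall>t\<ge>0. Xe \<epsilon> t \<omega>
      = jump_chain \<epsilon> b' (counting_path.jump_time (\<lambda>t. N' t \<omega>)) (X0 \<omega>) (N' t \<omega>)"
    using Xe_solution[OF \<epsilon>] N'_eq C.jumps_avoid_null_set[OF Z] AE_space
  proof eventually_elim
    case (elim \<omega>)
    note path = C.path[OF elim(4)]
    have field: "b (counting_path.jump_time (\<lambda>t. N' t \<omega>) k) = b' (counting_path.jump_time (\<lambda>t. N' t \<omega>) k)" for k
      using elim(3) counting_path.jump_time_pos[OF path, of k]
      by (intro b'_eq[symmetric]) (auto simp: C.T_def less_imp_le)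
    show ?case
    proof (intro allI impI)
      fix t :: real assume t: "0 \<le> t"
      have "Xe \<epsilon> t \<omega> = jump_chain \<epsilon> b (counting_path.jump_time (\<lambda>t. N' t \<omega>)) (X0 \<omega>) (N' t \<omega>)"
        using elim(2) by (intro counting_path.jump_solution_unique[OF path elim(1) _ t]) simp
      also have "\<dots> = jump_chain \<epsilon> b' (counting_path.jump_time (\<lambda>t. N' t \<omega>)) (X0 \<omega>) (N' t \<omega>)"
        by (intro jump_chain_cong field)
      finally show "Xe \<epsilon> t \<omega>
          = jump_chain \<epsilon> b' (counting_path.jump_time (\<lambda>t. N' t \<omega>)) (X0 \<omega>) (N' t \<omega>)" .
    qed
  qed
  show ?thesis by (rule that[OF scheme ode jump b'_diff b'_hess])
qed

lemma strong_convergence: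
  assumes \<epsilon>: "0 < \<epsilon>" "\<epsilon> < 1" and \<tau>: "0 < \<tau>"
  shows "(\<integral>\<^sup>+\<omega>. (SUP t\<in>{0..\<tau>}. ennreal ((norm (Xe \<epsilon> t \<omega> - X t \<omega>))\<^sup>2)) \<partial>M)
    \<le> ennreal (4 * exp (2 * enn2real (Linf_grad b) * \<tau>) * (enn2real (Linf_norm b))\<^sup>2 * \<tau> * \<epsilon>)"
proof -
  obtain G N' b' where scheme: "jump_scheme M (1 / \<epsilon>) G N' b' (enn2real (Linf_norm b)) (enn2real (Linf_grad b)) X0"
    and ode: "AE \<omega> in M. ode_solution b' (X0 \<omega>) (\<lambda>t. X t \<omega>)"
    and Xe: "AE \<omega> in M. \<forall>t\<ge>0. Xe \<epsilon> t \<omega> = jump_chain \<epsilon> b' (counting_path.jump_time (\<lambda>t. N' t \<omega>)) (X0 \<omega>) (N' t \<omega>)"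
    by (rule regular_scheme[OF \<epsilon>]) blast
  interpret J: jump_scheme M "1 / \<epsilon>" G N' b' "enn2real (Linf_norm b)" "enn2real (Linf_grad b)" X0
    by (rule scheme)
  have "AE \<omega> in M. (SUP t\<in>{0..\<tau>}. ennreal ((norm (Xe \<epsilon> t \<omega> - X t \<omega>))\<^sup>2))
      = (SUP t\<in>{0..\<tau>}. ennreal ((norm (J.XN t \<omega> - X t \<omega>))\<^sup>2))"
    using Xe by eventually_elim (auto intro!: SUP_cong simp: J.XN_def J.Y_def J.T_def)
  then have "(\<integral>\<^sup>+\<omega>. (SUP t\<in>{0..\<tau>}. ennreal ((norm (Xe \<epsilon> t \<omega> - X t \<omega>))\<^sup>2)) \<partial>M)
      = (\<integral>\<^sup>+\<omega>. (SUP t\<in>{0..\<tau>}. ennreal ((norm (J.XN t \<omega> - X t \<omega>))\<^sup>2)) \<partial>M)"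
    by (rule nn_integral_cong_AE)
  then show ?thesis using J.strong_error[OF ode \<tau>] by simp
qed

lemma weak_convergence:
  fixes f :: "'v \<Rightarrow> real"
  assumes hess: "Linf_hess b < \<infinity>" and K: "C2b_norm b = ennreal K" "0 \<le> K"
    and f: "grad_C1b_norm f < \<infinity>" and \<epsilon>: "0 < \<epsilon>" "\<epsilon> < 1" and t: "0 \<le> t" "t \<le> \<tau>" and \<tau>: "0 < \<tau>"
  shows "integrable M (\<lambda>\<omega>. f (Xe \<epsilon> t \<omega>) - f (X t \<omega>))"
    and "\<bar>\<integral>\<omega>. f (Xe \<epsilon> t \<omega>) - f (X t \<omega>) \<partial>M\<bar>
      \<le> (4 * exp (2 * K * \<tau>) * K\<^sup>2 * \<tau>) * (K * \<tau> * exp (K * \<tau>) + 1) * enn2real (grad_C1b_norm f) * \<epsilon>"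
proof -
  define B L H where BLH: "B = enn2real (Linf_norm b)" "L = enn2real (Linf_grad b)" "H = enn2real (Linf_hess b)"
  define F1 F2 where F: "F1 = enn2real (grad_norm f)" "F2 = enn2real (hess_norm f)"
  have nn: "0 \<le> B" "0 \<le> L" "0 \<le> H" "0 \<le> F1" "0 \<le> F2" by (auto simp: BLH F)
  have le_K: "enn2real x \<le> K" if "x \<le> C2b_norm b" for x
    using enn2real_mono[OF that] K by simp
  have BLH_K: "B \<le> K" "L \<le> K" "H \<le> K"
    unfolding BLH by (auto intro!: le_K simp: C2b_norm_def add_increasing add_increasing2)
  have f_fin: "grad_norm f < \<infinity>" "hess_norm f < \<infinity>"
    using f by (auto simp: grad_C1b_norm_def less_top)
  have F_sum: "enn2real (grad_C1b_norm f) = F1 + F2"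
    using f_fin by (simp add: grad_C1b_norm_def F enn2real_plus)
  have f_diff: "\<forall>x. f differentiable (at x)" using f_fin(2) by (auto simp: hess_norm_def split: if_splits)
  have f_lip: "F1-lipschitz_on UNIV f"
    using f_fin nn by (intro grad_norm_lipschitz) (auto simp: F less_top)
  have f_hess: "F2-lipschitz_on UNIV (gradient_map f)"
    using f_fin nn f_diff by (intro grad_norm_lipschitz) (auto simp: F less_top hess_norm_def)
  have [measurable]: "f \<in> borel_measurable borel"
    using lipschitz_on_continuous_on[OF f_lip] by (rule borel_measurable_continuous_onI)
  have [measurable]: "Xe \<epsilon> t \<in> borel_measurable M" "X t \<in> borel_measurable M"
    using Xe_measurable[OF \<epsilon> t(1)] X_measurable[OF t(1)] .
  obtain G N' b' where scheme: "jump_scheme M (1 / \<epsilon>) G N' b' B L X0"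
    and ode: "AE \<omega> in M. ode_solution b' (X0 \<omega>) (\<lambda>t. X t \<omega>)"
    and Xe: "AE \<omega> in M. \<forall>t\<ge>0. Xe \<epsilon> t \<omega> = jump_chain \<epsilon> b' (counting_path.jump_time (\<lambda>t. N' t \<omega>)) (X0 \<omega>) (N' t \<omega>)"
    and b'_diff: "\<And>t x. b' t differentiable (at x)"
    and b'_hess: "\<And>t. H-lipschitz_on UNIV (gradient_map (b' t))"
    unfolding BLH by (rule regular_scheme[OF \<epsilon>]) (use hess in blast)
  interpret J: jump_scheme M "1 / \<epsilon>" G N' b' B L X0 by (rule scheme)
  interpret S: smooth_jump_scheme M "1 / \<epsilon>" G N' b' B L X0 H X
    by (intro smooth_jump_scheme.intro smooth_jump_scheme_axioms.intro scheme b'_diff b'_hess ode)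
  have eq: "AE \<omega> in M. f (Xe \<epsilon> t \<omega>) - f (X t \<omega>) = f (J.XN t \<omega>) - f (S.Xf t \<omega>)"
    using Xe S.Xf_eq_X by eventually_elim (use t in \<open>simp add: J.XN_def J.Y_def J.T_def\<close>)
  note weak = S.weak_error[OF f_diff[rule_format] f_lip f_hess t \<tau>]
  show "integrable M (\<lambda>\<omega>. f (Xe \<epsilon> t \<omega>) - f (X t \<omega>))"
    using weak(1) eq by (subst integrable_cong_AE) auto
  have "(\<integral>\<omega>. f (Xe \<epsilon> t \<omega>) - f (X t \<omega>) \<partial>M) = (\<integral>\<omega>. f (J.XN t \<omega>) - f (S.Xf t \<omega>) \<partial>M)"
    using eq by (intro integral_cong_AE) auto
  then have "\<bar>\<integral>\<omega>. f (Xe \<epsilon> t \<omega>) - f (X t \<omega>) \<partial>M\<bar> \<le> F1 * (H * S.V \<tau> * \<tau> * exp (L * \<tau>)) + F2 * S.V \<tau>"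
    using weak(2) by simp
  also have "\<dots> \<le> (F1 + F2) * (S.V \<tau> * (K * \<tau> * exp (K * \<tau>) + 1))"
  proof -
    have V0: "0 \<le> S.V \<tau>" using \<tau> by (intro S.V_nonneg) simp
    have "H * \<tau> * exp (L * \<tau>) \<le> K * \<tau> * exp (K * \<tau>)"
      using BLH_K nn \<tau> K by (intro mult_mono) auto
    then have "S.V \<tau> * (H * \<tau> * exp (L * \<tau>)) \<le> S.V \<tau> * (K * \<tau> * exp (K * \<tau>) + 1)"
      using V0 by (intro mult_left_mono) auto
    then have "F1 * (S.V \<tau> * (H * \<tau> * exp (L * \<tau>))) \<le> F1 * (S.V \<tau> * (K * \<tau> * exp (K * \<tau>) + 1))"
      using nn(4) by (rule mult_left_mono)
    moreover have "S.V \<tau> * 1 \<le> S.V \<tau> * (K * \<tau> * exp (K * \<tau>) + 1)"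
      using V0 K \<tau> by (intro mult_left_mono) auto
    then have "F2 * S.V \<tau> \<le> F2 * (S.V \<tau> * (K * \<tau> * exp (K * \<tau>) + 1))"
      using nn(5) by (intro mult_left_mono) auto
    ultimately show ?thesis by (simp add: distrib_right mult_ac)
  qed
  also have "\<dots> \<le> (F1 + F2) * ((4 * exp (2 * K * \<tau>) * K\<^sup>2 * \<tau> * \<epsilon>) * (K * \<tau> * exp (K * \<tau>) + 1))"
  proof (intro mult_left_mono mult_right_mono)
    have "exp (2 * L * \<tau>) * B\<^sup>2 \<le> exp (2 * K * \<tau>) * K\<^sup>2"
      using BLH_K nn \<tau> by (intro mult_mono power_mono) auto
    then have "(exp (2 * L * \<tau>) * B\<^sup>2) * (4 * \<tau> * \<epsilon>) \<le> (exp (2 * K * \<tau>) * K\<^sup>2) * (4 * \<tau> * \<epsilon>)"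
      using \<tau> \<epsilon> by (intro mult_right_mono) auto
    then show "S.V \<tau> \<le> 4 * exp (2 * K * \<tau>) * K\<^sup>2 * \<tau> * \<epsilon>"
      by (simp add: S.V_def mult_ac)
  qed (use nn K \<tau> in auto)
  finally show "\<bar>\<integral>\<omega>. f (Xe \<epsilon> t \<omega>) - f (X t \<omega>) \<partial>M\<bar>
      \<le> (4 * exp (2 * K * \<tau>) * K\<^sup>2 * \<tau>) * (K * \<tau> * exp (K * \<tau>) + 1) * enn2real (grad_C1b_norm f) * \<epsilon>"
    by (simp add: F_sum mult_ac)
qed

end

theorem theorem2p1:
  shows
  "(\<forall>(M :: 'a measure) F0 N (b :: real \<Rightarrow> 'v::euclidean_space \<Rightarrow> 'v) X0 X Xe.
      poisson_approximation M F0 N b X0 X Xe \<longrightarrow>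
      (\<forall>T>0. \<forall>\<epsilon>\<in>{0<..<1}.
        (\<integral>\<^sup>+\<omega>. (SUP t\<in>{0..T}. ennreal ((norm (Xe \<epsilon> t \<omega> - X t \<omega>))\<^sup>2)) \<partial>M)
          \<le> ennreal (4 * exp (2 * enn2real (Linf_grad b) * T) * (enn2real (Linf_norm b))\<^sup>2 * T * \<epsilon>)))
   \<and>
   (\<forall>T>0. \<forall>K\<ge>0. \<exists>C>0.
      \<forall>(M :: 'a measure) F0 N (b :: real \<Rightarrow> 'v \<Rightarrow> 'v) X0 X Xe.
        poisson_approximation M F0 N b X0 X Xe \<and> Linf_hess b < \<infinity> \<and> C2b_norm b = ennreal K \<longrightarrow>
        (\<forall>f :: 'v \<Rightarrow> real. grad_C1b_norm f < \<infinity> \<longrightarrow>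
          (\<forall>t\<in>{0..T}. \<forall>\<epsilon>\<in>{0<..<1}.
             integrable M (\<lambda>\<omega>. f (Xe \<epsilon> t \<omega>) - f (X t \<omega>)) \<and>
             \<bar>\<integral>\<omega>. f (Xe \<epsilon> t \<omega>) - f (X t \<omega>) \<partial>M\<bar> \<le> C * enn2real (grad_C1b_norm f) * \<epsilon> \<and>
             \<bar>(\<integral>\<omega>. f (Xe \<epsilon> t \<omega>) \<partial>M) - (\<integral>\<omega>. f (X t \<omega>) \<partial>M)\<bar>
               \<le> C * enn2real (grad_C1b_norm f) * \<epsilon>)))"
    (is "?strong \<and> (\<forall>T>0. \<forall>K\<ge>0. \<exists>C>0. ?weak T K C)")
proof
  show ?strong
    by (intro allI impI ballI poisson_approximation.strong_convergence) auto
  show "\<forall>T>0. \<forall>K\<ge>0. \<exists>C>0. ?weak T K C"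
  proof (intro allI impI)
    fix \<tau> K :: real assume \<tau>: "0 < \<tau>" and K: "0 \<le> K"
    define C0 where "C0 = (4 * exp (2 * K * \<tau>) * K\<^sup>2 * \<tau>) * (K * \<tau> * exp (K * \<tau>) + 1)"
    have C0: "0 \<le> C0" using \<tau> K by (simp add: C0_def)
    have main: "integrable M (\<lambda>\<omega>. f (Xe \<epsilon> t \<omega>) - f (X t \<omega>)) \<and>
         \<bar>\<integral>\<omega>. f (Xe \<epsilon> t \<omega>) - f (X t \<omega>) \<partial>M\<bar> \<le> (C0 + 1) * enn2real (grad_C1b_norm f) * \<epsilon> \<and>
         \<bar>(\<integral>\<omega>. f (Xe \<epsilon> t \<omega>) \<partial>M) - (\<integral>\<omega>. f (X t \<omega>) \<partial>M)\<bar> \<le> (C0 + 1) * enn2real (grad_C1b_norm f) * \<epsilon>"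
      if pa: "poisson_approximation M F0 N b X0 X Xe" and b: "Linf_hess b < \<infinity>" "C2b_norm b = ennreal K"
        and f: "grad_C1b_norm f < \<infinity>" and t: "t \<in> {0..\<tau>}" and \<epsilon>: "\<epsilon> \<in> {0<..<1}"
      for M :: "'a measure" and F0 N and b :: "real \<Rightarrow> 'v \<Rightarrow> 'v" and X0 X Xe and f :: "'v \<Rightarrow> real" and t \<epsilon>
    proof -
      interpret poisson_approximation M F0 N b X0 X Xe by (rule pa)
      have t': "0 \<le> t" "t \<le> \<tau>" and \<epsilon>': "0 < \<epsilon>" "\<epsilon> < 1" using t \<epsilon> by auto
      note weak = weak_convergence[OF b K f \<epsilon>' t' \<tau>, folded C0_def]
      have "C0 * enn2real (grad_C1b_norm f) * \<epsilon> \<le> (C0 + 1) * enn2real (grad_C1b_norm f) * \<epsilon>"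
        using \<epsilon>' by (intro mult_right_mono) auto
      then have bound: "\<bar>\<integral>\<omega>. f (Xe \<epsilon> t \<omega>) - f (X t \<omega>) \<partial>M\<bar> \<le> (C0 + 1) * enn2real (grad_C1b_norm f) * \<epsilon>"
        using weak(2) by linarith
      have "\<bar>(\<integral>\<omega>. f (Xe \<epsilon> t \<omega>) \<partial>M) - (\<integral>\<omega>. f (X t \<omega>) \<partial>M)\<bar> \<le> (C0 + 1) * enn2real (grad_C1b_norm f) * \<epsilon>"
      \<comment> \<open>The two variables differ by an integrable one, so either both are integrable or both expectations are \<open>0\<close> by convention.\<close>
      proof (cases "integrable M (\<lambda>\<omega>. f (X t \<omega>))")
        case True
        have "integrable M (\<lambda>\<omega>. f (Xe \<epsilon> t \<omega>))"
          using Bochner_Integration.integrable_add[OF weak(1) True] by simp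
        then show ?thesis using bound True by simp
      next
        case False
        have "\<not> integrable M (\<lambda>\<omega>. f (Xe \<epsilon> t \<omega>))"
        proof
          assume "integrable M (\<lambda>\<omega>. f (Xe \<epsilon> t \<omega>))"
          from Bochner_Integration.integrable_diff[OF this weak(1)] False show False by simp
        qed
        then show ?thesis using False C0 \<epsilon>' by (simp add: not_integrable_integral_eq)
      qed
      then show ?thesis using weak(1) bound by blast
    qed
    show "\<exists>C>0. ?weak \<tau> K C"
      using C0 main by (intro exI[of _ "C0 + 1"] conjI allI impI ballI) auto
  qed
qed

end
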